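(* Let $N\ge1$, let $f\in S_2(\Gamma_1(N))$, and let $u,v\in\mathcal{O}^\times(Y_1(N)(\mathbf{C}))$ be modular units. Then \[ \int_{X_1(N)(\mathbf{C})}\eta(u,v)\wedge\omega_f=\frac{\pi}{2}\sum_{x\in E_N}\left(\int_{g_x\rho}^{g_x\rho^2}\eta(u,v)\right)\xi_f(x). \]
   Context: $\omega_f=2\pi i f(z)\,dz$; $\eta(u,v)=\log|u|\,d\arg(v)-\log|v|\,d\arg(u)$ (a closed $1$-form on the upper half-plane $\mathfrak{H}$, pulled back from $Y_1(N)$, so the path integral in $\mathfrak{H}$ from $g_x\rho$ to $g_x\rho^2$ is path-independent). $E_N$ is the set of $(a,b)\in(\mathbf{Z}/N\mathbf{Z})^2$ with $\gcd(a,b,N)=1$; for $x\in E_N$, $g_x\in\mathrm{SL}_2(\mathbf{Z})$ is any matrix whose bottom row is congruent to $x$ mod $N$. The Manin symbol is $\xi_f(x)=-i\int_{g_x0}^{g_x\infty}f(z)\,dz$. $\rho=e^{\pi i/3}$. *)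

theory Defs
  imports "HOL-Complex_Analysis.Complex_Analysis" "HOL-Number_Theory.Cong"
begin

definition upper_half_plane :: "complex set" where
  "upper_half_plane = {z. Im z > 0}"

definition SL2Z :: "(int ^ 2 ^ 2) set" where
  "SL2Z = {A. det A = 1}"

definition Gamma1 :: "nat \<Rightarrow> (int ^ 2 ^ 2) set" where
  "Gamma1 N = {A \<in> SL2Z. [A $ 1 $ 1 = 1] (mod int N) \<and> [A $ 2 $ 1 = 0] (mod int N)
                      \<and> [A $ 2 $ 2 = 1] (mod int N)}"

definition aut_factor :: "int ^ 2 ^ 2 \<Rightarrow> complex \<Rightarrow> complex" where
  "aut_factor A z = of_int (A $ 2 $ 1) * z + of_int (A $ 2 $ 2)"

definition act :: "int ^ 2 ^ 2 \<Rightarrow> complex \<Rightarrow> complex" where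
  "act A z = (of_int (A $ 1 $ 1) * z + of_int (A $ 1 $ 2)) / aut_factor A z"

definition q_param :: "nat \<Rightarrow> complex \<Rightarrow> complex" where
  "q_param N z = exp (2 * of_real pi * \<i> * z / of_nat N)"

text \<open>Every cusp of \<open>\<Gamma>\<^sub>1(N)\<close> is of the form \<open>A \<infinity>\<close> with \<open>A\<close> in \<open>SL\<^sub>2(\<int>)\<close>, and
  \<open>f|\<^sub>2 A\<close> is \<open>N\<close>-periodic. So the conditions at the cusps below are stated through the expansions
  of \<open>f|\<^sub>2 A\<close> in \<open>q\<^sub>N = exp (2 \<pi> i z / N)\<close>, for all \<open>A\<close>. Functions on the quotient are
  represented by functions on the upper half-plane; their values elsewhere are irrelevant.\<close>

definition cusp_forms2 :: "nat \<Rightarrow> (complex \<Rightarrow> complex) set" where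
  "cusp_forms2 N = {f. f holomorphic_on upper_half_plane
     \<and> (\<forall>A \<in> Gamma1 N. \<forall>z \<in> upper_half_plane. f (act A z) = aut_factor A z ^ 2 * f z)
     \<and> (\<forall>A \<in> SL2Z. \<exists>a :: nat \<Rightarrow> complex. a 0 = 0 \<and>
          (\<forall>z \<in> upper_half_plane.
             (\<lambda>n. a n * q_param N z ^ n) sums (f (act A z) / aut_factor A z ^ 2)))}"

text \<open>The ring of regular functions on the affine algebraic curve \<open>Y\<^sub>1(N)\<close> over the complex numbers:
  the meromorphic functions on \<open>X\<^sub>1(N)(\<complex>)\<close> whose poles are all at cusps.\<close>

definition regular_functions_Y1 :: "nat \<Rightarrow> (complex \<Rightarrow> complex) set" where
  "regular_functions_Y1 N = {u. u holomorphic_on upper_half_plane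
     \<and> (\<forall>A \<in> Gamma1 N. \<forall>z \<in> upper_half_plane. u (act A z) = u z)
     \<and> (\<forall>A \<in> SL2Z. \<exists>(m :: int) (a :: nat \<Rightarrow> complex).
          \<forall>z \<in> upper_half_plane. (\<lambda>n. a n * q_param N z powi (m + int n)) sums u (act A z))}"

definition modular_units :: "nat \<Rightarrow> (complex \<Rightarrow> complex) set" where
  "modular_units N = {u \<in> regular_functions_Y1 N.
     \<exists>w \<in> regular_functions_Y1 N. \<forall>z \<in> upper_half_plane. u z * w z = 1}"

text \<open>A complex-valued 1-form assigns to a point \<open>z\<close> and a tangent vector \<open>w\<close> a number, real-linearly
  in \<open>w\<close>; a 2-form takes two tangent vectors.\<close>

type_synonym form1 = "complex \<Rightarrow> complex \<Rightarrow> complex"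
type_synonym form2 = "complex \<Rightarrow> complex \<Rightarrow> complex \<Rightarrow> complex"

text \<open>The argument is multivalued, but its differential is \<open>d arg u = Im (du / u)\<close>.\<close>

definition darg :: "(complex \<Rightarrow> complex) \<Rightarrow> complex \<Rightarrow> complex \<Rightarrow> real" where
  "darg u z w = Im (deriv u z * w / u z)"

definition eta :: "(complex \<Rightarrow> complex) \<Rightarrow> (complex \<Rightarrow> complex) \<Rightarrow> form1" where
  "eta u v z w = of_real (ln (cmod (u z)) * darg v z w - ln (cmod (v z)) * darg u z w)"

definition omega :: "(complex \<Rightarrow> complex) \<Rightarrow> form1" where
  "omega f z w = 2 * of_real pi * \<i> * f z * w"

definition wedge :: "form1 \<Rightarrow> form1 \<Rightarrow> form2" where
  "wedge \<alpha> \<beta> z w\<^sub>1 w\<^sub>2 = \<alpha> z w\<^sub>1 * \<beta> z w\<^sub>2 - \<alpha> z w\<^sub>2 * \<beta> z w\<^sub>1"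

definition path_integral1 :: "form1 \<Rightarrow> (real \<Rightarrow> complex) \<Rightarrow> complex" where
  "path_integral1 \<alpha> p = integral {0..1} (\<lambda>t. \<alpha> (p t) (vector_derivative p (at t within {0..1})))"

text \<open>In the standard orientation \<open>dx \<and> dy\<close>, the coefficient of a 2-form \<open>\<Omega>\<close> is its value on the
  frame \<open>(1, i)\<close>.\<close>

definition integrable2 :: "complex set \<Rightarrow> form2 \<Rightarrow> bool" where
  "integrable2 D \<Omega> \<longleftrightarrow> set_integrable lborel D (\<lambda>z. \<Omega> z 1 \<i>)"

definition integral2 :: "complex set \<Rightarrow> form2 \<Rightarrow> complex" where
  "integral2 D \<Omega> = (LINT z:D|lborel. \<Omega> z 1 \<i>)"

text \<open>The quotient by \<open>\<Gamma>\<^sub>1(N)\<close> maps a set \<open>D\<close> as below bijectively onto \<open>Y\<^sub>1(N)(\<complex>)\<close>, which is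
  \<open>X\<^sub>1(N)(\<complex>)\<close> minus finitely many points. So the integral over \<open>X\<^sub>1(N)(\<complex>)\<close> of a 2-form is the
  integral over any such \<open>D\<close> of its pullback.\<close>

definition fundamental_domain :: "nat \<Rightarrow> complex set \<Rightarrow> bool" where
  "fundamental_domain N D \<longleftrightarrow> D \<in> sets borel \<and> D \<subseteq> upper_half_plane \<and>
     (\<forall>z \<in> upper_half_plane. \<exists>!w. w \<in> D \<and> (\<exists>A \<in> Gamma1 N. w = act A z))"

text \<open>Elements of \<open>(\<int>/N\<int>)\<^sup>2\<close> are given by their representatives in \<open>{0..<N}\<close>.\<close>

definition E_set :: "nat \<Rightarrow> (int \<times> int) set" where
  "E_set N = {(a, b). a \<in> {0..<int N} \<and> b \<in> {0..<int N} \<and> gcd (gcd a b) (int N) = 1}"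

definition lifts :: "nat \<Rightarrow> int ^ 2 ^ 2 \<Rightarrow> int \<times> int \<Rightarrow> bool" where
  "lifts N A x \<longleftrightarrow> A \<in> SL2Z \<and> [A $ 2 $ 1 = fst x] (mod int N) \<and> [A $ 2 $ 2 = snd x] (mod int N)"

text \<open>The integral of \<open>f(z) dz\<close> from the cusp \<open>A 0\<close> to the cusp \<open>A \<infinity>\<close> is taken along the image under
  \<open>A\<close> of the imaginary half-axis. In terms of a matrix \<open>A\<close> lifting \<open>x\<close>, this is \<open>\<xi>\<^sub>f(x)\<close>.\<close>

definition manin_symbol :: "(complex \<Rightarrow> complex) \<Rightarrow> int ^ 2 ^ 2 \<Rightarrow> complex" where
  "manin_symbol f A = - \<i> * (LINT t:{0<..}|lborel.
      f (act A (\<i> * of_real t)) * vector_derivative (\<lambda>s. act A (\<i> * of_real s)) (at t))"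

definition rho :: complex where
  "rho = exp (of_real pi * \<i> / 3)"

end

theory Submission
  imports Defs
begin

text \<open>Write \<open>\<alpha>\<^sub>A\<close> and \<open>f\<^sub>A\<close> for the translates of \<open>\<alpha> = \<eta>(u,v)\<close> and \<open>f\<close> by \<open>A\<close> in \<open>SL\<^sub>2(\<int>)\<close>; they
  depend only on the bottom row of \<open>A\<close> modulo \<open>N\<close>. Unfolding along the cosets of \<open>\<Gamma>\<^sub>1(N)\<close> turns
  twice the integral over \<open>D\<close> into the sum over \<open>E\<^sub>N\<close> of the integrals of the translated 2-form over the
  standard domain \<open>\<bar>Re z\<bar> \<le> 1/2\<close>, \<open>\<bar>z\<bar> \<ge> 1\<close> of \<open>SL\<^sub>2(\<int>)\<close>.

  Let \<open>G\<^sub>A\<close> be the primitive of \<open>f\<^sub>A\<close> vanishing at \<open>i\<infinity>\<close>. As \<open>\<alpha>\<close> is closed, the 2-form is a multiple of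
  \<open>d(G\<^sub>A \<alpha>\<^sub>A)\<close>. By Stokes only the boundary remains: the contribution of the cusp is zero because
  \<open>G\<^sub>A\<close> decays exponentially and \<open>\<alpha>\<^sub>A\<close> grows at most linearly, the vertical sides cancel in the sum over
  \<open>E\<^sub>N\<close> by \<open>z \<mapsto> z + 1\<close>, and on the arc the inversion \<open>z \<mapsto> -1/z\<close>, which reverses the arc and satisfies
  \<open>G\<^sub>A(-1/z) = G\<^sub>A\<^sub>S(z) - I\<^sub>A\<close> with \<open>I\<^sub>A\<close> the integral of \<open>f\<^sub>A\<close> from \<open>0\<close> to \<open>i\<infinity>\<close>, leaves half of
  the sum of \<open>I\<^sub>A\<close> times the integral of \<open>\<alpha>\<^sub>A\<close> along the arc.\<close>

text \<open>The factor 2 in the unfolding comes from \<open>- mat 1\<close>: it acts trivially but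
  lies outside \<open>Gamma1 N\<close> once N \<ge> 3, so almost every point of \<open>D\<close> is
  reached from the standard domain by exactly two matrices. Since \<open>D\<close> is an arbitrary
  Borel set of representatives, it has no boundary to which Stokes could be applied; the passage to
  the standard domain is therefore made by Fubini on the product of \<open>SL2Z\<close> with the
  half-plane, and boundaries appear only afterwards. Closedness and path independence both come from
  holomorphic logarithms L and M of u and v: \<eta>(u,v) = Re L d(Im M) - Re M d(Im L), and this
  form has an explicit potential H. The constant arises as follows. The 2-form is - 2 \<pi> i times
  d(G \<alpha>), the arcs leave one half of the sum of I times the integral of \<alpha>, and \<xi> =
  - i I turns - \<pi> i I into \<pi> \<xi>; undoing the factor 2 of the unfolding gives
  \<pi>/2.\<close>

no_notation fps_nth (infixl "$" 75)

subsection \<open>The modular group\<close>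

lemma upper_half_plane_iff [simp]: "z \<in> upper_half_plane \<longleftrightarrow> Im z > 0"
  by (simp add: upper_half_plane_def)

lemma open_upper_half_plane: "open upper_half_plane"
  unfolding upper_half_plane_def by (rule open_halfspace_Im_gt)

lemma convex_upper_half_plane: "convex upper_half_plane"
  unfolding upper_half_plane_def by (rule convex_halfspace_Im_gt)

definition mat2 :: "int \<Rightarrow> int \<Rightarrow> int \<Rightarrow> int \<Rightarrow> int ^ 2 ^ 2" where
  "mat2 a b c d = vector [vector [a, b], vector [c, d]]"

lemma mat2_nth [simp]:
  "mat2 a b c d $ 1 $ 1 = a" "mat2 a b c d $ 1 $ 2 = b"
  "mat2 a b c d $ 2 $ 1 = c" "mat2 a b c d $ 2 $ 2 = d"
  by (simp_all add: mat2_def)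

lemma mult_nth [simp]:
  fixes A B :: "int ^ 2 ^ 2"
  shows "(A ** B) $ i $ j = A $ i $ 1 * B $ 1 $ j + A $ i $ 2 * B $ 2 $ j"
  by (simp add: matrix_matrix_mult_def sum_2)

lemma mat2_eqI:
  fixes A B :: "int ^ 2 ^ 2"
  assumes "A $ 1 $ 1 = B $ 1 $ 1" "A $ 1 $ 2 = B $ 1 $ 2" "A $ 2 $ 1 = B $ 2 $ 1" "A $ 2 $ 2 = B $ 2 $ 2"
  shows "A = B"
  using assms by (simp add: vec_eq_iff forall_2)

lemma SL2Z_iff: "A \<in> SL2Z \<longleftrightarrow> A $ 1 $ 1 * A $ 2 $ 2 - A $ 1 $ 2 * A $ 2 $ 1 = 1"
  by (simp add: SL2Z_def det_2)

lemma SL2Z_mult: "A \<in> SL2Z \<Longrightarrow> B \<in> SL2Z \<Longrightarrow> A ** B \<in> SL2Z"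
  by (simp add: SL2Z_def det_mul)

definition minv :: "int ^ 2 ^ 2 \<Rightarrow> int ^ 2 ^ 2" where
  "minv A = mat2 (A $ 2 $ 2) (- A $ 1 $ 2) (- A $ 2 $ 1) (A $ 1 $ 1)"

lemma minv_SL2Z: "A \<in> SL2Z \<Longrightarrow> minv A \<in> SL2Z"
  by (simp add: SL2Z_iff minv_def mult.commute)

lemma minv_left: "A \<in> SL2Z \<Longrightarrow> minv A ** A = mat 1"
  by (rule mat2_eqI) (auto simp: minv_def SL2Z_iff mat_def algebra_simps)

lemma minv_right: "A \<in> SL2Z \<Longrightarrow> A ** minv A = mat 1"
  by (rule mat2_eqI) (auto simp: minv_def SL2Z_iff mat_def algebra_simps)

lemma mat_1_SL2Z: "mat 1 \<in> SL2Z"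
  by (simp add: SL2Z_iff mat_def)

lemma countable_SL2Z: "countable SL2Z"
proof -
  let ?h = "\<lambda>A :: int ^ 2 ^ 2. (A $ 1 $ 1, A $ 1 $ 2, A $ 2 $ 1, A $ 2 $ 2)"
  have "inj_on ?h SL2Z"
    by (rule inj_onI) (auto intro: mat2_eqI)
  then show ?thesis
    by (rule countableI')
qed

lemma aut_factor_nonzero:
  assumes "A \<in> SL2Z" "Im z > 0"
  shows "aut_factor A z \<noteq> 0"
proof
  assume 0: "aut_factor A z = 0"
  from arg_cong[OF this, of Im] have c: "A $ 2 $ 1 = 0"
    using assms by (simp add: aut_factor_def)
  with 0 have "A $ 2 $ 2 = 0"
    by (simp add: aut_factor_def)
  with c assms show False
    by (simp add: SL2Z_iff)
qed

lemma Im_act: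
  assumes "A \<in> SL2Z" "Im z > 0"
  shows "Im (act A z) = Im z / (cmod (aut_factor A z))\<^sup>2"
proof -
  obtain x y where z: "z = Complex x y" by (cases z)
  define a b c d where abcd: "a = real_of_int (A $ 1 $ 1)" "b = real_of_int (A $ 1 $ 2)"
    "c = real_of_int (A $ 2 $ 1)" "d = real_of_int (A $ 2 $ 2)"
  have det: "a * d - b * c = 1"
    using assms(1) unfolding SL2Z_iff abcd
    by (metis of_int_1 of_int_diff of_int_mult)
  have eq: "Im (act A z) = (a * y * (c * x + d) - (a * x + b) * (c * y)) / ((c * x + d)\<^sup>2 + (c * y)\<^sup>2)"
    by (simp add: act_def aut_factor_def z Im_divide abcd)
  have "a * y * (c * x + d) - (a * x + b) * (c * y) = y * (a * d - b * c)"
    by (simp add: algebra_simps)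
  then show ?thesis
    unfolding eq det by (simp add: z aut_factor_def cmod_power2 abcd)
qed

lemma Im_act_pos:
  assumes "A \<in> SL2Z" "Im z > 0"
  shows "Im (act A z) > 0"
  using assms aut_factor_nonzero[OF assms] by (simp add: Im_act)

lemma aut_factor_mult:
  assumes "A \<in> SL2Z" "B \<in> SL2Z" "Im z > 0"
  shows "aut_factor (A ** B) z = aut_factor A (act B z) * aut_factor B z"
  using aut_factor_nonzero[OF assms(2,3)]
  by (simp add: act_def aut_factor_def[of A] aut_factor_def[of "A ** B"] field_simps)
     (simp add: aut_factor_def algebra_simps)

lemma act_mult:
  assumes "A \<in> SL2Z" "B \<in> SL2Z" "Im z > 0"
  shows "act (A ** B) z = act A (act B z)"
proof -
  have nz: "aut_factor B z \<noteq> 0" "aut_factor A (act B z) \<noteq> 0"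
    using aut_factor_nonzero[of B z] aut_factor_nonzero[of A "act B z"] Im_act_pos[of B z] assms
    by auto
  have "of_int ((A ** B) $ 1 $ 1) * z + of_int ((A ** B) $ 1 $ 2)
      = (of_int (A $ 1 $ 1) * act B z + of_int (A $ 1 $ 2)) * aut_factor B z"
    using nz(1) by (simp add: act_def field_simps) (simp add: aut_factor_def algebra_simps)
  then show ?thesis
    unfolding act_def[of "A ** B"] act_def[of A] aut_factor_mult[OF assms]
    using nz by (simp only: mult_divide_mult_cancel_right not_False_eq_True)
qed

lemma act_mat_1 [simp]: "act (mat 1) z = z" "aut_factor (mat 1) z = 1"
  by (simp_all add: act_def aut_factor_def mat_def)

lemma act_minv [simp]:
  assumes "A \<in> SL2Z" "Im z > 0"
  shows "act A (act (minv A) z) = z" "act (minv A) (act A z) = z"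
  using assms act_mult[of A "minv A" z] act_mult[of "minv A" A z]
  by (auto simp: minv_left minv_right minv_SL2Z)

lemma has_field_derivative_act:
  assumes "A \<in> SL2Z" "Im z > 0"
  shows "(act A has_field_derivative 1 / (aut_factor A z)\<^sup>2) (at z within S)"
proof -
  have nz: "aut_factor A z \<noteq> 0"
    using assms by (rule aut_factor_nonzero)
  have det: "of_int (A $ 1 $ 1) * of_int (A $ 2 $ 2) - of_int (A $ 1 $ 2) * of_int (A $ 2 $ 1) = (1 :: complex)"
    using assms(1) unfolding SL2Z_iff by (metis of_int_1 of_int_diff of_int_mult)
  have "((\<lambda>z. (of_int (A $ 1 $ 1) * z + of_int (A $ 1 $ 2)) / aut_factor A z) has_field_derivative
     (of_int (A $ 1 $ 1) * aut_factor A z - (of_int (A $ 1 $ 1) * z + of_int (A $ 1 $ 2)) * of_int (A $ 2 $ 1))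
       / (aut_factor A z * aut_factor A z)) (at z within S)"
    unfolding aut_factor_def
    by (rule derivative_eq_intros refl | use nz in \<open>simp add: aut_factor_def\<close>)+
  also have "of_int (A $ 1 $ 1) * aut_factor A z - (of_int (A $ 1 $ 1) * z + of_int (A $ 1 $ 2)) * of_int (A $ 2 $ 1)
      = (1 :: complex)"
    using det by (simp add: aut_factor_def algebra_simps)
  finally show ?thesis
    by (simp add: act_def[abs_def] power2_eq_square)
qed

lemma inj_on_act: "A \<in> SL2Z \<Longrightarrow> inj_on (act A) upper_half_plane"
  by (rule inj_on_inverseI[where g = "act (minv A)"]) auto

section \<open>Cosets of \<open>Gamma1 N\<close> and bottom rows modulo N\<close>

definition bottom_row :: "nat \<Rightarrow> int ^ 2 ^ 2 \<Rightarrow> int \<times> int" where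
  "bottom_row N A = (A $ 2 $ 1 mod int N, A $ 2 $ 2 mod int N)"

lemma finite_E_set: "finite (E_set N)"
  by (rule finite_subset[of _ "{0..<int N} \<times> {0..<int N}"]) (auto simp: E_set_def)

text \<open>A common divisor of the bottom row and N divides the determinant, which is 1.\<close>

lemma bottom_row_in_E_set:
  assumes "N \<ge> 1" "A \<in> SL2Z"
  shows "bottom_row N A \<in> E_set N"
proof -
  have "gcd (gcd (A $ 2 $ 1 mod int N) (A $ 2 $ 2 mod int N)) (int N) dvd 1"
  proof -
    let ?g = "gcd (gcd (A $ 2 $ 1 mod int N) (A $ 2 $ 2 mod int N)) (int N)"
    have g: "?g dvd int N" "?g dvd A $ 2 $ 1 mod int N" "?g dvd A $ 2 $ 2 mod int N"
      by (auto intro: dvd_trans)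
    then have "?g dvd A $ 2 $ 1" "?g dvd A $ 2 $ 2"
      by (auto simp: dvd_mod_iff)
    then have "?g dvd A $ 1 $ 1 * A $ 2 $ 2 - A $ 1 $ 2 * A $ 2 $ 1"
      by (intro dvd_diff dvd_mult)
    then show ?thesis
      using assms by (simp add: SL2Z_iff)
  qed
  then show ?thesis
    using assms by (simp add: bottom_row_def E_set_def)
qed

lemma lifts_iff_row:
  assumes "N \<ge> 1" "x \<in> E_set N"
  shows "lifts N A x \<longleftrightarrow> A \<in> SL2Z \<and> bottom_row N A = x"
  using assms by (cases x) (auto simp: lifts_def bottom_row_def E_set_def cong_def)

lemma row_eq_iff:
  assumes "N \<ge> 1"
  shows "bottom_row N A = bottom_row N B \<longleftrightarrow> [A $ 2 $ 1 = B $ 2 $ 1] (mod int N) \<and> [A $ 2 $ 2 = B $ 2 $ 2] (mod int N)"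
  by (simp add: bottom_row_def cong_def)

lemma row_mult_cong:
  assumes "N \<ge> 1" "bottom_row N A = bottom_row N B"
  shows "bottom_row N (A ** C) = bottom_row N (B ** C)"
  using assms(2) unfolding row_eq_iff[OF assms(1)] by (auto intro!: cong_add cong_mult)

text \<open>The relevant entries of \<open>A ** minv B\<close> are 2 by 2 minors mixing a row of A
  with a row of B. Exchanging the congruent bottom rows turns them into det A, into the minor of a
  repeated row, and into det B.\<close>

lemma row_eq_Gamma1:
  assumes "N \<ge> 1" "A \<in> SL2Z" "B \<in> SL2Z" "bottom_row N A = bottom_row N B"
  shows "A ** minv B \<in> Gamma1 N"
proof -
  have c: "[A $ 2 $ 1 = B $ 2 $ 1] (mod int N)" "[A $ 2 $ 2 = B $ 2 $ 2] (mod int N)"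
    using assms row_eq_iff by auto
  have dA: "A $ 1 $ 1 * A $ 2 $ 2 - A $ 1 $ 2 * A $ 2 $ 1 = 1"
   and dB: "B $ 1 $ 1 * B $ 2 $ 2 - B $ 1 $ 2 * B $ 2 $ 1 = 1"
    using assms SL2Z_iff by auto
  have "[A $ 1 $ 1 * B $ 2 $ 2 - A $ 1 $ 2 * B $ 2 $ 1 = A $ 1 $ 1 * A $ 2 $ 2 - A $ 1 $ 2 * A $ 2 $ 1] (mod int N)"
    by (intro cong_diff cong_mult cong_refl c[THEN cong_sym])
  moreover have "[A $ 2 $ 1 * B $ 2 $ 2 - A $ 2 $ 2 * B $ 2 $ 1 = B $ 2 $ 1 * B $ 2 $ 2 - B $ 2 $ 2 * B $ 2 $ 1] (mod int N)"
    by (intro cong_diff cong_mult cong_refl c)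
  moreover have "[A $ 2 $ 2 * B $ 1 $ 1 - A $ 2 $ 1 * B $ 1 $ 2 = B $ 2 $ 2 * B $ 1 $ 1 - B $ 2 $ 1 * B $ 1 $ 2] (mod int N)"
    by (intro cong_diff cong_mult cong_refl c)
  moreover have "A ** minv B \<in> SL2Z"
    using assms by (simp add: SL2Z_mult minv_SL2Z)
  ultimately show ?thesis
    unfolding Gamma1_def using dA dB by (auto simp: minv_def algebra_simps)
qed

lemma Gamma1_SL2Z: "A \<in> Gamma1 N \<Longrightarrow> A \<in> SL2Z"
  by (simp add: Gamma1_def)

lemma bottom_row_cosetE:
  assumes "N \<ge> 1" "A \<in> SL2Z" "B \<in> SL2Z" "bottom_row N A = bottom_row N B"
  obtains C where "C \<in> Gamma1 N" "C \<in> SL2Z" "C ** B = A"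
  using row_eq_Gamma1[OF assms] Gamma1_SL2Z assms
  by (intro that[of "A ** minv B"]) (auto simp: minv_left simp flip: matrix_mul_assoc)

lemma Gamma1_mult_row:
  assumes "N \<ge> 1" "A \<in> Gamma1 N"
  shows "bottom_row N (A ** B) = bottom_row N B"
proof -
  have "[A $ 2 $ 1 * B $ 1 $ j + A $ 2 $ 2 * B $ 2 $ j = 0 * B $ 1 $ j + 1 * B $ 2 $ j] (mod int N)" for j
    using assms by (intro cong_add cong_mult cong_refl) (auto simp: Gamma1_def)
  then show ?thesis
    unfolding row_eq_iff[OF assms(1)] by simp
qed

text \<open>Right multiplication by C permutes the cosets, with inverse given by
  \<open>minv C\<close>; as K sees only the coset, the representatives chosen by g do not matter.
  With C = \<open>matT 1\<close> this cancels the vertical sides, with C = \<open>matS\<close> it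
  folds the arc.\<close>

lemma sum_E_set_mult:
  fixes K :: "int ^ 2 ^ 2 \<Rightarrow> 'a :: comm_monoid_add"
  assumes N: "N \<ge> 1" and g: "\<And>x. x \<in> E_set N \<Longrightarrow> lifts N (g x) x"
    and K: "\<And>A B. A \<in> SL2Z \<Longrightarrow> B \<in> SL2Z \<Longrightarrow> bottom_row N A = bottom_row N B \<Longrightarrow> K A = K B"
    and C: "C \<in> SL2Z"
  shows "(\<Sum>x\<in>E_set N. K (g x ** C)) = (\<Sum>x\<in>E_set N. K (g x))"
proof -
  have gx: "g x \<in> SL2Z" "bottom_row N (g x) = x" if "x \<in> E_set N" for x
    using g[OF that] lifts_iff_row[OF N that] by auto
  have inv: "bottom_row N (g (bottom_row N (g x ** B)) ** B') = x"
    if "x \<in> E_set N" "B \<in> SL2Z" "B ** B' = mat 1" for x B B'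
  proof -
    have "bottom_row N (g (bottom_row N (g x ** B))) = bottom_row N (g x ** B)"
      using that by (simp add: gx bottom_row_in_E_set[OF N] SL2Z_mult)
    then have "bottom_row N (g (bottom_row N (g x ** B)) ** B') = bottom_row N ((g x ** B) ** B')"
      by (rule row_mult_cong[OF N])
    then show ?thesis
      using that by (simp add: gx matrix_mul_assoc[symmetric])
  qed
  show ?thesis
  proof (rule sum.reindex_bij_witness[where j = "\<lambda>x. bottom_row N (g x ** C)" and i = "\<lambda>x. bottom_row N (g x ** minv C)"])
    fix x assume x: "x \<in> E_set N"
    show "K (g (bottom_row N (g x ** C))) = K (g x ** C)"
      using x C by (intro K) (auto simp: gx bottom_row_in_E_set[OF N] SL2Z_mult)
  qed (use inv C in \<open>auto simp: minv_left minv_right minv_SL2Z bottom_row_in_E_set[OF N] SL2Z_mult gx\<close>)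
qed

subsection \<open>Area integrals in the complex plane\<close>

text \<open>\<open>has_absolute_integral_change_of_variables\<close> speaks of maps of
  \<open>real ^ 2\<close> and determinants of matrices, so areas in the complex plane are
  transported there.\<close>

definition c2v :: "complex \<Rightarrow> real ^ 2" where "c2v z = vector [Re z, Im z]"
definition v2c :: "real ^ 2 \<Rightarrow> complex" where "v2c v = Complex (v $ 1) (v $ 2)"

lemma c2v_nth [simp]: "c2v z $ 1 = Re z" "c2v z $ 2 = Im z"
  by (simp_all add: c2v_def)

lemma v2c_c2v [simp]: "v2c (c2v z) = z"
  by (simp add: v2c_def)

lemma c2v_v2c [simp]: "c2v (v2c v) = v"
  by (simp add: vec_eq_iff forall_2 v2c_def)

lemma linear_c2v: "linear c2v"
  by (rule linearI) (simp_all add: vec_eq_iff forall_2)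

lemma linear_v2c: "linear v2c"
  by (rule linearI) (simp_all add: v2c_def complex_eq_iff)

lemma bounded_linear_c2v: "bounded_linear c2v"
  using linear_c2v by (rule linear_linear[THEN iffD2])

lemma bounded_linear_v2c: "bounded_linear v2c"
  using linear_v2c by (rule linear_linear[THEN iffD2])

lemma v2c_measurable [measurable]: "v2c \<in> borel \<rightarrow>\<^sub>M borel"
  by (intro borel_measurable_continuous_onI linear_continuous_on bounded_linear_v2c)

lemma c2v_measurable [measurable]: "c2v \<in> borel \<rightarrow>\<^sub>M borel"
  by (intro borel_measurable_continuous_onI linear_continuous_on bounded_linear_c2v)

lemma Complex_measurable [measurable]: "(\<lambda>(x, y). Complex x y) \<in> borel \<rightarrow>\<^sub>M borel"
  by (intro borel_measurable_continuous_onI)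
     (auto simp: Complex_eq case_prod_beta intro!: continuous_intros)

lemma Basis_real2: "(Basis :: (real ^ 2) set) = {axis 1 1, axis 2 1}"
  by (auto simp: Basis_vec_def UNIV_2)

lemma lborel_complex_vec: "distr lborel borel v2c = lborel"
proof (rule lborel_eqI[symmetric])
  fix l u :: complex assume le: "\<And>b. b \<in> Basis \<Longrightarrow> l \<bullet> b \<le> u \<bullet> b"
  have "v2c -` box l u = box (c2v l) (c2v u)"
    by (auto simp: mem_box_cart forall_2 v2c_def in_box_complex_iff)
  moreover have "emeasure lborel (box (c2v l) (c2v u)) = ennreal (\<Prod>b\<in>Basis. (u - l) \<bullet> b)"
    using le[of 1] le[of \<i>] by (subst emeasure_lborel_box)
      (auto simp: Basis_real2 inner_axis inner_axis' Basis_complex_def cart_eq_inner_axis[symmetric] axis_eq_axis inner_diff_left)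
  ultimately show "emeasure (distr lborel borel v2c) (box l u) = ennreal (\<Prod>b\<in>Basis. (u - l) \<bullet> b)"
    by (subst emeasure_distr) auto
qed simp

text \<open>The counterpart of \<open>lborel_complex_vec\<close> for iterated integration in x and
  y; as there, Lebesgue measure is recognised by its values on boxes.\<close>

lemma lborel_complex_pair: "distr lborel borel (\<lambda>(x, y). Complex x y) = lborel"
proof (rule lborel_eqI[symmetric])
  fix l u :: complex assume le: "\<And>b. b \<in> Basis \<Longrightarrow> l \<bullet> b \<le> u \<bullet> b"
  have "(\<lambda>(x, y). Complex x y) -` box l u = box (Re l, Im l) (Re u, Im u)"
    by (auto simp: in_box_complex_iff) (auto simp: mem_box Basis_prod_def)
  moreover have "emeasure lborel (box (Re l, Im l) (Re u, Im u)) = ennreal (\<Prod>b\<in>Basis. (u - l) \<bullet> b)"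
    using le[of 1] le[of \<i>] by (subst emeasure_lborel_box) (auto simp: Basis_prod_def Basis_complex_def)
  ultimately show "emeasure (distr lborel borel (\<lambda>(x, y). Complex x y)) (box l u) = ennreal (\<Prod>b\<in>Basis. (u - l) \<bullet> b)"
    by (subst emeasure_distr) auto
qed simp

text \<open>A bridge between Bochner integrals over \<open>lborel\<close> and absolute gauge
  integrals over \<open>real ^ 2\<close>. The two meet in the completed measure, which does not
  change the integral of a Borel function.\<close>

lemma set_integrable_v2c:
  fixes h :: "complex \<Rightarrow> complex"
  assumes [measurable]: "S \<in> sets borel" and h: "set_borel_measurable borel S h"
  shows "(\<lambda>v. c2v (h (v2c v))) absolutely_integrable_on (v2c -` S) \<longleftrightarrow> set_integrable lborel S h"
    and "set_integrable lborel S h \<Longrightarrow> integral (v2c -` S) (\<lambda>v. c2v (h (v2c v))) = c2v (LINT z:S|lborel. h z)"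
proof -
  define k where "k z = indicat_real S z *\<^sub>R h z" for z
  have k [measurable]: "k \<in> borel_measurable borel"
    using h by (simp add: set_borel_measurable_def k_def[abs_def])
  have eq: "indicat_real (v2c -` S) v *\<^sub>R c2v (h (v2c v)) = c2v (k (v2c v))" for v
    by (simp add: k_def indicator_def linear_0[OF linear_c2v])
  have [measurable]: "(\<lambda>v. c2v (k (v2c v))) \<in> borel_measurable lborel"
    by measurable
  have 1: "(\<lambda>v. c2v (h (v2c v))) absolutely_integrable_on (v2c -` S) \<longleftrightarrow> integrable lborel (\<lambda>v. c2v (k (v2c v)))"
    unfolding set_integrable_def eq by (rule integrable_completion) measurable
  have 2: "integrable lborel (\<lambda>v. c2v (k (v2c v))) \<longleftrightarrow> integrable lborel (\<lambda>v. k (v2c v))"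
  proof
    assume "integrable lborel (\<lambda>v. c2v (k (v2c v)))"
    from integrable_bounded_linear[OF bounded_linear_v2c this]
    show "integrable lborel (\<lambda>v. k (v2c v))" by simp
  qed (rule integrable_bounded_linear[OF bounded_linear_c2v])
  have 3: "integrable lborel (\<lambda>v. k (v2c v)) \<longleftrightarrow> integrable lborel k"
    by (subst lborel_complex_vec[symmetric], subst integrable_distr_eq) auto
  show ai: "(\<lambda>v. c2v (h (v2c v))) absolutely_integrable_on (v2c -` S) \<longleftrightarrow> set_integrable lborel S h"
    unfolding 1 2 3 by (simp add: set_integrable_def k_def[abs_def])
  assume int: "set_integrable lborel S h"
  then have "integral (v2c -` S) (\<lambda>v. c2v (h (v2c v))) = (LINT v|lebesgue. c2v (k (v2c v)))"
    unfolding ai[symmetric] by (subst set_lebesgue_integral_eq_integral(2)[symmetric])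
      (auto simp: set_lebesgue_integral_def eq)
  also have "\<dots> = (LINT v|lborel. c2v (k (v2c v)))"
    by (rule integral_completion) measurable
  also have "\<dots> = c2v (LINT v|lborel. k (v2c v))"
    using int 3 by (intro integral_bounded_linear[OF bounded_linear_c2v])
      (auto simp: set_integrable_def k_def[abs_def])
  also have "(LINT v|lborel. k (v2c v)) = (LINT z|lborel. k z)"
    using integral_distr[of v2c lborel borel k] by (simp add: lborel_complex_vec)
  finally show "integral (v2c -` S) (\<lambda>v. c2v (h (v2c v))) = c2v (LINT z:S|lborel. h z)"
    by (simp add: set_lebesgue_integral_def k_def[abs_def])
qed

text \<open>Multiplication by a + b i has the real matrix with rows (a, -b) and (b, a). This is the
  Jacobian of a holomorphic map.\<close>

lemma det_complex_mult: "det (matrix (\<lambda>v. c2v (c * v2c v))) = (cmod c)\<^sup>2"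
  unfolding det_2 matrix_def
  by (simp add: v2c_def axis_def cmod_power2) (simp add: power2_eq_square)

text \<open>Integrability is transported in both directions because the unfolding has to establish
  integrability over \<open>D\<close>, not only compute the value.\<close>

lemma integral_holomorphic_change_of_variables:
  fixes f g g' :: "complex \<Rightarrow> complex"
  assumes [measurable]: "S \<in> sets borel" "g ` S \<in> sets borel"
    and der: "\<And>z. z \<in> S \<Longrightarrow> (g has_field_derivative g' z) (at z within S)"
    and inj: "inj_on g S"
    and f: "set_borel_measurable borel (g ` S) f"
    and fg: "set_borel_measurable borel S (\<lambda>z. (cmod (g' z))\<^sup>2 *\<^sub>R f (g z))"
  shows "set_integrable lborel S (\<lambda>z. (cmod (g' z))\<^sup>2 *\<^sub>R f (g z)) \<longleftrightarrow> set_integrable lborel (g ` S) f"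
    and "set_integrable lborel (g ` S) f \<Longrightarrow>
      (LINT z:S|lborel. (cmod (g' z))\<^sup>2 *\<^sub>R f (g z)) = (LINT z:g ` S|lborel. f z)"
proof -
  define G where "G v = c2v (g (v2c v))" for v
  define G' where "G' v = (\<lambda>h. c2v (g' (v2c v) * v2c h))" for v
  define F where "F v = c2v (f (v2c v))" for v
  have img: "G ` (v2c -` S) = v2c -` (g ` S)"
  proof
    show "v2c -` (g ` S) \<subseteq> G ` (v2c -` S)"
    proof
      fix v assume "v \<in> v2c -` (g ` S)"
      then obtain z where "z \<in> S" "v2c v = g z" by auto
      then have "v = G (c2v z)" "c2v z \<in> v2c -` S"
        using c2v_v2c[of v] by (auto simp: G_def)
      then show "v \<in> G ` (v2c -` S)" by blast
    qed
  qed (auto simp: G_def)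
  have dG: "(G has_derivative G' v) (at v within v2c -` S)" if "v \<in> v2c -` S" for v
  proof -
    have "(g has_derivative (*) (g' (v2c v))) (at (v2c v) within S)"
      using der that by (auto simp: has_field_derivative_def)
    then have "(g has_derivative (*) (g' (v2c v))) (at (v2c v) within v2c ` (v2c -` S))"
      by (rule has_derivative_subset) auto
    with bounded_linear_imp_has_derivative[OF bounded_linear_v2c]
    have "((\<lambda>v. g (v2c v)) has_derivative (\<lambda>h. g' (v2c v) * v2c h)) (at v within v2c -` S)"
      by (rule has_derivative_in_compose)
    then show ?thesis
      unfolding G_def G'_def by (rule bounded_linear.has_derivative[OF bounded_linear_c2v])
  qed
  have dm: "\<bar>det (matrix (G' v))\<bar> *\<^sub>R F (G v) = c2v ((cmod (g' (v2c v)))\<^sup>2 *\<^sub>R f (g (v2c v)))" for v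
    by (simp add: G'_def det_complex_mult F_def G_def linear_scale[OF linear_c2v])
  have S': "v2c -` S \<in> sets lebesgue"
  proof -
    have "v2c -` S \<inter> space borel \<in> sets borel"
      by (rule measurable_sets[OF v2c_measurable]) simp
    then show ?thesis by simp
  qed
  have inj': "inj_on G (v2c -` S)"
  proof (rule inj_onI)
    fix v w assume *: "v \<in> v2c -` S" "w \<in> v2c -` S" "G v = G w"
    then have "g (v2c v) = g (v2c w)"
      unfolding G_def by (metis v2c_c2v)
    with inj * have "v2c v = v2c w" by (auto dest: inj_onD)
    then show "v = w" by (metis c2v_v2c)
  qed
  note cov = has_absolute_integral_change_of_variables[OF S' dG inj', of F, unfolded dm img]
  note L = set_integrable_v2c[OF assms(1) fg] and R = set_integrable_v2c[OF assms(2) f, folded F_def]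
  show eq: "set_integrable lborel S (\<lambda>z. (cmod (g' z))\<^sup>2 *\<^sub>R f (g z)) \<longleftrightarrow> set_integrable lborel (g ` S) f"
    using cov L(1) R(1) by blast
  assume int: "set_integrable lborel (g ` S) f"
  then have "c2v (LINT z:S|lborel. (cmod (g' z))\<^sup>2 *\<^sub>R f (g z)) = c2v (LINT z:g ` S|lborel. f z)"
    using cov L R eq by metis
  then show "(LINT z:S|lborel. (cmod (g' z))\<^sup>2 *\<^sub>R f (g z)) = (LINT z:g ` S|lborel. f z)"
    by (metis v2c_c2v)
qed

subsection \<open>The standard fundamental domain\<close>

definition fund :: "complex set" where
  "fund = {z. Im z > 0 \<and> \<bar>Re z\<bar> \<le> 1 / 2 \<and> 1 \<le> cmod z}"

text \<open>Equivalent points of \<open>fund\<close> may be distinct on its boundary; in the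
  interior the reduction is unique up to sign, and the boundary is a null set.\<close>

definition fund_int :: "complex set" where
  "fund_int = {z. Im z > 0 \<and> \<bar>Re z\<bar> < 1 / 2 \<and> 1 < cmod z}"

lemma fund_int_subset: "fund_int \<subseteq> fund" "fund \<subseteq> upper_half_plane"
  by (auto simp: fund_def fund_int_def)

definition matT :: "int \<Rightarrow> int ^ 2 ^ 2" where "matT n = mat2 1 n 0 1"
definition matS :: "int ^ 2 ^ 2" where "matS = mat2 0 (- 1) 1 0"

lemma matT_SL2Z [simp]: "matT n \<in> SL2Z" and matS_SL2Z [simp]: "matS \<in> SL2Z"
  by (simp_all add: matT_def matS_def SL2Z_iff)

lemma act_matT [simp]: "act (matT n) z = z + of_int n" "aut_factor (matT n) z = 1"
  by (simp_all add: act_def aut_factor_def matT_def)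

lemma act_matS [simp]: "act matS z = - 1 / z" "aut_factor matS z = z"
  by (simp_all add: act_def aut_factor_def matS_def)

lemma cmod_aut_factor: 
  "(cmod (aut_factor A z))\<^sup>2 = (real_of_int (A $ 2 $ 1) * Re z + real_of_int (A $ 2 $ 2))\<^sup>2 + (real_of_int (A $ 2 $ 1) * Im z)\<^sup>2"
  by (simp add: aut_factor_def cmod_power2)

section \<open>Reduction theory of the modular group\<close>

lemma finite_aut_factor_le_1:
  assumes "Im z > 0"
  shows "finite {(c :: int, d :: int). cmod (of_int c * z + of_int d) \<le> 1}"
proof (rule finite_subset)
  define K where "K = \<lceil>1 / Im z\<rceil>"
  define L where "L = \<lceil>1 + K * cmod z\<rceil>"
  show "{(c :: int, d :: int). cmod (of_int c * z + of_int d) \<le> 1} \<subseteq> {-K..K} \<times> {-L..L}"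
  proof clarify
    fix c d :: int assume le: "cmod (of_int c * z + of_int d) \<le> 1"
    have "\<bar>real_of_int c * Im z\<bar> \<le> 1"
      using abs_Im_le_cmod[of "of_int c * z + of_int d"] le by simp
    then have "\<bar>real_of_int c\<bar> \<le> 1 / Im z"
      using assms by (simp add: abs_mult field_simps)
    then have c: "\<bar>c\<bar> \<le> K"
      unfolding K_def by linarith
    have "cmod (of_int d) \<le> cmod (of_int c * z + of_int d) + cmod (of_int c * z)"
      using norm_triangle_ineq4[of "of_int c * z + of_int d" "of_int c * z"] by simp
    then have "\<bar>real_of_int d\<bar> \<le> 1 + \<bar>real_of_int c\<bar> * cmod z"
      using le by (simp add: norm_mult)
    also have "\<dots> \<le> 1 + K * cmod z"
      using c by (intro add_left_mono mult_right_mono) (auto simp flip: of_int_abs)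
    finally have "\<bar>d\<bar> \<le> L"
      unfolding L_def by linarith
    with c show "c \<in> {-K..K} \<and> d \<in> {-L..L}"
      by auto
  qed
qed auto

text \<open>Since Im (A z) = Im z / |c z + d|^2, a maximum of the height on the orbit is a minimum
  of |c z + d|, and only finitely many pairs (c, d) make this at most 1.\<close>

lemma ex_maximal_Im:
  assumes z: "Im z > 0"
  obtains A where "A \<in> SL2Z" "\<And>B. B \<in> SL2Z \<Longrightarrow> Im (act B z) \<le> Im (act A z)"
proof -
  \<comment> \<open>\<open>R\<close> itself may be infinite, as the top row is free; only the set of
    values is finite. It contains the value 1 of the identity, so its minimum is a minimum over all
    of \<open>SL2Z\<close>.\<close>
  define R where "R = {A \<in> SL2Z. cmod (aut_factor A z) \<le> 1}"
  have "(\<lambda>A. cmod (aut_factor A z)) ` R \<subseteq>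
      (\<lambda>(c, d). cmod (of_int c * z + of_int d)) ` {(c, d). cmod (of_int c * z + of_int d) \<le> 1}"
    by (auto simp: R_def aut_factor_def image_iff)
  then have fin: "finite ((\<lambda>A. cmod (aut_factor A z)) ` R)"
    using finite_aut_factor_le_1[OF z] finite_subset by blast
  have ne: "mat 1 \<in> R"
    by (simp add: R_def mat_1_SL2Z)
  define m where "m = Min ((\<lambda>A. cmod (aut_factor A z)) ` R)"
  have "m \<in> (\<lambda>A. cmod (aut_factor A z)) ` R"
    unfolding m_def using fin ne by (intro Min_in) auto
  then obtain A where A: "A \<in> R" "cmod (aut_factor A z) = m" by auto
  have m1: "m \<le> 1"
    using A by (auto simp: R_def)
  have "m \<le> cmod (aut_factor B z)" if "B \<in> SL2Z" for B
  proof (cases "B \<in> R")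
    case True
    then show ?thesis unfolding m_def using fin by (intro Min_le) auto
  next
    case False
    then show ?thesis using that m1 by (auto simp: R_def)
  qed
  moreover have "0 < m"
    using A aut_factor_nonzero[of A z] z by (auto simp: R_def)
  ultimately have "Im (act B z) \<le> Im (act A z)" if "B \<in> SL2Z" for B
    using that A z aut_factor_nonzero[of B z] \<open>0 < m\<close>
    by (auto simp: Im_act R_def intro!: divide_left_mono power_mono mult_pos_pos zero_less_power)
  then show ?thesis
    using A that by (auto simp: R_def)
qed

text \<open>A point of maximal height is moved by a translation into |Re z| \<le> 1/2 without
  changing its height. If it had modulus below 1, then \<open>matS\<close> would raise it
  further.\<close>

lemma ex_act_in_fund:
  assumes z: "Im z > 0"
  obtains A where "A \<in> SL2Z" "act A z \<in> fund"
proof -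
  obtain A where A: "A \<in> SL2Z" "\<And>B. B \<in> SL2Z \<Longrightarrow> Im (act B z) \<le> Im (act A z)"
    using ex_maximal_Im[OF z] by blast
  define n where "n = - round (Re (act A z))"
  define B where "B = matT n ** A"
  have B: "B \<in> SL2Z" and actB: "act B z = act A z + of_int n"
    using A z by (simp_all add: B_def SL2Z_mult act_mult)
  have pos: "Im (act B z) > 0"
    using B z by (rule Im_act_pos)
  have re: "\<bar>Re (act B z)\<bar> \<le> 1 / 2"
    using of_int_round_abs_le[of "Re (act A z)"] by (simp add: actB n_def abs_minus_commute)
  have "Im (act (matS ** B) z) \<le> Im (act B z)"
    using A(2)[of "matS ** B"] B actB by (simp add: SL2Z_mult)
  then have "Im (act B z) / (cmod (act B z))\<^sup>2 \<le> Im (act B z)"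
    using Im_act[of matS "act B z"] pos B z by (simp add: act_mult del: act_matS(1))
  moreover have "0 < cmod (act B z)"
    using pos by auto
  ultimately have "1 \<le> (cmod (act B z))\<^sup>2"
    using pos by (simp add: divide_simps)
  then have "1 \<le> cmod (act B z)"
    using power2_le_imp_le[of 1 "cmod (act B z)"] by simp
  with re pos have "act B z \<in> fund"
    by (simp add: fund_def)
  with B show ?thesis by (rule that)
qed

text \<open>Here |c z + d|^2 = c^2 |z|^2 + 2 c d Re z + d^2 exceeds c^2 - |c d| + d^2, an integer
  that is positive because the form is positive definite.\<close>

lemma cmod_aut_factor_gt_1:
  assumes "z \<in> fund_int" "A $ 2 $ 1 \<noteq> 0"
  shows "cmod (aut_factor A z) > 1"
proof -
  define c d where cd: "c = A $ 2 $ 1" "d = A $ 2 $ 2"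
  define x where "x = Re z"
  have x: "\<bar>x\<bar> < 1 / 2" and z: "1 < (cmod z)\<^sup>2"
    using assms by (auto simp: fund_int_def x_def)
  have c: "c \<noteq> 0" using assms cd by simp
  have "(cmod (aut_factor A z))\<^sup>2 = c\<^sup>2 * (cmod z)\<^sup>2 + 2 * c * d * x + d\<^sup>2"
    unfolding cmod_aut_factor by (simp add: cmod_power2 cd x_def) (simp add: power2_eq_square algebra_simps)
  also have "\<dots> > c\<^sup>2 * 1 + 2 * c * d * x + d\<^sup>2"
    using c z by simp
  finally have 1: "(cmod (aut_factor A z))\<^sup>2 > c\<^sup>2 + 2 * c * d * x + d\<^sup>2"
    by simp
  have "\<bar>2 * real_of_int c * d * x\<bar> \<le> \<bar>real_of_int c * d\<bar> * 1"
    using x mult_left_mono[of "2 * \<bar>x\<bar>" 1 "\<bar>real_of_int c * d\<bar>"] by (simp add: abs_mult mult_ac)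
  then have 2: "(cmod (aut_factor A z))\<^sup>2 > c\<^sup>2 - \<bar>c * d\<bar> + d\<^sup>2"
    using 1 by (simp only: abs_le_iff of_int_abs of_int_mult of_int_diff of_int_add of_int_power) linarith
  have 3: "1 \<le> c\<^sup>2 - \<bar>c * d\<bar> + d\<^sup>2"
  proof -
    have "0 < \<bar>c\<bar>\<^sup>2 - \<bar>c\<bar> * \<bar>d\<bar> + \<bar>d\<bar>\<^sup>2"
    proof -
      \<comment> \<open>Four times the form, with the square completed.\<close>
      have "0 < (2 * \<bar>d\<bar> - \<bar>c\<bar>)\<^sup>2 + 3 * \<bar>c\<bar>\<^sup>2"
        using c by (intro add_nonneg_pos) auto
      then show ?thesis by (simp add: power2_eq_square algebra_simps)
    qed
    then show ?thesis by (simp add: abs_mult)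
  qed
  then have "(1 :: real) \<le> of_int (c\<^sup>2 - \<bar>c * d\<bar> + d\<^sup>2)"
    by linarith
  with 2 have "1 < (cmod (aut_factor A z))\<^sup>2"
    by simp
  then show ?thesis
    by (metis norm_ge_zero one_power2 power2_less_imp_less)
qed

text \<open>If c were nonzero, A would strictly lower z, and its inverse, whose lower left entry is
  - c, would strictly lower A z, which leads back to z. Hence A is a translation up to sign, and the
  open strip has width 1.\<close>

lemma act_fund_int_unique:
  assumes A: "A \<in> SL2Z" and z: "z \<in> fund_int" "act A z \<in> fund_int"
  shows "A = mat 1 \<or> A = - mat 1"
proof -
  have pos: "Im z > 0" "Im (act A z) > 0"
    using z by (auto simp: fund_int_def)
  have lt: "Im (act B w) < Im w" if "B \<in> SL2Z" "w \<in> fund_int" "B $ 2 $ 1 \<noteq> 0" for B w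
  proof -
    have "1 < (cmod (aut_factor B w))\<^sup>2"
      using cmod_aut_factor_gt_1[of w B] that by simp
    moreover have "Im w > 0" using that by (auto simp: fund_int_def)
    ultimately show ?thesis using that by (simp add: Im_act divide_simps)
  qed
  have c: "A $ 2 $ 1 = 0"
  proof (rule ccontr)
    assume "A $ 2 $ 1 \<noteq> 0"
    then have "Im (act A z) < Im z" "Im (act (minv A) (act A z)) < Im (act A z)"
      using lt[of A z] lt[OF minv_SL2Z[OF A], of "act A z"] A z by (simp_all add: minv_def)
    then show False using A pos by simp
  qed
  with A have ad: "A $ 1 $ 1 * A $ 2 $ 2 = 1"
    by (simp add: SL2Z_iff)
  then have ad': "A $ 1 $ 1 = 1 \<and> A $ 2 $ 2 = 1 \<or> A $ 1 $ 1 = -1 \<and> A $ 2 $ 2 = -1"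
    by (rule zmult_eq_1_iff[THEN iffD1])
  have b: "act A z = z + of_int (A $ 1 $ 1 * A $ 1 $ 2)"
    using c ad' by (auto simp: act_def aut_factor_def)
  have "\<bar>real_of_int (A $ 1 $ 1 * A $ 1 $ 2)\<bar> = \<bar>Re (act A z) - Re z\<bar>"
    unfolding b by simp
  also have "\<dots> < 1"
    using z by (auto simp: fund_int_def)
  finally have "A $ 1 $ 1 * A $ 1 $ 2 = 0"
    by linarith
  with ad' have "A $ 1 $ 2 = 0" by auto
  show ?thesis
    using ad'
  proof
    assume "A $ 1 $ 1 = 1 \<and> A $ 2 $ 2 = 1"
    with c \<open>A $ 1 $ 2 = 0\<close> have "A = mat 1"
      by (intro mat2_eqI) (auto simp: mat_def)
    then show ?thesis ..
  next
    assume "A $ 1 $ 1 = - 1 \<and> A $ 2 $ 2 = - 1"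
    with c \<open>A $ 1 $ 2 = 0\<close> have "A = - mat 1"
      by (intro mat2_eqI) (auto simp: mat_def)
    then show ?thesis ..
  qed
qed

lemma act_uminus [simp]: "act (- A) z = act A z"
  by (simp add: act_def aut_factor_def)
     (metis (no_types, opaque_lifting) add_uminus_conv_diff minus_add_distrib minus_divide_divide minus_diff_eq)

lemma uminus_SL2Z [simp]: "- A \<in> SL2Z \<longleftrightarrow> A \<in> SL2Z"
  by (simp add: SL2Z_iff)

lemma measurable_act [measurable]: "act A \<in> borel_measurable borel"
  unfolding act_def[abs_def] aut_factor_def by measurable

lemma fund_int_borel [measurable]: "fund_int \<in> sets borel"
  unfolding fund_int_def by measurable

lemma fund_borel [measurable]: "fund \<in> sets borel"
  unfolding fund_def by measurable

lemma upper_half_plane_borel [measurable]: "upper_half_plane \<in> sets borel"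
  unfolding upper_half_plane_def by measurable

section \<open>Generic points and the null set of boundary translates\<close>

lemma negligible_fund_boundary: "negligible (fund - fund_int)"
proof -
  have "{z. Re z = a} = {z. 1 \<bullet> z = a}" for a by auto
  then have re: "negligible {z. Re z = a}" for a
    using negligible_hyperplane[of "1 :: complex" a] by simp
  have "negligible ({z. Re z = 1 / 2} \<union> {z. Re z = - 1 / 2} \<union> sphere 0 1)"
    by (intro negligible_Un re negligible_sphere)
  then show ?thesis
    by (rule negligible_subset) (auto simp: fund_def fund_int_def)
qed

definition bad_points :: "complex set" where
  "bad_points = (\<Union>A\<in>SL2Z. act A ` (fund - fund_int))"

lemma negligible_bad_points: "negligible bad_points"
  unfolding bad_points_def
proof (rule negligible_countable_Union)
  show "countable ((\<lambda>A. act A ` (fund - fund_int)) ` SL2Z)"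
    by (intro countable_image countable_SL2Z)
  fix s assume "s \<in> (\<lambda>A. act A ` (fund - fund_int)) ` SL2Z"
  then obtain A where A: "A \<in> SL2Z" "s = act A ` (fund - fund_int)" by auto
  have "act A differentiable_on (fund - fund_int)"
    unfolding differentiable_on_def differentiable_def
  proof
    fix z assume "z \<in> fund - fund_int"
    then have "Im z > 0" by (auto simp: fund_def)
    from has_field_derivative_act[OF A(1) this] 
    show "\<exists>D. (act A has_derivative D) (at z within fund - fund_int)"
      unfolding has_field_derivative_def by blast
  qed
  then show "negligible s"
    unfolding A using negligible_fund_boundary by (intro negligible_differentiable_image_negligible) auto
qed

lemma AE_not_bad: "AE z in lborel. z \<notin> bad_points"
proof -
  have "bad_points \<in> null_sets lebesgue"
    using negligible_bad_points by (simp add: negligible_iff_null_sets)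
  then have "AE z in lebesgue. z \<notin> bad_points"
    by (rule AE_not_in)
  then show ?thesis
    by (simp add: AE_completion_iff)
qed

text \<open>Off the translates of the boundary the reduced point is interior, so two matrices
  reducing z differ by an element that fixes the reduction up to \<open>act_fund_int_unique\<close>.
  The pair A, - A is the origin of the factor 2.\<close>

lemma representations_not_bad:
  assumes "Im z > 0" "z \<notin> bad_points"
  obtains A where "A \<in> SL2Z" "{B \<in> SL2Z. act (minv B) z \<in> fund_int} = {A, - A}" "A \<noteq> - A"
proof -
  obtain B where B: "B \<in> SL2Z" "act B z \<in> fund"
    using ex_act_in_fund[OF assms(1)] by blast
  have "z = act (minv B) (act B z)"
    using B assms by simp
  then have "act B z \<in> fund_int"
    using B assms unfolding bad_points_def by (blast dest: minv_SL2Z)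
  define A where "A = minv B"
  have A: "A \<in> SL2Z" "minv A = B"
    using B by (auto simp: A_def minv_SL2Z) (auto simp: minv_def intro: mat2_eqI)
  have "C = A \<or> C = - A" if C: "C \<in> SL2Z" "act (minv C) z \<in> fund_int" for C
  proof -
    have "act (minv C ** A) (act B z) = act (minv C) z"
      using C A B assms Im_act_pos[OF B(1) assms(1)] by (simp add: act_mult minv_SL2Z A_def)
    then have "minv C ** A = mat 1 \<or> minv C ** A = - mat 1"
      using C A B \<open>act B z \<in> fund_int\<close> by (intro act_fund_int_unique[of _ "act B z"]) (auto simp: SL2Z_mult minv_SL2Z)
    then have "C ** (minv C ** A) = C \<or> C ** (minv C ** A) = - C"
    proof
      assume "minv C ** A = - mat 1"
      moreover have "C ** - mat 1 = - C"
        by (rule mat2_eqI) (auto simp: mat_def)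
      ultimately show ?thesis by simp
    qed auto
    then show ?thesis
      using C by (auto simp: matrix_mul_assoc minv_right)
  qed
  moreover have "minv (- A) = - minv A"
    by (rule mat2_eqI) (auto simp: minv_def)
  moreover have "A \<noteq> - A"
  proof
    assume "A = - A"
    then have "A $ i $ j = - A $ i $ j" for i j by (metis vector_uminus_component)
    then have "A $ i $ j = 0" for i j by (metis equal_neg_zero)
    with A show False by (simp add: SL2Z_iff)
  qed
  ultimately show ?thesis
    using A \<open>act B z \<in> fund_int\<close> by (intro that[of A]) auto
qed

subsection \<open>Unfolding\<close>

text \<open>The coefficient of the pullback under A of the 2-form \<Phi> dx dy: the Jacobian of
  \<open>act A\<close> is |c z + d|^(-4).\<close>

definition slash4 :: "(complex \<Rightarrow> complex) \<Rightarrow> int ^ 2 ^ 2 \<Rightarrow> complex \<Rightarrow> complex" where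
  "slash4 \<Phi> A z = (cmod (1 / (aut_factor A z)\<^sup>2))\<^sup>2 *\<^sub>R \<Phi> (act A z)"

lemma slash4_mult:
  assumes "A \<in> SL2Z" "B \<in> SL2Z" "Im z > 0"
  shows "slash4 \<Phi> (A ** B) z = slash4 (slash4 \<Phi> A) B z"
  using assms by (simp add: slash4_def act_mult aut_factor_mult norm_mult norm_divide norm_power power_mult_distrib power_divide mult.commute)

lemma mat_1_Gamma1: "mat 1 \<in> Gamma1 N"
  using mat_1_SL2Z by (auto simp: Gamma1_def mat_def)

lemma slash4_cong_row:
  assumes N: "N \<ge> 1" and AB: "A \<in> SL2Z" "B \<in> SL2Z" "bottom_row N A = bottom_row N B"
    and inv: "\<And>A z. A \<in> Gamma1 N \<Longrightarrow> Im z > 0 \<Longrightarrow> slash4 \<Phi> A z = \<Phi> z" and z: "Im z > 0"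
  shows "slash4 \<Phi> A z = slash4 \<Phi> B z"
proof -
  obtain C where C: "C \<in> Gamma1 N" "C \<in> SL2Z" "C ** B = A"
    using bottom_row_cosetE[OF N AB] .
  have "slash4 \<Phi> A z = slash4 (slash4 \<Phi> C) B z"
    using C AB z by (simp flip: slash4_mult)
  also have "\<dots> = slash4 \<Phi> B z"
    using AB z inv[OF C(1)] Im_act_pos by (simp add: slash4_def[of _ B])
  finally show ?thesis .
qed

lemma continuous_on_slash4:
  assumes "continuous_on upper_half_plane \<Phi>" "A \<in> SL2Z"
  shows "continuous_on upper_half_plane (slash4 \<Phi> A)"
proof -
  have "continuous_on upper_half_plane (act A)"
    by (rule DERIV_continuous_on[OF has_field_derivative_act]) (use assms in auto)
  then have "continuous_on upper_half_plane (\<lambda>z. \<Phi> (act A z))"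
    by (rule continuous_on_compose2[OF assms(1)]) (use assms Im_act_pos in auto)
  then show ?thesis
    unfolding slash4_def[abs_def] using assms aut_factor_nonzero
    by (intro continuous_intros) (auto simp: aut_factor_def intro!: continuous_intros)
qed

lemma set_borel_measurable_continuous:
  fixes \<Phi> :: "complex \<Rightarrow> complex"
  assumes "continuous_on upper_half_plane \<Phi>" "S \<in> sets borel" "S \<subseteq> upper_half_plane"
  shows "set_borel_measurable borel S \<Phi>"
  unfolding set_borel_measurable_def
  using borel_measurable_continuous_on_indicator[OF assms(2) continuous_on_subset[OF assms(1,3)]] .

text \<open>Every coset contains exactly one matrix carrying z into D. Two of them with the same row
  differ by C in \<open>Gamma1 N\<close>, so their images agree by uniqueness in D and A = B or A =
  - B. The second case forces C = \<open>- mat 1\<close>, hence N divides 2, which N \<ge> 3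
  excludes.\<close>

lemma bij_betw_bottom_row:
  assumes N: "N \<ge> 3" and D: "fundamental_domain N D"
    and g: "\<And>x. x \<in> E_set N \<Longrightarrow> lifts N (g x) x"
    and z: "z \<in> fund_int"
  shows "bij_betw (bottom_row N) {A \<in> SL2Z. act A z \<in> D} (E_set N)"
proof (rule bij_betwI')
  have N1: "N \<ge> 1" using N by simp
  have pos: "Im z > 0" using z by (simp add: fund_int_def)
  fix A B assume AB: "A \<in> {A \<in> SL2Z. act A z \<in> D}" "B \<in> {A \<in> SL2Z. act A z \<in> D}"
  show "bottom_row N A = bottom_row N B \<longleftrightarrow> A = B"
  proof
    assume eq: "bottom_row N A = bottom_row N B"
    obtain C where C: "C \<in> Gamma1 N" "C \<in> SL2Z" "C ** B = A"
      using bottom_row_cosetE[OF N1 _ _ eq] AB by blast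
    have Bz: "Im (act B z) > 0"
      using AB pos by (auto intro: Im_act_pos)
    have CB: "act A z = act C (act B z)"
      using C AB pos by (simp flip: act_mult)
    have "\<exists>!w. w \<in> D \<and> (\<exists>A\<in>Gamma1 N. w = act A (act B z))"
      using D Bz by (auto simp: fundamental_domain_def)
    moreover have "act A z \<in> D \<and> (\<exists>A'\<in>Gamma1 N. act A z = act A' (act B z))"
      using AB C CB by auto
    moreover have "act B z \<in> D \<and> (\<exists>A'\<in>Gamma1 N. act B z = act A' (act B z))"
      using AB by (auto intro!: bexI[of _ "mat 1"] simp: mat_1_Gamma1)
    ultimately have AB_eq: "act A z = act B z"
      by blast
    have "act (minv B ** A) z = z"
      using AB AB_eq pos by (simp add: act_mult minv_SL2Z)
    then have "minv B ** A = mat 1 \<or> minv B ** A = - mat 1"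
      using AB z by (intro act_fund_int_unique[of _ z]) (auto simp: SL2Z_mult minv_SL2Z)
    then show "A = B"
    proof
      assume "minv B ** A = mat 1"
      then have "B ** (minv B ** A) = B" by simp
      then show ?thesis using AB by (simp add: matrix_mul_assoc minv_right)
    next
      assume "minv B ** A = - mat 1"
      then have "B ** (minv B ** A) = - B" by (auto intro: mat2_eqI simp: mat_def)
      then have "A = - B" using AB by (simp add: matrix_mul_assoc minv_right)
      then have "C ** B = - B"
        using C by simp
      then have "(C ** B) ** minv B = - B ** minv B"
        by simp
      also have "- B ** minv B = - (B ** minv B)"
        by (rule mat2_eqI) simp_all
      finally have "C = - mat 1"
        using AB by (simp add: minv_right flip: matrix_mul_assoc)
      with C(1) have "[-1 = 1] (mod int N)"
        by (auto simp: Gamma1_def mat_def)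
      then have "int N dvd 2"
        by (simp add: cong_iff_dvd_diff)
      then show ?thesis
        using N zdvd_imp_le[of "int N" 2] by auto
    qed
  qed simp
next
  fix A assume "A \<in> {A \<in> SL2Z. act A z \<in> D}"
  then show "bottom_row N A \<in> E_set N"
    using N by (auto intro: bottom_row_in_E_set)
next
  fix x assume x: "x \<in> E_set N"
  have N1: "N \<ge> 1" using N by simp
  have pos: "Im z > 0" using z by (simp add: fund_int_def)
  have gx: "g x \<in> SL2Z" "bottom_row N (g x) = x"
    using g[OF x] lifts_iff_row[OF N1 x] by auto
  have "Im (act (g x) z) > 0"
    using gx pos by (auto intro: Im_act_pos)
  then obtain A where A: "A \<in> Gamma1 N" "act A (act (g x) z) \<in> D"
    using D unfolding fundamental_domain_def by (metis upper_half_plane_iff)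
  then show "\<exists>A\<in>{A \<in> SL2Z. act A z \<in> D}. x = bottom_row N A"
    using gx pos N1 by (intro bexI[of _ "A ** g x"]) (auto simp: Gamma1_mult_row act_mult Gamma1_SL2Z SL2Z_mult)
qed

lemma pair_sigma_finite_SL2Z: "pair_sigma_finite (count_space SL2Z) (lborel :: complex measure)"
  by (intro pair_sigma_finite.intro sigma_finite_measure_count_space_countable countable_SL2Z
        sigma_finite_lborel)

text \<open>The image set is Borel because it is a preimage under
  \<open>act (minv A)\<close>.\<close>

lemma set_integral_act:
  fixes \<Phi> :: "complex \<Rightarrow> complex"
  assumes A: "A \<in> SL2Z" and S: "S \<in> sets borel" "S \<subseteq> upper_half_plane"
    and \<Phi>: "continuous_on upper_half_plane \<Phi>"
  shows "act A ` S \<in> sets borel"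
    and "set_integrable lborel S (slash4 \<Phi> A) \<longleftrightarrow> set_integrable lborel (act A ` S) \<Phi>"
    and "set_integrable lborel S (slash4 \<Phi> A) \<Longrightarrow> (LINT z:S|lborel. slash4 \<Phi> A z) = (LINT z:act A ` S|lborel. \<Phi> z)"
proof -
  have eq: "act A ` S = {z \<in> upper_half_plane. act (minv A) z \<in> S}"
    using A S by (force simp: minv_SL2Z intro: Im_act_pos)
  have [measurable]: "S \<in> sets borel" by fact
  show meas: "act A ` S \<in> sets borel"
    unfolding eq by measurable
  have pos: "0 < Im z" if "z \<in> S" for z
    using S(2) that by auto
  have sub: "act A ` S \<subseteq> upper_half_plane"
    unfolding eq by auto
  note cov = integral_holomorphic_change_of_variables[of S "act A" "\<lambda>z. 1 / (aut_factor A z)\<^sup>2" \<Phi>,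
      folded slash4_def upper_half_plane_iff, OF S(1) meas has_field_derivative_act[OF A]
      inj_on_subset[OF inj_on_act[OF A] S(2)] set_borel_measurable_continuous[OF \<Phi> meas sub]
      set_borel_measurable_continuous[OF continuous_on_slash4[OF \<Phi> A] S]]
  show "set_integrable lborel S (slash4 \<Phi> A) \<longleftrightarrow> set_integrable lborel (act A ` S) \<Phi>"
    by (rule cov(1)[OF pos])
  then show "set_integrable lborel S (slash4 \<Phi> A) \<Longrightarrow> (LINT z:S|lborel. slash4 \<Phi> A z) = (LINT z:act A ` S|lborel. \<Phi> z)"
    using cov(2)[OF pos] by blast
qed

lemma slash4_norm: "slash4 (\<lambda>z. of_real (cmod (\<Phi> z))) A z = of_real (cmod (slash4 \<Phi> A z))"
  by (simp add: slash4_def scaleR_conv_of_real norm_mult norm_power norm_divide)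

text \<open>Double counting of the pairs (A, z) with z in \<open>fund_int\<close> and A z in D. For
  fixed z the matrices A correspond to E_N, which gives the right side. For fixed A one substitutes
  w = A z; a generic w in D then belongs to two matrices, which gives twice the integral over D.
  Integrability over D is an outcome of the Fubini argument.\<close>

lemma unfold_integral:
  fixes \<Phi> :: "complex \<Rightarrow> complex"
  assumes N: "N \<ge> 3" and D: "fundamental_domain N D"
    and g: "\<And>x. x \<in> E_set N \<Longrightarrow> lifts N (g x) x"
    and \<Phi>: "continuous_on upper_half_plane \<Phi>"
    and inv: "\<And>A z. A \<in> Gamma1 N \<Longrightarrow> Im z > 0 \<Longrightarrow> slash4 \<Phi> A z = \<Phi> z"
    and int: "\<And>x. x \<in> E_set N \<Longrightarrow> set_integrable lborel fund_int (slash4 \<Phi> (g x))"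
  shows "set_integrable lborel D \<Phi>"
    and "2 * (LINT z:D|lborel. \<Phi> z) = (\<Sum>x\<in>E_set N. LINT z:fund_int|lborel. slash4 \<Phi> (g x) z)"
proof -
  interpret P: pair_sigma_finite "count_space SL2Z" "lborel :: complex measure"
    by (rule pair_sigma_finite_SL2Z)
  interpret Q: pair_sigma_finite "lborel :: complex measure" "count_space SL2Z" ..
  have N1: "N \<ge> 1" using N by simp
  have D_borel [measurable]: "D \<in> sets borel" and D_sub: "D \<subseteq> upper_half_plane"
    using D by (auto simp: fundamental_domain_def)
  have gx: "g x \<in> SL2Z" "bottom_row N (g x) = x" if "x \<in> E_set N" for x
    using g[OF that] lifts_iff_row[OF N1 that] by auto
  define S where "S A = {z \<in> fund_int. act A z \<in> D}" for A
  have S_borel [measurable]: "S A \<in> sets borel" for A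
    unfolding S_def by measurable
  have S_sub: "S A \<subseteq> upper_half_plane" "S A \<subseteq> fund_int" for A
    by (auto simp: S_def fund_int_def)
  have act_S: "act A ` S A = {z \<in> D. act (minv A) z \<in> fund_int}" if "A \<in> SL2Z" for A
    using that D_sub by (force simp: S_def fund_int_def minv_SL2Z)
  note sia = set_integral_act[OF _ S_borel S_sub(1)]
  \<comment> \<open>The same double integrand in the coordinate z of the standard domain
    (\<open>k1\<close>) and in the coordinate w = A z of D (\<open>k2\<close>).\<close>
  define k1 where "k1 A z = indicat_real (S A) z *\<^sub>R slash4 \<Phi> A z" for A z
  define k2 where "k2 A z = indicat_real (act A ` S A) z *\<^sub>R \<Phi> z" for A z
  have k1_meas: "k1 A \<in> borel_measurable borel" if "A \<in> SL2Z" for A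
    using set_borel_measurable_continuous[OF continuous_on_slash4[OF \<Phi> that] S_borel S_sub(1)]
    by (simp add: k1_def[abs_def] set_borel_measurable_def)
  have k2_meas: "k2 A \<in> borel_measurable borel" if "A \<in> SL2Z" for A
  proof -
    have "act A ` S A \<subseteq> upper_half_plane"
      using act_S[OF that] D_sub by blast
    from set_borel_measurable_continuous[OF \<Phi> sia(1)[OF that \<Phi>] this] show ?thesis
      by (simp add: k2_def[abs_def] set_borel_measurable_def)
  qed
  have k1P: "(\<lambda>(A, z). k1 A z) \<in> borel_measurable (count_space SL2Z \<Otimes>\<^sub>M lborel)"
    by (rule measurable_pair_measure_countable1[OF countable_SL2Z]) (simp add: k1_meas)
  have k2P: "(\<lambda>(A, z). k2 A z) \<in> borel_measurable (count_space SL2Z \<Otimes>\<^sub>M lborel)"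
    by (rule measurable_pair_measure_countable1[OF countable_SL2Z]) (simp add: k2_meas)
  have k1Q: "(\<lambda>(z, A). k1 A z) \<in> borel_measurable (lborel \<Otimes>\<^sub>M count_space SL2Z)"
    using measurable_pair_swap[OF k1P] by (simp add: case_prod_beta')
  \<comment> \<open>For fixed z only finitely many A contribute, so the integral over the counting
    measure is a finite sum.\<close>
  have supp1: "z \<in> fund_int \<Longrightarrow> (\<integral>A. h A \<partial>count_space SL2Z) = (\<Sum>A | A \<in> SL2Z \<and> act A z \<in> D. h A)"
    "z \<notin> fund_int \<Longrightarrow> (\<integral>A. h A \<partial>count_space SL2Z) = 0" "integrable (count_space SL2Z) h"
    if h: "\<And>A. z \<notin> S A \<Longrightarrow> h A = 0" for z and h :: "int ^ 2 ^ 2 \<Rightarrow> 'b :: {banach, second_countable_topology}"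
  proof -
    have sub: "{A \<in> SL2Z. h A \<noteq> 0} \<subseteq> {A \<in> SL2Z. act A z \<in> D}"
      using h by (auto simp: S_def)
    have fin: "finite {A \<in> SL2Z. act A z \<in> D}" if "z \<in> fund_int"
      using bij_betw_finite[OF bij_betw_bottom_row[OF N D g that]] finite_E_set by blast
    have fin': "finite {A \<in> SL2Z. h A \<noteq> 0}"
    proof (cases "z \<in> fund_int")
      case True
      then show ?thesis using fin sub finite_subset by blast
    next
      case False
      then have "{A \<in> SL2Z. h A \<noteq> 0} = {}" using h by (auto simp: S_def)
      then show ?thesis by (simp only: finite.emptyI)
    qed
    show "(\<integral>A. h A \<partial>count_space SL2Z) = (\<Sum>A | A \<in> SL2Z \<and> act A z \<in> D. h A)" if "z \<in> fund_int"
      unfolding lebesgue_integral_count_space_finite_support[OF fin']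
      using sub fin[OF that] by (intro sum.mono_neutral_left) auto
    show "(\<integral>A. h A \<partial>count_space SL2Z) = 0" if "z \<notin> fund_int"
      using h that by (intro integral_eq_zero_AE) (auto simp: S_def AE_count_space)
    have "(\<integral>\<^sup>+A. ennreal (norm (h A)) \<partial>count_space SL2Z) = (\<Sum>A\<in>{A \<in> SL2Z. h A \<noteq> 0}. ennreal (norm (h A)))"
      by (rule nn_integral_count_space'[OF fin']) auto
    then show "integrable (count_space SL2Z) h"
      using fin' by (simp add: integrable_iff_bounded)
  qed
  \<comment> \<open>The function h is \<open>cmod\<close> when absolute integrability is checked and
    the identity when the value is computed.\<close>
  have k1_sum: "(\<integral>A. h (k1 A z) \<partial>count_space SL2Z) = (\<Sum>x\<in>E_set N. h (indicat_real fund_int z *\<^sub>R slash4 \<Phi> (g x) z))"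
    if h: "h 0 = 0" for z and h :: "complex \<Rightarrow> 'b :: {banach, second_countable_topology}"
  proof (cases "z \<in> fund_int")
    case True
    have eq: "slash4 \<Phi> A z = slash4 \<Phi> (g (bottom_row N A)) z" if "A \<in> SL2Z" for A
      using that True gx by (intro slash4_cong_row[OF N1 _ _ _ inv]) (auto simp: bottom_row_in_E_set[OF N1] fund_int_def)
    have "(\<integral>A. h (k1 A z) \<partial>count_space SL2Z) = (\<Sum>A | A \<in> SL2Z \<and> act A z \<in> D. h (k1 A z))"
      using True h by (intro supp1) (auto simp: k1_def)
    also have "\<dots> = (\<Sum>A | A \<in> SL2Z \<and> act A z \<in> D. h (slash4 \<Phi> (g (bottom_row N A)) z))"
      using True by (intro sum.cong) (auto simp: k1_def S_def eq)
    also have "\<dots> = (\<Sum>x\<in>E_set N. h (slash4 \<Phi> (g x) z))"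
      by (rule sum.reindex_bij_betw[OF bij_betw_bottom_row[OF N D g True]])
    finally show ?thesis using True by simp
  next
    case False
    then show ?thesis using h by (subst supp1(2)[of z]) (auto simp: k1_def)
  qed
  have "integrable (lborel \<Otimes>\<^sub>M count_space SL2Z) (\<lambda>(z, A). k1 A z)"
  proof (rule Q.Fubini_integrable[OF k1Q])
    show "integrable lborel (\<lambda>z. \<integral>A. norm ((\<lambda>(z, A). k1 A z) (z, A)) \<partial>count_space SL2Z)"
      unfolding prod.case k1_sum[of cmod, OF norm_zero] using int
      by (intro Bochner_Integration.integrable_sum integrable_norm) (simp add: set_integrable_def)
    show "AE z in lborel. integrable (count_space SL2Z) (\<lambda>A. (\<lambda>(z, A). k1 A z) (z, A))"
    proof (rule AE_I2)
      show "integrable (count_space SL2Z) (\<lambda>A. (\<lambda>(z, A). k1 A z) (z, A))" for z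
        by (rule supp1(3)[of z]) (simp add: k1_def)
    qed
  qed
  then have k1_int: "integrable (count_space SL2Z \<Otimes>\<^sub>M lborel) (\<lambda>(A, z). k1 A z)"
    using Q.integrable_product_swap by (fastforce simp: case_prod_beta')
  have k1_A: "integrable lborel (k1 A)" if "A \<in> SL2Z" for A
    using P.AE_integrable_fst[OF k1_int] that by (auto simp: AE_count_space)
  have k1_k2: "(\<integral>z. k1 A z \<partial>lborel) = (\<integral>z. k2 A z \<partial>lborel)" "integrable lborel (k2 A)"
    "(\<integral>z. cmod (k1 A z) \<partial>lborel) = (\<integral>z. cmod (k2 A z) \<partial>lborel)" if "A \<in> SL2Z" for A
  proof -
    have int1: "set_integrable lborel (S A) (slash4 \<Phi> A)"
      using k1_A[OF that] by (simp add: k1_def[abs_def] set_integrable_def)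
    then show "integrable lborel (k2 A)"
      unfolding sia(2)[OF that \<Phi>] by (simp add: k2_def[abs_def] set_integrable_def)
    show "(\<integral>z. k1 A z \<partial>lborel) = (\<integral>z. k2 A z \<partial>lborel)"
      using sia(3)[OF that \<Phi> int1] by (simp add: k1_def k2_def set_lebesgue_integral_def)
    \<comment> \<open>The substitution is repeated for |\<Phi>|, because Fubini for
      \<open>k2\<close> needs the integrals of the absolute values.\<close>
    have \<Phi>': "continuous_on upper_half_plane (\<lambda>z. of_real (cmod (\<Phi> z)) :: complex)"
      by (intro continuous_intros \<Phi>)
    have "set_integrable lborel (S A) (slash4 (\<lambda>z. of_real (cmod (\<Phi> z))) A)"
      using set_integrable_norm[OF int1] unfolding slash4_norm
      by (simp add: set_integrable_def complex_of_real_integrable_eq[symmetric] scaleR_conv_of_real)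
    from sia(3)[OF that \<Phi>' this]
    have "complex_of_real (\<integral>z. cmod (k1 A z) \<partial>lborel) = of_real (\<integral>z. cmod (k2 A z) \<partial>lborel)"
      unfolding slash4_norm set_lebesgue_integral_def
      by (simp add: k1_def k2_def scaleR_conv_of_real norm_mult flip: integral_complex_of_real of_real_mult)
    then show "(\<integral>z. cmod (k1 A z) \<partial>lborel) = (\<integral>z. cmod (k2 A z) \<partial>lborel)"
      by simp
  qed
  have k2_int: "integrable (count_space SL2Z \<Otimes>\<^sub>M lborel) (\<lambda>(A, z). k2 A z)"
  proof (rule P.Fubini_integrable[OF k2P])
    have "integrable (count_space SL2Z \<Otimes>\<^sub>M lborel) (\<lambda>(A, z). cmod (k1 A z))"
      using integrable_norm[OF k1_int] by (simp add: case_prod_beta')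
    from P.integrable_fst[OF this]
    have "integrable (count_space SL2Z) (\<lambda>A. \<integral>z. cmod (k1 A z) \<partial>lborel)" .
    also have "?this \<longleftrightarrow> integrable (count_space SL2Z) (\<lambda>A. \<integral>z. cmod (k2 A z) \<partial>lborel)"
      by (rule Bochner_Integration.integrable_cong[OF refl]) (simp add: k1_k2(3))
    finally show "integrable (count_space SL2Z) (\<lambda>A. \<integral>z. norm ((\<lambda>(A, z). k2 A z) (A, z)) \<partial>lborel)"
      by simp
    show "AE A in count_space SL2Z. integrable lborel (\<lambda>z. (\<lambda>(A, z). k2 A z) (A, z))"
      by (auto simp: AE_count_space k1_k2)
  qed
  \<comment> \<open>A matrix B contributes at z in D exactly when \<open>act (minv B) z\<close> is
    interior, that is for B = A and B = - A.\<close>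
  have k2_sum: "(\<integral>A. k2 A z \<partial>count_space SL2Z) = indicat_real D z *\<^sub>R (2 * \<Phi> z)" if nb: "z \<notin> bad_points" for z
  proof (cases "z \<in> D")
    case True
    then have "Im z > 0" using D_sub by auto
    then obtain A
      where A: "A \<in> SL2Z" "{B \<in> SL2Z. act (minv B) z \<in> fund_int} = {A, - A}" "A \<noteq> - A"
      using nb by (rule representations_not_bad)
    have mem: "B \<in> {A, - A} \<longleftrightarrow> act (minv B) z \<in> fund_int" if "B \<in> SL2Z" for B
      using that A(2) by blast
    have eq: "k2 B z = \<Phi> z" if "B \<in> {A, - A}" for B
    proof -
      have "B \<in> SL2Z" using that A(1) by auto
      with mem[OF this] that True show ?thesis by (simp add: k2_def act_S)
    qed
    have sub: "{B \<in> SL2Z. k2 B z \<noteq> 0} \<subseteq> {A, - A}"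
    proof
      fix B assume B: "B \<in> {B \<in> SL2Z. k2 B z \<noteq> 0}"
      then have "z \<in> act B ` S B" by (cases "z \<in> act B ` S B") (simp_all add: k2_def)
      then have "act (minv B) z \<in> fund_int" using B by (simp add: act_S)
      with B mem[of B] show "B \<in> {A, - A}" by blast
    qed
    have "finite {B \<in> SL2Z. k2 B z \<noteq> 0}"
      by (rule finite_subset[OF sub]) simp
    from lebesgue_integral_count_space_finite_support[OF this]
    have "(\<integral>B. k2 B z \<partial>count_space SL2Z) = (\<Sum>B | B \<in> SL2Z \<and> k2 B z \<noteq> 0. k2 B z)" .
    also have "\<dots> = (\<Sum>B\<in>{A, - A}. k2 B z)"
    proof (rule sum.mono_neutral_left)
      show "\<forall>B\<in>{A, - A} - {B \<in> SL2Z. k2 B z \<noteq> 0}. k2 B z = 0"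
      proof
        fix B assume B: "B \<in> {A, - A} - {B \<in> SL2Z. k2 B z \<noteq> 0}"
        then have "B \<in> SL2Z" using A(1) by auto
        with B show "k2 B z = 0" by blast
      qed
    qed (use sub in auto)
    also have "\<dots> = (\<Sum>B\<in>{A, - A}. \<Phi> z)"
      by (rule sum.cong[OF refl eq])
    also have "\<dots> = 2 * \<Phi> z"
      using A(3) by simp
    finally show ?thesis using True by simp
  next
    case False
    then have "(\<integral>A. k2 A z \<partial>count_space SL2Z) = (\<integral>A. 0 \<partial>count_space SL2Z)"
      by (intro Bochner_Integration.integral_cong[OF refl]) (simp add: k2_def act_S)
    then show ?thesis using False by simp
  qed
  have ae: "AE z in lborel. (\<integral>A. k2 A z \<partial>count_space SL2Z) = indicat_real D z *\<^sub>R (2 * \<Phi> z)"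
    using AE_not_bad by eventually_elim (rule k2_sum)
  have "continuous_on upper_half_plane (\<lambda>z. 2 * \<Phi> z)"
    by (intro continuous_intros \<Phi>)
  from set_borel_measurable_continuous[OF this D_borel D_sub]
  have m: "(\<lambda>z. indicat_real D z *\<^sub>R (2 * \<Phi> z)) \<in> borel_measurable lborel"
    by (simp add: set_borel_measurable_def)
  have int2: "integrable lborel (\<lambda>z. \<integral>A. k2 A z \<partial>count_space SL2Z)"
    by (rule P.integrable_snd[OF k2_int])
  then have "integrable lborel (\<lambda>z. indicat_real D z *\<^sub>R (2 * \<Phi> z))"
    using integrable_cong_AE[OF _ m ae] by auto
  then have "integrable lborel (\<lambda>z. (1 / 2) * (indicat_real D z *\<^sub>R (2 * \<Phi> z)))"
    by (rule integrable_mult_right)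
  also have "(\<lambda>z. (1 / 2) * (indicat_real D z *\<^sub>R (2 * \<Phi> z))) = (\<lambda>z. indicat_real D z *\<^sub>R \<Phi> z)"
    by (rule ext) simp
  finally show "set_integrable lborel D \<Phi>"
    unfolding set_integrable_def .
  have "2 * (LINT z:D|lborel. \<Phi> z) = (\<integral>z. indicat_real D z *\<^sub>R (2 * \<Phi> z) \<partial>lborel)"
    unfolding set_lebesgue_integral_def integral_mult_right_zero[symmetric]
    by (simp only: mult_scaleR_right)
  also have "\<dots> = (\<integral>z. (\<integral>A. k2 A z \<partial>count_space SL2Z) \<partial>lborel)"
    by (rule integral_cong_AE[OF m borel_measurable_integrable[OF int2]]) (use ae in eventually_elim, simp)
  also have "\<dots> = (\<integral>A. (\<integral>z. k2 A z \<partial>lborel) \<partial>count_space SL2Z)"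
    by (rule P.Fubini_integral[OF k2_int])
  also have "\<dots> = (\<integral>A. (\<integral>z. k1 A z \<partial>lborel) \<partial>count_space SL2Z)"
    by (rule Bochner_Integration.integral_cong) (auto simp: k1_k2)
  also have "\<dots> = (\<integral>z. (\<integral>A. k1 A z \<partial>count_space SL2Z) \<partial>lborel)"
    by (rule P.Fubini_integral[OF k1_int, symmetric])
  also have "\<dots> = (\<Sum>x\<in>E_set N. LINT z:fund_int|lborel. slash4 \<Phi> (g x) z)"
    unfolding k1_sum[of "\<lambda>w. w", OF refl] set_lebesgue_integral_def using int
    by (intro Bochner_Integration.integral_sum) (auto simp: set_integrable_def)
  finally show "2 * (LINT z:D|lborel. \<Phi> z) = (\<Sum>x\<in>E_set N. LINT z:fund_int|lborel. slash4 \<Phi> (g x) z)" .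
qed

subsection \<open>Stokes' theorem on the standard domain\<close>

text \<open>The form is P dx + Q dy, and \<open>P' z \<i> = Q' z 1\<close> says that the
  y-derivative of P is the x-derivative of Q. Total derivatives allow the chain rule along curved
  coordinates; their continuity allows the order of integration to be exchanged.\<close>

definition C1_closed :: "form1 \<Rightarrow> bool" where
  "C1_closed \<beta> \<longleftrightarrow> (\<exists>P Q P' Q'.
     (\<forall>z\<in>upper_half_plane. (\<forall>w. \<beta> z w = of_real (Re w) * P z + of_real (Im w) * Q z)
        \<and> (P has_derivative P' z) (at z) \<and> (Q has_derivative Q' z) (at z) \<and> P' z \<i> = Q' z 1)
     \<and> (\<forall>w. continuous_on upper_half_plane (\<lambda>z. P' z w))
     \<and> (\<forall>w. continuous_on upper_half_plane (\<lambda>z. Q' z w)))"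

lemma C1_closedE:
  assumes "C1_closed \<beta>"
  obtains P Q P' Q' where
    "\<And>z w. Im z > 0 \<Longrightarrow> \<beta> z w = of_real (Re w) * P z + of_real (Im w) * Q z"
    "\<And>z. Im z > 0 \<Longrightarrow> (P has_derivative P' z) (at z)"
    "\<And>z. Im z > 0 \<Longrightarrow> (Q has_derivative Q' z) (at z)"
    "\<And>z. Im z > 0 \<Longrightarrow> P' z \<i> = Q' z 1"
    "\<And>w. continuous_on upper_half_plane (\<lambda>z. P' z w)"
    "\<And>w. continuous_on upper_half_plane (\<lambda>z. Q' z w)"
proof -
  from assms obtain P Q P' Q' where *:
      "\<forall>z\<in>upper_half_plane. (\<forall>w. \<beta> z w = of_real (Re w) * P z + of_real (Im w) * Q z)
        \<and> (P has_derivative P' z) (at z) \<and> (Q has_derivative Q' z) (at z) \<and> P' z \<i> = Q' z 1"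
      "\<forall>w. continuous_on upper_half_plane (\<lambda>z. P' z w)"
      "\<forall>w. continuous_on upper_half_plane (\<lambda>z. Q' z w)"
    unfolding C1_closed_def by (elim exE conjE) (rule that)
  show thesis
    by (rule that[of P Q P' Q']) (use * in simp_all)
qed

lemma C1_closed_linear:
  assumes "C1_closed \<beta>" "Im z > 0"
  shows "\<beta> z w = of_real (Re w) * \<beta> z 1 + of_real (Im w) * \<beta> z \<i>"
proof -
  obtain P Q P' Q' where PQ: "\<And>z w. Im z > 0 \<Longrightarrow> \<beta> z w = of_real (Re w) * P z + of_real (Im w) * Q z"
    by (rule C1_closedE[OF assms(1)]) (rule that)
  show ?thesis
    unfolding PQ[OF assms(2)] by simp
qed

lemma C1_closed_continuous:
  assumes "C1_closed \<beta>"
  shows "continuous_on upper_half_plane (\<lambda>z. \<beta> z w)"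
proof -
  obtain P Q P' Q' where PQ: "\<And>z w. Im z > 0 \<Longrightarrow> \<beta> z w = of_real (Re w) * P z + of_real (Im w) * Q z"
    and d: "\<And>z. Im z > 0 \<Longrightarrow> (P has_derivative P' z) (at z)" "\<And>z. Im z > 0 \<Longrightarrow> (Q has_derivative Q' z) (at z)"
    by (rule C1_closedE[OF assms]) (rule that)
  have "continuous_on upper_half_plane P"
    by (rule has_derivative_continuous_on[OF has_derivative_at_withinI[OF d(1)]]) simp
  moreover have "continuous_on upper_half_plane Q"
    by (rule has_derivative_continuous_on[OF has_derivative_at_withinI[OF d(2)]]) simp
  ultimately have "continuous_on upper_half_plane (\<lambda>z. of_real (Re w) * P z + of_real (Im w) * Q z)"
    by (intro continuous_intros)
  then show ?thesis
    by (rule continuous_on_eq) (simp add: PQ)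
qed

text \<open>Coordinates on the strip above the unit arc: \<open>x\<close> is the real part and \<open>t\<close> the height above
  the arc, so that the truncated fundamental domain becomes a rectangle.\<close>

definition strip :: "real \<Rightarrow> real \<Rightarrow> complex" where
  "strip x t = Complex x (sqrt (1 - x\<^sup>2) + t)"

definition strip_dx :: "real \<Rightarrow> complex" where
  "strip_dx x = Complex 1 (- x / sqrt (1 - x\<^sup>2))"

text \<open>The arc has height at least sqrt 3 / 2 here. The cruder bound 1/2 is the threshold
  \<open>Im z \<ge> 1 / 2\<close> in all growth estimates at the cusps.\<close>

lemma arc_pos:
  assumes "x \<in> {- 1 / 2..1 / 2 :: real}"
  shows "0 < 1 - x\<^sup>2" "1 / 2 < sqrt (1 - x\<^sup>2)"
proof -
  have "\<bar>x\<bar>\<^sup>2 \<le> (1 / 2)\<^sup>2"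
    using assms by (intro power_mono) auto
  then have "1 - x\<^sup>2 > 1 / 4"
    by (simp add: power2_eq_square)
  then show "0 < 1 - x\<^sup>2" "1 / 2 < sqrt (1 - x\<^sup>2)"
    using real_less_rsqrt[of "1 / 2" "1 - x\<^sup>2"] by (auto simp: power2_eq_square)
qed

lemma Im_strip:
  assumes "x \<in> {- 1 / 2..1 / 2}" "0 \<le> t"
  shows "1 / 2 < Im (strip x t)"
  using arc_pos[OF assms(1)] assms(2) by (simp add: strip_def)

lemma strip_dx_vector_derivative:
  assumes "x \<in> {- 1 / 2..1 / 2}"
  shows "((\<lambda>x. strip x t) has_vector_derivative strip_dx x) (at x within S)"
proof -
  have "((\<lambda>x. sqrt (1 - x\<^sup>2) + t) has_real_derivative - x / sqrt (1 - x\<^sup>2)) (at x within S)"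
    using arc_pos[OF assms] by (auto intro!: derivative_eq_intros simp: field_simps)
  then have "((\<lambda>x. of_real x + \<i> * of_real (sqrt (1 - x\<^sup>2) + t)) has_vector_derivative
      (of_real 1 + \<i> * of_real (- x / sqrt (1 - x\<^sup>2)))) (at x within S)"
    by (intro has_vector_derivative_add has_vector_derivative_mult_right has_vector_derivative_of_real)
       (auto simp: has_real_derivative_iff_has_vector_derivative[symmetric] intro!: derivative_eq_intros)
  then show ?thesis
    by (simp add: strip_def[abs_def] strip_dx_def Complex_eq)
qed

lemma strip_dt_vector_derivative: "((\<lambda>t. strip x t) has_vector_derivative \<i>) (at t within S)"
proof -
  have "((\<lambda>t. of_real x + \<i> * of_real (sqrt (1 - x\<^sup>2) + t)) has_vector_derivative
      (0 + \<i> * of_real 1)) (at t within S)"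
    by (intro has_vector_derivative_add has_vector_derivative_mult_right has_vector_derivative_of_real has_vector_derivative_const)
       (auto simp: has_real_derivative_iff_has_vector_derivative[symmetric] intro!: derivative_eq_intros)
  then show ?thesis
    by (simp add: strip_def[abs_def] Complex_eq)
qed

lemma continuous_on_strip [continuous_intros]:
  "continuous_on S a \<Longrightarrow> continuous_on S b \<Longrightarrow> continuous_on S (\<lambda>p. strip (a p) (b p))"
  by (auto simp: strip_def Complex_eq intro!: continuous_intros)

lemma continuous_on_strip_dx:
  assumes "continuous_on S a" "a ` S \<subseteq> {- 1 / 2..1 / 2}"
  shows "continuous_on S (\<lambda>p. strip_dx (a p))"
proof -
  have "0 < 1 - (a p)\<^sup>2" if "p \<in> S" for p
    using assms that by (intro arc_pos) auto
  then have "sqrt (1 - (a p)\<^sup>2) \<noteq> 0" if "p \<in> S" for p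
    using that by force
  then show ?thesis
    unfolding strip_dx_def Complex_eq by (intro continuous_intros assms) auto
qed

text \<open>G' dz wedge \<beta> is d(G \<beta>). In the coordinates (x, t), whose Jacobian is 1, the
  form \<beta> has components P + s Q along x and Q along t, where s is the slope of the arc; the
  fundamental theorem is then applied in each variable separately.\<close>

lemma stokes_strip:
  fixes G G' :: "complex \<Rightarrow> complex"
  assumes \<beta>: "C1_closed \<beta>"
    and G: "\<And>z. Im z > 0 \<Longrightarrow> (G has_field_derivative G' z) (at z)"
    and G': "continuous_on upper_half_plane G'"
    and T: "0 \<le> T"
  shows "integral {- 1 / 2..1 / 2} (\<lambda>x. integral {0..T} (\<lambda>t. G' (strip x t) * (\<beta> (strip x t) \<i> - \<i> * \<beta> (strip x t) 1))) =
    integral {0..T} (\<lambda>t. G (strip (1 / 2) t) * \<beta> (strip (1 / 2) t) \<i>)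
    - integral {0..T} (\<lambda>t. G (strip (- 1 / 2) t) * \<beta> (strip (- 1 / 2) t) \<i>)
    - integral {- 1 / 2..1 / 2} (\<lambda>x. G (strip x T) * \<beta> (strip x T) (strip_dx x))
    + integral {- 1 / 2..1 / 2} (\<lambda>x. G (strip x 0) * \<beta> (strip x 0) (strip_dx x))"
proof -
  obtain P Q P' Q' where PQ: "\<And>z w. Im z > 0 \<Longrightarrow> \<beta> z w = of_real (Re w) * P z + of_real (Im w) * Q z"
    and dP: "\<And>z. Im z > 0 \<Longrightarrow> (P has_derivative P' z) (at z)"
    and dQ: "\<And>z. Im z > 0 \<Longrightarrow> (Q has_derivative Q' z) (at z)"
    and cl: "\<And>z. Im z > 0 \<Longrightarrow> P' z \<i> = Q' z 1"
    and cP: "\<And>w. continuous_on upper_half_plane (\<lambda>z. P' z w)"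
    and cQ: "\<And>w. continuous_on upper_half_plane (\<lambda>z. Q' z w)"
    by (rule C1_closedE[OF \<beta>]) (rule that)
  have contG: "continuous_on upper_half_plane G"
    by (rule DERIV_continuous_on[OF has_field_derivative_at_within[OF G]]) simp
  have contP: "continuous_on upper_half_plane P"
    by (rule has_derivative_continuous_on[OF has_derivative_at_withinI[OF dP]]) simp
  have contQ: "continuous_on upper_half_plane Q"
    by (rule has_derivative_continuous_on[OF has_derivative_at_withinI[OF dQ]]) simp
  define s where "s x = - x / sqrt (1 - x\<^sup>2)" for x :: real
  let ?R = "cbox (- 1 / 2, 0) (1 / 2, T)"
  let ?X = "{- 1 / 2..1 / 2 :: real}" and ?T = "{0..T}"
  have pos: "Im (strip x t) > 0" if "x \<in> ?X" "t \<in> ?T" for x t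
    using Im_strip[of x t] that by auto
  have cR: "continuous_on ?R (\<lambda>(x, t). F (strip x t))" if "continuous_on upper_half_plane F" for F :: "complex \<Rightarrow> complex"
    unfolding case_prod_beta
    by (rule continuous_on_compose2[OF that]) (auto intro!: continuous_intros pos simp: cbox_Pair_eq)
  have cs: "continuous_on ?R (\<lambda>(x, t). complex_of_real (s x))"
  proof -
    have "sqrt (1 - x\<^sup>2) \<noteq> 0" if "x \<in> ?X" for x
      using arc_pos[OF that] by auto
    then show ?thesis
      unfolding case_prod_beta s_def by (intro continuous_intros) (auto simp: cbox_Pair_eq)
  qed
  \<comment> \<open>\<open>A\<close> is the x-derivative of G Q and \<open>B\<close> the
    t-derivative of G (P + s Q), along the strip.\<close>
  define A where "A x t = G' (strip x t) * strip_dx x * Q (strip x t)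
     + G (strip x t) * (Q' (strip x t) 1 + of_real (s x) * Q' (strip x t) \<i>)" for x t
  define B where "B x t = G' (strip x t) * \<i> * (P (strip x t) + of_real (s x) * Q (strip x t))
     + G (strip x t) * (P' (strip x t) \<i> + of_real (s x) * Q' (strip x t) \<i>)" for x t
  have dx: "strip_dx x = 1 + \<i> * of_real (s x)" for x
    by (simp add: strip_dx_def s_def complex_eq_iff)
  have lin: "Q' z (strip_dx x) = Q' z 1 + of_real (s x) * Q' z \<i>" if "Im z > 0" for z x
  proof -
    interpret bounded_linear "Q' z"
      using dQ[OF that] by (rule has_derivative_bounded_linear)
    have "strip_dx x = 1 + s x *\<^sub>R \<i>"
      by (simp add: strip_dx_def s_def complex_eq_iff)
    then have "Q' z (strip_dx x) = Q' z 1 + s x *\<^sub>R Q' z \<i>"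
      by (simp only: add scaleR)
    then show ?thesis
      by (simp add: scaleR_conv_of_real)
  qed
  note conts = cR[OF contG] cR[OF G'] cR[OF contP] cR[OF contQ] cR[OF cP] cR[OF cQ] cs
  have cA: "continuous_on ?R (\<lambda>(x, t). A x t)" and cB: "continuous_on ?R (\<lambda>(x, t). B x t)"
    unfolding A_def B_def dx case_prod_beta
    by (intro continuous_intros conts[unfolded case_prod_beta])+
  have FA: "((\<lambda>x. A x t) has_integral
      G (strip (1 / 2) t) * Q (strip (1 / 2) t) - G (strip (- 1 / 2) t) * Q (strip (- 1 / 2) t)) ?X" if t: "t \<in> ?T" for t
  proof (rule fundamental_theorem_of_calculus)
    fix x assume x: "x \<in> ?X"
    note p = pos[OF x t]
    have 1: "((\<lambda>x. G (strip x t)) has_vector_derivative strip_dx x * G' (strip x t)) (at x within ?X)"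
      by (rule field_vector_diff_chain_within[OF strip_dx_vector_derivative[OF x], unfolded o_def])
         (rule has_field_derivative_at_within[OF G[OF p]])
    have 2: "((\<lambda>x. Q (strip x t)) has_vector_derivative Q' (strip x t) (strip_dx x)) (at x within ?X)"
      by (rule vector_derivative_diff_chain_within[OF strip_dx_vector_derivative[OF x], unfolded o_def])
         (rule has_derivative_at_withinI[OF dQ[OF p]])
    show "((\<lambda>x. G (strip x t) * Q (strip x t)) has_vector_derivative A x t) (at x within ?X)"
      using has_vector_derivative_mult[OF 1 2] by (simp add: A_def lin[OF p] algebra_simps)
  qed simp
  have FB: "((\<lambda>t. B x t) has_integral
      G (strip x T) * \<beta> (strip x T) (strip_dx x) - G (strip x 0) * \<beta> (strip x 0) (strip_dx x)) ?T" if x: "x \<in> ?X" for x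
  proof -
    have "((\<lambda>t. B x t) has_integral
      G (strip x T) * (P (strip x T) + of_real (s x) * Q (strip x T))
      - G (strip x 0) * (P (strip x 0) + of_real (s x) * Q (strip x 0))) ?T"
    proof (rule fundamental_theorem_of_calculus[OF T])
      fix t assume t: "t \<in> ?T"
      note p = pos[OF x t]
      have 1: "((\<lambda>t. G (strip x t)) has_vector_derivative \<i> * G' (strip x t)) (at t within ?T)"
        by (rule field_vector_diff_chain_within[OF strip_dt_vector_derivative, unfolded o_def])
           (rule has_field_derivative_at_within[OF G[OF p]])
      have 2: "((\<lambda>t. P (strip x t)) has_vector_derivative P' (strip x t) \<i>) (at t within ?T)"
        by (rule vector_derivative_diff_chain_within[OF strip_dt_vector_derivative, unfolded o_def])
           (rule has_derivative_at_withinI[OF dP[OF p]])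
      have 3: "((\<lambda>t. Q (strip x t)) has_vector_derivative Q' (strip x t) \<i>) (at t within ?T)"
        by (rule vector_derivative_diff_chain_within[OF strip_dt_vector_derivative, unfolded o_def])
           (rule has_derivative_at_withinI[OF dQ[OF p]])
      show "((\<lambda>t. G (strip x t) * (P (strip x t) + of_real (s x) * Q (strip x t))) has_vector_derivative B x t) (at t within ?T)"
        using has_vector_derivative_mult[OF 1 has_vector_derivative_add[OF 2 has_vector_derivative_mult_right[OF 3, of "of_real (s x)"]]]
        by (simp add: B_def algebra_simps)
    qed
    moreover have "\<beta> (strip x t) (strip_dx x) = P (strip x t) + of_real (s x) * Q (strip x t)" if "t \<in> ?T" for t
      using PQ[OF pos[OF x that]] by (simp add: strip_dx_def s_def)
    ultimately show ?thesis
      using T by simp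
  qed
  \<comment> \<open>The terms in s cancel, and closedness removes the terms containing G
    undifferentiated.\<close>
  have AB: "G' (strip x t) * (\<beta> (strip x t) \<i> - \<i> * \<beta> (strip x t) 1) = A x t - B x t"
    if "x \<in> ?X" "t \<in> ?T" for x t
    using pos[OF that] by (simp add: PQ A_def B_def cl dx algebra_simps)
  have cA': "continuous_on ?T (A x)" and cB': "continuous_on ?T (B x)" if "x \<in> ?X" for x
    using that by (auto intro!: continuous_on_compose2[OF cA, of ?T "\<lambda>t. (x, t)", simplified]
       continuous_on_compose2[OF cB, of ?T "\<lambda>t. (x, t)", simplified] continuous_intros simp: cbox_Pair_eq)
  have IA: "(\<lambda>x. integral ?T (A x)) integrable_on ?X" and IB: "(\<lambda>x. integral ?T (B x)) integrable_on ?X"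
    using integral_continuous_on_param[of ?X 0 T A] integral_continuous_on_param[of ?X 0 T B] cA cB
    by (auto intro!: integrable_continuous_real simp: cbox_Pair_eq)
  have "integral ?X (\<lambda>x. integral ?T (\<lambda>t. G' (strip x t) * (\<beta> (strip x t) \<i> - \<i> * \<beta> (strip x t) 1)))
     = integral ?X (\<lambda>x. integral ?T (A x) - integral ?T (B x))"
  proof (rule integral_cong)
    fix x assume x: "x \<in> ?X"
    have "integral ?T (\<lambda>t. G' (strip x t) * (\<beta> (strip x t) \<i> - \<i> * \<beta> (strip x t) 1)) = integral ?T (\<lambda>t. A x t - B x t)"
      by (rule integral_cong) (rule AB[OF x])
    also have "\<dots> = integral ?T (A x) - integral ?T (B x)"
      by (intro integral_diff integrable_continuous_real cA' cB' x)
    finally show "integral ?T (\<lambda>t. G' (strip x t) * (\<beta> (strip x t) \<i> - \<i> * \<beta> (strip x t) 1)) = integral ?T (A x) - integral ?T (B x)" .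
  qed
  also have "\<dots> = integral ?X (\<lambda>x. integral ?T (A x)) - integral ?X (\<lambda>x. integral ?T (B x))"
    by (rule integral_diff[OF IA IB])
  also have "integral ?X (\<lambda>x. integral ?T (A x)) = integral ?T (\<lambda>t. integral ?X (\<lambda>x. A x t))"
    using integral_swap_continuous[OF cA] by simp
  also have "\<dots> = integral ?T (\<lambda>t. G (strip (1 / 2) t) * \<beta> (strip (1 / 2) t) \<i> - G (strip (- 1 / 2) t) * \<beta> (strip (- 1 / 2) t) \<i>)"
  proof (rule integral_cong)
    fix t assume t: "t \<in> ?T"
    show "integral ?X (\<lambda>x. A x t) = G (strip (1 / 2) t) * \<beta> (strip (1 / 2) t) \<i> - G (strip (- 1 / 2) t) * \<beta> (strip (- 1 / 2) t) \<i>"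
      using integral_unique[OF FA[OF t]] pos[of "1/2" t] pos[of "-1/2" t] t by (simp add: PQ)
  qed
  also have "\<dots> = integral ?T (\<lambda>t. G (strip (1 / 2) t) * \<beta> (strip (1 / 2) t) \<i>)
       - integral ?T (\<lambda>t. G (strip (- 1 / 2) t) * \<beta> (strip (- 1 / 2) t) \<i>)"
  proof (rule integral_diff)
    have "continuous_on ?T (\<lambda>t. G (strip x t) * \<beta> (strip x t) \<i>)" if x: "x \<in> ?X" for x
    proof -
      have "continuous_on ?T (\<lambda>t. G (strip x t) * Q (strip x t))"
        by (intro continuous_intros continuous_on_compose2[OF contG] continuous_on_compose2[OF contQ])
           (use pos[OF x] in auto)
      then show ?thesis
        by (rule continuous_on_eq) (use pos[OF x] in \<open>simp add: PQ\<close>)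
    qed
    then show "(\<lambda>t. G (strip (1 / 2) t) * \<beta> (strip (1 / 2) t) \<i>) integrable_on ?T"
      "(\<lambda>t. G (strip (- 1 / 2) t) * \<beta> (strip (- 1 / 2) t) \<i>) integrable_on ?T"
      by (auto intro!: integrable_continuous_real)
  qed
  also have "integral ?X (\<lambda>x. integral ?T (B x)) = integral ?X
      (\<lambda>x. G (strip x T) * \<beta> (strip x T) (strip_dx x) - G (strip x 0) * \<beta> (strip x 0) (strip_dx x))"
    by (rule integral_cong) (rule integral_unique[OF FB])
  also have "\<dots> = integral ?X (\<lambda>x. G (strip x T) * \<beta> (strip x T) (strip_dx x))
      - integral ?X (\<lambda>x. G (strip x 0) * \<beta> (strip x 0) (strip_dx x))"
  proof (rule integral_diff)
    have "continuous_on ?X (\<lambda>x. G (strip x t) * \<beta> (strip x t) (strip_dx x))" if t: "t \<in> ?T" for t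
    proof -
      have *: "continuous_on ?X (\<lambda>x. F (strip x t))" if "continuous_on upper_half_plane F" for F :: "complex \<Rightarrow> complex"
        by (rule continuous_on_compose2[OF that]) (use pos[OF _ t] in \<open>auto intro!: continuous_intros\<close>)
      have "sqrt (1 - x\<^sup>2) \<noteq> 0" if "x \<in> ?X" for x
        using arc_pos[OF that] by auto
      then have "continuous_on ?X s"
        unfolding s_def by (intro continuous_intros) auto
      then have "continuous_on ?X (\<lambda>x. G (strip x t) * (P (strip x t) + of_real (s x) * Q (strip x t)))"
        by (intro continuous_intros * contG contP contQ)
      then show ?thesis
        by (rule continuous_on_eq) (use pos[OF _ t] in \<open>simp add: PQ strip_dx_def s_def\<close>)
    qed
    then show "(\<lambda>x. G (strip x T) * \<beta> (strip x T) (strip_dx x)) integrable_on ?X"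
      "(\<lambda>x. G (strip x 0) * \<beta> (strip x 0) (strip_dx x)) integrable_on ?X"
      using T by (auto intro!: integrable_continuous_real)
  qed
  finally show ?thesis by simp
qed

section \<open>Integration over the standard domain\<close>

lemma Complex_fst_snd_measurable [measurable]: "(\<lambda>p. Complex (fst p) (snd p)) \<in> borel \<rightarrow>\<^sub>M borel"
  using Complex_measurable by (simp add: case_prod_beta')

lemma integrable_lborel_complex_iff:
  fixes f :: "complex \<Rightarrow> complex"
  assumes [measurable]: "f \<in> borel_measurable borel"
  shows "integrable lborel f \<longleftrightarrow> integrable (lborel \<Otimes>\<^sub>M lborel) (\<lambda>(x, y). f (Complex x y))"
  using integrable_distr_eq[of "\<lambda>(x, y). Complex x y" lborel borel f]
  by (simp add: lborel_complex_pair[unfolded case_prod_beta'] lborel_prod case_prod_beta')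

lemma integral_lborel_complex:
  fixes f :: "complex \<Rightarrow> complex"
  assumes [measurable]: "f \<in> borel_measurable borel" and int: "integrable lborel f"
  shows "(\<integral>z. f z \<partial>lborel) = (\<integral>x. (\<integral>y. f (Complex x y) \<partial>lborel) \<partial>lborel)"
proof -
  have "(\<integral>z. f z \<partial>lborel) = (\<integral>z. f z \<partial>distr lborel borel (\<lambda>(x, y). Complex x y))"
    by (simp add: lborel_complex_pair)
  also have "\<dots> = (\<integral>p. f (Complex (fst p) (snd p)) \<partial>(lborel \<Otimes>\<^sub>M lborel))"
    by (subst integral_distr) (simp_all add: lborel_prod case_prod_beta')
  also have "\<dots> = (\<integral>x. (\<integral>y. f (Complex x y) \<partial>lborel) \<partial>lborel)"
    using int lborel_pair.integral_fst'[of "\<lambda>p. f (Complex (fst p) (snd p))"]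
    by (simp add: integrable_lborel_complex_iff case_prod_beta')
  finally show ?thesis .
qed

lemma fund_strip_iff:
  assumes "\<bar>x\<bar> \<le> 1 / 2"
  shows "Complex x y \<in> fund \<longleftrightarrow> sqrt (1 - x\<^sup>2) \<le> y"
proof -
  have x: "0 < 1 - x\<^sup>2" "1 / 2 < sqrt (1 - x\<^sup>2)"
    using arc_pos[of x] assms unfolding atLeastAtMost_iff by linarith+
  have "Complex x y \<in> fund \<longleftrightarrow> y > 0 \<and> 1 \<le> sqrt (x\<^sup>2 + y\<^sup>2)"
    using assms by (simp add: fund_def complex_norm)
  also have "\<dots> \<longleftrightarrow> y > 0 \<and> 1 - x\<^sup>2 \<le> y\<^sup>2"
    by auto
  also have "\<dots> \<longleftrightarrow> sqrt (1 - x\<^sup>2) \<le> y"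
  proof
    assume "y > 0 \<and> 1 - x\<^sup>2 \<le> y\<^sup>2"
    then show "sqrt (1 - x\<^sup>2) \<le> y" by (intro real_le_lsqrt) (use x in auto)
  next
    assume y: "sqrt (1 - x\<^sup>2) \<le> y"
    then have "(sqrt (1 - x\<^sup>2))\<^sup>2 \<le> y\<^sup>2"
      using x by (intro power_mono) auto
    with x y show "y > 0 \<and> 1 - x\<^sup>2 \<le> y\<^sup>2" by auto
  qed
  finally show ?thesis .
qed

text \<open>Cut at constant height above the arc rather than by a horizontal line, so that the set
  is the image under \<open>strip\<close> of a rectangle.\<close>

definition fund_trunc :: "nat \<Rightarrow> complex set" where
  "fund_trunc n = {z \<in> fund. Im z \<le> sqrt (1 - (Re z)\<^sup>2) + real n}"

lemma fund_trunc_borel [measurable]: "fund_trunc n \<in> sets borel"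
  unfolding fund_trunc_def by measurable

lemma integral_fund_trunc:
  fixes \<Phi> :: "complex \<Rightarrow> complex"
  assumes \<Phi>: "continuous_on upper_half_plane \<Phi>" and int: "set_integrable lborel fund \<Phi>"
  shows "(LINT z:fund_trunc n|lborel. \<Phi> z) =
    integral {- 1 / 2..1 / 2} (\<lambda>x. integral {0..real n} (\<lambda>t. \<Phi> (strip x t)))"
proof -
  let ?X = "{- 1 / 2..1 / 2 :: real}" and ?T = "{0..real n}"
  have sub: "fund_trunc n \<subseteq> fund" by (auto simp: fund_trunc_def)
  define k where "k z = indicat_real (fund_trunc n) z *\<^sub>R \<Phi> z" for z
  have k_meas: "k \<in> borel_measurable borel"
    using set_borel_measurable_continuous[OF \<Phi> fund_trunc_borel, of n] sub fund_int_subset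
    by (simp add: k_def[abs_def] set_borel_measurable_def)
  have k_int: "integrable lborel k"
    using set_integrable_subset[OF int _ sub] by (simp add: k_def[abs_def] set_integrable_def)
  have cT: "continuous_on ({- 1 / 2..1 / 2} \<times> cbox 0 (real n)) (\<lambda>(x, t). \<Phi> (strip x t))"
    unfolding case_prod_beta
    by (rule continuous_on_compose2[OF \<Phi>]) (auto intro!: continuous_intros less_trans[OF _ Im_strip])
  have inner: "(\<integral>y. k (Complex x y) \<partial>lborel) = indicat_real ?X x *\<^sub>R integral ?T (\<lambda>t. \<Phi> (strip x t))" for x
  proof (cases "x \<in> ?X")
    case True
    have "(\<integral>y. k (Complex x y) \<partial>lborel) = (\<integral>t. k (Complex x (sqrt (1 - x\<^sup>2) + t)) \<partial>lborel)"
      using lborel_integral_real_affine[of 1 "\<lambda>y. k (Complex x y)" "sqrt (1 - x\<^sup>2)"] by simp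
    also have "\<dots> = (LINT t:?T|lborel. \<Phi> (strip x t))"
      unfolding set_lebesgue_integral_def
      using True fund_strip_iff[of x]
      by (intro Bochner_Integration.integral_cong) (auto simp: k_def fund_trunc_def strip_def indicator_def)
    also have "\<dots> = integral ?T (\<lambda>t. \<Phi> (strip x t))"
    proof (intro set_borel_integral_eq_integral borel_integrable_atLeastAtMost')
      show "continuous_on ?T (\<lambda>t. \<Phi> (strip x t))"
        using True by (auto intro!: continuous_on_compose2[OF cT, of ?T "\<lambda>t. (x, t)", simplified] continuous_intros)
    qed
    finally show ?thesis using True by simp
  next
    case False
    then have "k (Complex x y) = 0" for y
      by (auto simp: k_def fund_trunc_def fund_def indicator_def abs_le_iff)
    with False show ?thesis by simp
  qed
  have "(LINT z:fund_trunc n|lborel. \<Phi> z) = (\<integral>z. k z \<partial>lborel)"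
    by (simp add: k_def set_lebesgue_integral_def)
  also have "\<dots> = (LINT x:?X|lborel. integral ?T (\<lambda>t. \<Phi> (strip x t)))"
    unfolding integral_lborel_complex[OF k_meas k_int] inner set_lebesgue_integral_def ..
  also have "\<dots> = integral ?X (\<lambda>x. integral ?T (\<lambda>t. \<Phi> (strip x t)))"
    using integral_continuous_on_param[OF cT]
    by (intro set_borel_integral_eq_integral borel_integrable_atLeastAtMost') simp
  finally show ?thesis .
qed

lemma integral_fund_limit:
  fixes \<Phi> :: "complex \<Rightarrow> complex"
  assumes \<Phi>: "continuous_on upper_half_plane \<Phi>" and int: "set_integrable lborel fund \<Phi>"
  shows "(\<lambda>n. integral {- 1 / 2..1 / 2} (\<lambda>x. integral {0..real n} (\<lambda>t. \<Phi> (strip x t))))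
     \<longlonglongrightarrow> (LINT z:fund|lborel. \<Phi> z)"
proof -
  have un: "(\<Union>n. fund_trunc n) = fund"
  proof
    show "fund \<subseteq> (\<Union>n. fund_trunc n)"
    proof
      fix z assume z: "z \<in> fund"
      obtain n where "Im z - sqrt (1 - (Re z)\<^sup>2) \<le> real n"
        using real_arch_simple by blast
      with z show "z \<in> (\<Union>n. fund_trunc n)"
        by (auto simp: fund_trunc_def intro!: exI[of _ n])
    qed
  qed (auto simp: fund_trunc_def)
  have "incseq fund_trunc"
    by (auto simp: incseq_def fund_trunc_def)
  with int un have "(\<lambda>n. LINT z:fund_trunc n|lborel. \<Phi> z) \<longlonglongrightarrow> (LINT z:(\<Union>n. fund_trunc n)|lborel. \<Phi> z)"
    by (intro set_integral_cont_up) auto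
  then show ?thesis
    unfolding un integral_fund_trunc[OF assms] .
qed

lemma integral_fund_int:
  fixes \<Phi> :: "complex \<Rightarrow> complex"
  assumes \<Phi>: "continuous_on upper_half_plane \<Phi>" and int: "set_integrable lborel fund \<Phi>"
  shows "set_integrable lborel fund_int \<Phi>" "(LINT z:fund_int|lborel. \<Phi> z) = (LINT z:fund|lborel. \<Phi> z)"
proof -
  show int': "set_integrable lborel fund_int \<Phi>"
    using fund_int_subset by (intro set_integrable_subset[OF int]) auto
  have "AE z in lebesgue. z \<notin> fund - fund_int"
    using negligible_fund_boundary by (intro AE_not_in) (simp add: negligible_iff_null_sets)
  then have "AE z in lborel. z \<notin> fund - fund_int"
    by (simp add: AE_completion_iff)
  then have "AE z in lborel. indicat_real fund_int z *\<^sub>R \<Phi> z = indicat_real fund z *\<^sub>R \<Phi> z"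
    by eventually_elim (use fund_int_subset in \<open>auto simp: indicator_def\<close>)
  then show "(LINT z:fund_int|lborel. \<Phi> z) = (LINT z:fund|lborel. \<Phi> z)"
    unfolding set_lebesgue_integral_def using int int'
    by (intro integral_cong_AE) (auto simp: set_integrable_def)
qed

lemma set_integrable_fund:
  fixes \<Phi> :: "complex \<Rightarrow> complex"
  assumes \<Phi>: "continuous_on upper_half_plane \<Phi>"
    and c: "c > 0" and bound: "\<And>z. Im z > 1 / 2 \<Longrightarrow> cmod (\<Phi> z) \<le> C * exp (- c * Im z)"
  shows "set_integrable lborel fund \<Phi>"
proof -
  \<comment> \<open>The domain is enlarged to a half-strip, on which the dominating function is a
    product of a function of x and one of y.\<close>
  define e where "e z = (if \<bar>Re z\<bar> \<le> 1 / 2 \<and> 0 \<le> Im z then exp (- c * Im z) else 0)" for z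
  have e_meas [measurable]: "e \<in> borel_measurable borel"
    unfolding e_def by measurable
  have "integrable (lborel \<Otimes>\<^sub>M lborel) (\<lambda>(x, y). complex_of_real (e (Complex x y)))"
  proof (rule lborel_pair.Fubini_integrable)
    show "(\<lambda>(x, y). complex_of_real (e (Complex x y))) \<in> borel_measurable (lborel \<Otimes>\<^sub>M lborel)"
      using measurable_compose[OF Complex_measurable e_meas] by (simp add: lborel_prod case_prod_beta')
    have "(\<lambda>y :: real. exp (- c * y)) absolutely_integrable_on {0..}"
      using c by (intro nonnegative_absolutely_integrable_1 integrable_on_exp_minus_to_infinity) auto
    then have ex: "set_integrable lborel {0..} (\<lambda>y. exp (- c * y))"
      unfolding set_integrable_def by (subst (asm) integrable_completion) auto
    have ee: "complex_of_real (e (Complex x y)) =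
        of_real (indicat_real {- 1 / 2..1 / 2} x) * of_real (indicat_real {0..} y *\<^sub>R exp (- c * y))" for x y
      by (auto simp: e_def indicator_def abs_le_iff)
    have "(\<integral>y. cmod (complex_of_real (e (Complex x y))) \<partial>lborel)
        = indicat_real {- 1 / 2..1 / 2} x * (LINT y:{0..}|lborel. exp (- c * y))" for x
      unfolding ee set_lebesgue_integral_def by (simp add: norm_mult abs_mult)
    then show "integrable lborel (\<lambda>x. \<integral>y. norm ((\<lambda>(x, y). complex_of_real (e (Complex x y))) (x, y)) \<partial>lborel)"
      by simp
    have "integrable lborel (\<lambda>y. complex_of_real (e (Complex x y)))" for x
      unfolding ee using ex by (intro integrable_mult_right integrable_of_real) (simp add: set_integrable_def)
    then show "AE x in lborel. integrable lborel (\<lambda>y. (\<lambda>(x, y). complex_of_real (e (Complex x y))) (x, y))"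
      by simp
  qed
  then have "integrable lborel (\<lambda>z. complex_of_real (e z))"
    by (subst integrable_lborel_complex_iff) auto
  then have "integrable lborel (\<lambda>z. of_real C * complex_of_real (e z))"
    by (rule integrable_mult_right)
  then show ?thesis
    unfolding set_integrable_def
  proof (rule Bochner_Integration.integrable_bound)
    show "(\<lambda>z. indicat_real fund z *\<^sub>R \<Phi> z) \<in> borel_measurable lborel"
      using set_borel_measurable_continuous[OF \<Phi> fund_borel] fund_int_subset
      by (simp add: set_borel_measurable_def)
    show "AE z in lborel. cmod (indicat_real fund z *\<^sub>R \<Phi> z) \<le> cmod (of_real C * complex_of_real (e z))"
    proof (rule AE_I2)
      fix z :: complex
      show "cmod (indicat_real fund z *\<^sub>R \<Phi> z) \<le> cmod (of_real C * complex_of_real (e z))"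
      proof (cases "z \<in> fund")
        case True
        then have z: "\<bar>Re z\<bar> \<le> 1 / 2" "Im z > 0" by (auto simp: fund_def)
        have "sqrt (1 - (Re z)\<^sup>2) \<le> Im z"
          using True fund_strip_iff[OF z(1), of "Im z"] by simp
        then have "Im z > 1 / 2"
          using arc_pos[of "Re z"] z unfolding atLeastAtMost_iff by linarith
        then have "cmod (\<Phi> z) \<le> C * exp (- c * Im z)" by (rule bound)
        also have "\<dots> \<le> \<bar>C\<bar> * exp (- c * Im z)" by (intro mult_right_mono) auto
        finally show ?thesis using True z by (simp add: e_def norm_mult)
      qed simp
    qed
  qed
qed

subsection \<open>Behaviour at the cusps\<close>

text \<open>The coefficient of the pullback of f(z) dz under A.\<close>

definition slash2 :: "(complex \<Rightarrow> complex) \<Rightarrow> int ^ 2 ^ 2 \<Rightarrow> complex \<Rightarrow> complex" where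
  "slash2 f A z = f (act A z) / (aut_factor A z)\<^sup>2"

lemma cmod_q_param: "cmod (q_param N z) = exp (- (2 * pi / N) * Im z)"
  by (simp add: q_param_def Re_divide_of_nat)

lemma q_param_in_ball:
  assumes "N \<ge> 1" "Im z > 0"
  shows "q_param N z \<in> ball 0 1"
  using assms by (simp add: cmod_q_param)

lemma q_param_deriv: "(q_param N has_field_derivative (2 * of_real pi * \<i> / of_nat N) * q_param N z) (at z)"
proof -
  have "q_param N = (\<lambda>z. exp ((2 * of_real pi * \<i> / of_nat N) * z))"
    by (simp add: q_param_def[abs_def])
  moreover have "((\<lambda>z. exp (c * z)) has_field_derivative c * exp (c * z)) (at z)" for c :: complex
    by (auto intro!: derivative_eq_intros)
  ultimately show ?thesis
    by (simp only:)
qed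

lemma q_param_surj:
  assumes "N \<ge> 1" "w \<in> ball 0 1" "w \<noteq> 0"
  obtains z where "Im z > 0" "q_param N z = w"
proof
  define z where "z = of_nat N * Ln w / (2 * of_real pi * \<i>)"
  have z: "2 * of_real pi * \<i> * z / of_nat N = Ln w"
    using assms by (simp add: z_def)
  show qz: "q_param N z = w"
    unfolding q_param_def z using assms by simp
  have "exp (- (2 * pi / N) * Im z) = cmod w"
    unfolding qz[symmetric] by (rule cmod_q_param[symmetric])
  also have "\<dots> < 1"
    using assms(2) by simp
  finally have "exp (- (2 * pi / N) * Im z) < 1" .
  then have "0 < (2 * pi / N) * Im z"
    by simp
  then show "Im z > 0"
    by (rule zero_less_mult_pos) (use assms(1) in simp)
qed

text \<open>Convergence is given only at the points q(z), but these fill the punctured unit disc. So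
  the power series converges on the whole disc and extends F across the cusp.\<close>

lemma q_series_holomorphic:
  assumes N: "N \<ge> 1" and F: "\<And>z. Im z > 0 \<Longrightarrow> (\<lambda>n. a n * q_param N z ^ n) sums F z"
  obtains h where "h holomorphic_on ball 0 1" "h 0 = a 0" "\<And>z. Im z > 0 \<Longrightarrow> F z = h (q_param N z)"
proof
  define h where "h w = (\<Sum>n. a n * w ^ n)" for w
  have sums: "(\<lambda>n. a n * w ^ n) sums h w" if w: "w \<in> ball 0 1" for w
  proof (cases "w = 0")
    case True
    then show ?thesis by (auto simp: h_def intro!: summable_sums summable_comparison_test'[of "\<lambda>_. 0" 1])
  next
    case False
    obtain z where z: "Im z > 0" "q_param N z = w"
      using q_param_surj[OF N w False] .
    then show ?thesis using F[OF z(1)] by (auto simp: h_def sums_iff)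
  qed
  then show "h holomorphic_on ball 0 1"
    by (intro power_series_holomorphic[of _ _ a]) simp
  show "h 0 = a 0"
    by (simp add: h_def)
  show "F z = h (q_param N z)" if "Im z > 0" for z
    using sums[OF q_param_in_ball[OF N that]] F[OF that] by (rule sums_unique2[symmetric])
qed

text \<open>The region Im z \<ge> 1/2 is mapped by q into a compact disc of radius exp (- \<pi>/N) <
  1.\<close>

lemma bounded_on_cusp:
  assumes N: "N \<ge> 1" and k: "continuous_on (ball 0 1) (k :: complex \<Rightarrow> complex)"
  obtains C where "C \<ge> 0" "\<And>z. Im z \<ge> 1 / 2 \<Longrightarrow> cmod (k (q_param N z)) \<le> C"
proof -
  define r where "r = exp (- (pi / N))"
  have r: "r < 1" using N by (simp add: r_def)
  have "compact (k ` cball 0 r)"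
    using r by (intro compact_continuous_image continuous_on_subset[OF k]) auto
  then obtain C where C: "\<And>w. w \<in> cball 0 r \<Longrightarrow> cmod (k w) \<le> C"
    by (metis bounded_iff compact_imp_bounded imageI)
  have "cmod (k 0) \<le> C"
    by (rule C) (simp add: r_def)
  then have "C \<ge> 0"
    using norm_ge_zero[of "k 0"] by linarith
  moreover have "cmod (k (q_param N z)) \<le> C" if "Im z \<ge> 1 / 2" for z
  proof (rule C)
    have "(2 * pi / N) * (1 / 2) \<le> (2 * pi / N) * Im z"
      using that by (intro mult_left_mono) auto
    then show "q_param N z \<in> cball 0 r"
      by (simp add: cmod_q_param r_def)
  qed
  ultimately show ?thesis by (rule that)
qed

lemma holomorphic_factor_zero:
  assumes "h holomorphic_on ball 0 1" "h 0 = 0"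
  obtains k where "k holomorphic_on ball 0 1" "\<And>w. h w = w * k w"
proof
  show "(\<lambda>z. if z = 0 then deriv h 0 else (h z - h 0) / (z - 0)) holomorphic_on ball 0 1"
    by (rule pole_lemma) (use assms in auto)
qed (use assms in auto)

text \<open>Write the expansion as h(q) = q k(q). As dz = N / (2 \<pi> i) dq / q, the form becomes N
  / (2 \<pi> i) k(q) dq, which has a primitive on the whole disc. Normalised to vanish at q = 0 it
  is divisible by q, whence the decay.\<close>

lemma cusp_form_primitive:
  assumes N: "N \<ge> 1" and f: "f \<in> cusp_forms2 N" and A: "A \<in> SL2Z"
  obtains G C where "C \<ge> 0"
    "\<And>z. Im z > 0 \<Longrightarrow> (G has_field_derivative slash2 f A z) (at z)"
    "\<And>z. Im z \<ge> 1 / 2 \<Longrightarrow> cmod (G z) \<le> C * exp (- (2 * pi / N) * Im z)"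
    "\<And>z. Im z \<ge> 1 / 2 \<Longrightarrow> cmod (slash2 f A z) \<le> C * exp (- (2 * pi / N) * Im z)"
proof -
  obtain a where a: "a 0 = 0" "\<And>z. Im z > 0 \<Longrightarrow> (\<lambda>n. a n * q_param N z ^ n) sums slash2 f A z"
    using f A by (auto simp: cusp_forms2_def slash2_def)
  obtain h where h: "h holomorphic_on ball 0 1" "h 0 = a 0" "\<And>z. Im z > 0 \<Longrightarrow> slash2 f A z = h (q_param N z)"
    using q_series_holomorphic[OF N a(2)] by blast
  obtain k where k: "k holomorphic_on ball 0 1" "\<And>w. h w = w * k w"
    using holomorphic_factor_zero[OF h(1)] h(2) a(1) by auto
  obtain K where K: "\<And>w. w \<in> ball 0 1 \<Longrightarrow> (K has_field_derivative k w) (at w)"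
    using holomorphic_convex_primitive'[OF convex_ball open_ball k(1)] at_within_open[OF _ open_ball] by metis
  define K0 where "K0 w = K w - K 0" for w
  have dK0: "(K0 has_field_derivative k w) (at w)" if "w \<in> ball 0 1" for w
    unfolding K0_def[abs_def] using K[OF that] by (auto intro!: derivative_eq_intros)
  then have "K0 holomorphic_on ball 0 1"
    unfolding holomorphic_on_open[OF open_ball] by blast
  then obtain l where l: "l holomorphic_on ball 0 1" "\<And>w. K0 w = w * l w"
    using holomorphic_factor_zero[of K0] by (auto simp: K0_def)
  define G where "G z = of_nat N / (2 * of_real pi * \<i>) * K0 (q_param N z)" for z
  have G: "(G has_field_derivative slash2 f A z) (at z)" if z: "Im z > 0" for z
  proof -
    note qb = q_param_in_ball[OF N z]
    have "((\<lambda>z. K0 (q_param N z)) has_field_derivative k (q_param N z) * ((2 * of_real pi * \<i> / of_nat N) * q_param N z)) (at z)"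
      by (rule DERIV_chain2[OF dK0[OF qb] q_param_deriv])
    from DERIV_cmult[OF this, of "of_nat N / (2 * of_real pi * \<i>)"] show ?thesis
      unfolding G_def[abs_def] h(3)[OF z] k(2) using N by (simp add: mult_ac)
  qed
  obtain C1 where C1: "C1 \<ge> 0" "\<And>z. Im z \<ge> 1 / 2 \<Longrightarrow> cmod (k (q_param N z)) \<le> C1"
    by (rule bounded_on_cusp[OF N holomorphic_on_imp_continuous_on[OF k(1)]]) (rule that)
  obtain C2 where C2: "C2 \<ge> 0" "\<And>z. Im z \<ge> 1 / 2 \<Longrightarrow> cmod (l (q_param N z)) \<le> C2"
    by (rule bounded_on_cusp[OF N holomorphic_on_imp_continuous_on[OF l(1)]]) (rule that)
  define C where "C = C1 + real N * C2"
  have b1: "cmod (slash2 f A z) \<le> C * exp (- (2 * pi / N) * Im z)" if z: "Im z \<ge> 1 / 2" for z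
  proof -
    have "cmod (slash2 f A z) = cmod (k (q_param N z)) * exp (- (2 * pi / N) * Im z)"
      using z by (simp add: h(3) k(2) norm_mult cmod_q_param mult.commute)
    also have "\<dots> \<le> C * exp (- (2 * pi / N) * Im z)"
      using C1(2)[OF z] C2(1) by (intro mult_right_mono) (auto simp: C_def intro: add_increasing2)
    finally show ?thesis .
  qed
  have b2: "cmod (G z) \<le> C * exp (- (2 * pi / N) * Im z)" if z: "Im z \<ge> 1 / 2" for z
  proof -
    have "cmod (G z) = (real N / (2 * pi)) * cmod (l (q_param N z)) * exp (- (2 * pi / N) * Im z)"
      by (simp add: G_def l(2) norm_mult norm_divide cmod_q_param)
    also have "\<dots> \<le> C * exp (- (2 * pi / N) * Im z)"
    proof (rule mult_right_mono)
      have "real N / (2 * pi) \<le> real N / 1"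
        using pi_ge_two by (intro divide_left_mono) auto
      then have "(real N / (2 * pi)) * cmod (l (q_param N z)) \<le> real N * C2"
        using C2(2)[OF z] by (intro mult_mono) auto
      then show "(real N / (2 * pi)) * cmod (l (q_param N z)) \<le> C"
        using C1(1) by (simp add: C_def)
    qed simp
    finally show ?thesis .
  qed
  show ?thesis
    using C1(1) C2(1) by (intro that[of C G] G b1 b2) (simp add: C_def)
qed

lemma cusp_form_decay:
  assumes "N \<ge> 1" "f \<in> cusp_forms2 N" "A \<in> SL2Z"
  obtains C where "C \<ge> 0" "\<And>z. Im z \<ge> 1 / 2 \<Longrightarrow> cmod (slash2 f A z) \<le> C * exp (- (2 * pi / N) * Im z)"
  by (rule cusp_form_primitive[OF assms]) (rule that)

text \<open>On the punctured disc h does not vanish because u has an inverse; at 0 it takes the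
  value of the leading coefficient.\<close>

lemma modular_unit_q_expansion:
  assumes N: "N \<ge> 1" and u: "u \<in> modular_units N" and A: "A \<in> SL2Z"
  obtains m :: int and h where "h holomorphic_on ball 0 1" "\<And>w. w \<in> ball 0 1 \<Longrightarrow> h w \<noteq> 0"
    "\<And>z. Im z > 0 \<Longrightarrow> u (act A z) = q_param N z powi m * h (q_param N z)"
proof -
  obtain u' where u': "\<forall>z\<in>upper_half_plane. u z * u' z = 1"
    using u unfolding modular_units_def by blast
  have nz: "u z \<noteq> 0" if "Im z > 0" for z
    using u'[rule_format, of z] that by auto
  have q0: "q_param N z \<noteq> 0" for z
    by (simp add: q_param_def)
  have "u \<in> regular_functions_Y1 N"
    using u by (simp add: modular_units_def)
  then obtain m a where ma: "\<forall>z\<in>upper_half_plane. (\<lambda>n. a n * q_param N z powi (m + int n)) sums u (act A z)"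
    using A unfolding regular_functions_Y1_def by blast
  have a: "(\<lambda>n. a n * q_param N z powi (m + int n)) sums u (act A z)" if "Im z > 0" for z
    using ma that by simp
  have "\<exists>n. a n \<noteq> 0"
  proof (rule ccontr)
    assume "\<nexists>n. a n \<noteq> 0"
    then have "(\<lambda>n. 0) sums u (act A \<i>)"
      using a[of \<i>] by simp
    then have "u (act A \<i>) = 0"
      by (rule sums_unique2[OF _ sums_zero])
    then show False
      using nz[OF Im_act_pos[OF A, of \<i>]] by simp
  qed
  \<comment> \<open>The given exponent m need not be the order at the cusp, as leading coefficients
    may vanish; the order is m + d.\<close>
  define d where "d = (LEAST n. a n \<noteq> 0)"
  have d: "a d \<noteq> 0"
    unfolding d_def by (rule LeastI_ex) fact
  have less_d: "a n = 0" if "n < d" for n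
    using not_less_Least[OF that[unfolded d_def]] by simp
  define M where "M = m + int d"
  have ser: "(\<lambda>n. a (n + d) * q_param N z ^ n) sums (q_param N z powi (- M) * u (act A z))" if z: "Im z > 0" for z
  proof -
    have "(\<lambda>n. a (n + d) * q_param N z powi (m + int (n + d))) sums u (act A z)"
      using a[OF z] less_d by (subst sums_zero_iff_shift) simp_all
    then have "(\<lambda>n. q_param N z powi (- M) * (a (n + d) * q_param N z powi (m + int (n + d)))) sums (q_param N z powi (- M) * u (act A z))"
      by (rule sums_mult)
    also have "(\<lambda>n. q_param N z powi (- M) * (a (n + d) * q_param N z powi (m + int (n + d)))) = (\<lambda>n. a (n + d) * q_param N z ^ n)"
    proof
      fix n
      have "q_param N z powi (- M) * q_param N z powi (m + int (n + d)) = q_param N z powi (int n)"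
        unfolding M_def by (subst power_int_add[symmetric]) (auto simp: q0)
      then show "q_param N z powi (- M) * (a (n + d) * q_param N z powi (m + int (n + d))) = a (n + d) * q_param N z ^ n"
        by (simp add: mult_ac)
    qed
    finally show ?thesis .
  qed
  obtain h where h: "h holomorphic_on ball 0 1" "h 0 = a (0 + d)"
    "\<And>z. Im z > 0 \<Longrightarrow> q_param N z powi (- M) * u (act A z) = h (q_param N z)"
    using q_series_holomorphic[OF N ser] by blast
  show ?thesis
  proof
    show "u (act A z) = q_param N z powi M * h (q_param N z)" if "Im z > 0" for z
      using h(3)[OF that, symmetric] q0[of z] by (simp add: power_int_minus)
    show "h w \<noteq> 0" if w: "w \<in> ball 0 1" for w
    proof (cases "w = 0")
      case False
      obtain z where z: "Im z > 0" "q_param N z = w"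
        using q_param_surj[OF N w False] .
      show ?thesis
        using h(3)[OF z(1)] nz[OF Im_act_pos[OF A z(1)]] q0[of z] z(2) by auto
    qed (use h d in auto)
  qed (use h in auto)
qed

text \<open>From u = q^m h(q), log |u| is m log |q|, linear in Im z, plus a bounded term, and u'/u
  is (2 \<pi> i / N) (m + q h'/h), a function continuous on the q-disc.\<close>

lemma modular_unit_growth:
  assumes N: "N \<ge> 1" and u: "u \<in> modular_units N" and A: "A \<in> SL2Z"
  obtains C where "C \<ge> 0" "\<And>z. Im z \<ge> 1 / 2 \<Longrightarrow> \<bar>ln (cmod (u (act A z)))\<bar> \<le> C * Im z"
    "\<And>z. Im z \<ge> 1 / 2 \<Longrightarrow> cmod (deriv (\<lambda>z. u (act A z)) z / u (act A z)) \<le> C"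
proof -
  obtain m :: int and h where h: "h holomorphic_on ball 0 1" "\<And>w. w \<in> ball 0 1 \<Longrightarrow> h w \<noteq> 0"
    and uh: "\<And>z. Im z > 0 \<Longrightarrow> u (act A z) = q_param N z powi m * h (q_param N z)"
    by (rule modular_unit_q_expansion[OF assms]) (rule that)
  define c where "c = 2 * of_real pi * \<i> / (of_nat N :: complex)"
  have q0: "q_param N z \<noteq> 0" for z
    by (simp add: q_param_def)
  have dh: "(h has_field_derivative deriv h w) (at w)" if "w \<in> ball 0 1" for w
    using holomorphic_derivI[OF h(1) _ that] by simp
  have ld: "deriv (\<lambda>z. u (act A z)) z / u (act A z) = c * (of_int m + q_param N z * deriv h (q_param N z) / h (q_param N z))"
    if z: "Im z > 0" for z
  proof -
    let ?q = "q_param N z"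
    note qb = q_param_in_ball[OF N z]
    have alg: "p * (d * (c * q)) + (k * (p / q) * (c * q)) * H = p * H * (c * (k + q * d / H))"
      if "q \<noteq> 0" "H \<noteq> 0" for p d c q k H :: complex
      using that by (simp add: field_simps)
    have 1: "((\<lambda>z. h (q_param N z)) has_field_derivative deriv h ?q * (c * ?q)) (at z)"
      unfolding c_def by (rule DERIV_chain2[OF dh[OF qb] q_param_deriv])
    have 2: "((\<lambda>z. q_param N z powi m) has_field_derivative of_int m * ?q powi (m - 1) * (c * ?q)) (at z)"
      unfolding c_def by (rule DERIV_power_int[OF q_param_deriv disjI2[OF q0]])
    have "?q powi (m - 1) = ?q powi m / ?q"
      using q0[of z] by (simp add: power_int_diff)
    with DERIV_mult'[OF 2 1]
    have "((\<lambda>z. q_param N z powi m * h (q_param N z)) has_field_derivative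
        ?q powi m * h ?q * (c * (of_int m + ?q * deriv h ?q / h ?q))) (at z)"
      by (simp only: alg[OF q0 h(2)[OF qb]])
    then have "((\<lambda>z. u (act A z)) has_field_derivative
        ?q powi m * h ?q * (c * (of_int m + ?q * deriv h ?q / h ?q))) (at z)"
      by (rule has_field_derivative_transform_within_open[OF _ open_upper_half_plane]) (use z uh in auto)
    then show ?thesis
      using q0[of z] h(2)[OF qb] by (simp add: DERIV_imp_deriv uh[OF z])
  qed
  have "continuous_on (ball 0 1) (\<lambda>w. c * (of_int m + w * deriv h w / h w))"
    using h by (intro continuous_intros holomorphic_on_imp_continuous_on[OF h(1)]
       holomorphic_on_imp_continuous_on[OF holomorphic_deriv[OF h(1)]]) auto
  then obtain C1 where C1: "C1 \<ge> 0"
    "\<And>z. Im z \<ge> 1 / 2 \<Longrightarrow> cmod (c * (of_int m + q_param N z * deriv h (q_param N z) / h (q_param N z))) \<le> C1"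
    by (rule bounded_on_cusp[OF N]) (rule that)
  have "continuous_on (ball 0 1) (\<lambda>w. complex_of_real (ln (cmod (h w))))"
    using h by (intro continuous_intros holomorphic_on_imp_continuous_on[OF h(1)]) auto
  then obtain C2 where C2: "C2 \<ge> 0"
    "\<And>z. Im z \<ge> 1 / 2 \<Longrightarrow> cmod (complex_of_real (ln (cmod (h (q_param N z))))) \<le> C2"
    by (rule bounded_on_cusp[OF N]) (rule that)
  \<comment> \<open>\<open>C1\<close> bounds the logarithmic derivative, \<open>2 * C2\<close>
    absorbs the bounded term by 1 \<le> 2 Im z, and the last summand is the slope of m log
    |q|.\<close>
  define C where "C = C1 + (2 * C2 + 2 * pi * \<bar>m\<bar> / N)"
  have "\<bar>ln (cmod (u (act A z)))\<bar> \<le> C * Im z" if z: "Im z \<ge> 1 / 2" for z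
  proof -
    have pos: "Im z > 0" using z by simp
    have "ln (cmod (u (act A z))) = of_int m * ln (cmod (q_param N z)) + ln (cmod (h (q_param N z)))"
      using h(2)[OF q_param_in_ball[OF N pos]]
      by (simp add: uh[OF pos] norm_mult norm_power_int cmod_q_param exp_power_int ln_mult)
    also have "\<bar>\<dots>\<bar> \<le> \<bar>of_int m * ln (cmod (q_param N z))\<bar> + \<bar>ln (cmod (h (q_param N z)))\<bar>"
      by (rule abs_triangle_ineq)
    also have "\<bar>of_int m * ln (cmod (q_param N z))\<bar> = 2 * pi * \<bar>m\<bar> / N * Im z"
      using pos by (simp add: cmod_q_param abs_mult)
    also have "\<bar>ln (cmod (h (q_param N z)))\<bar> \<le> C2"
      using C2(2)[OF z] by simp
    also have "C2 \<le> 2 * C2 * Im z"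
      using mult_left_mono[OF z C2(1)] by simp
    also have "2 * pi * \<bar>m\<bar> / N * Im z + 2 * C2 * Im z \<le> C * Im z"
      using C1(1) pos by (simp add: C_def algebra_simps)
    finally show ?thesis by simp
  qed
  moreover have "cmod (deriv (\<lambda>z. u (act A z)) z / u (act A z)) \<le> C" if z: "Im z \<ge> 1 / 2" for z
  proof -
    have "0 \<le> 2 * C2 + 2 * pi * \<bar>m\<bar> / N"
      using C2(1) by simp
    then show ?thesis
      using C1(2)[OF z] z by (simp add: ld C_def)
  qed
  moreover have "C \<ge> 0"
    using C1 C2 by (simp add: C_def)
  ultimately show ?thesis by (intro that[of C])
qed

lemma eta_growth:
  assumes N: "N \<ge> 1" and u: "u \<in> modular_units N" and v: "v \<in> modular_units N" and A: "A \<in> SL2Z"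
  obtains C where "C \<ge> 0" "\<And>z w. Im z \<ge> 1 / 2 \<Longrightarrow>
     cmod (eta (\<lambda>z. u (act A z)) (\<lambda>z. v (act A z)) z w) \<le> C * Im z * cmod w"
proof -
  obtain C1 where C1: "C1 \<ge> 0" "\<And>z. Im z \<ge> 1 / 2 \<Longrightarrow> \<bar>ln (cmod (u (act A z)))\<bar> \<le> C1 * Im z"
    "\<And>z. Im z \<ge> 1 / 2 \<Longrightarrow> cmod (deriv (\<lambda>z. u (act A z)) z / u (act A z)) \<le> C1"
    by (rule modular_unit_growth[OF N u A]) (rule that)
  obtain C2 where C2: "C2 \<ge> 0" "\<And>z. Im z \<ge> 1 / 2 \<Longrightarrow> \<bar>ln (cmod (v (act A z)))\<bar> \<le> C2 * Im z"
    "\<And>z. Im z \<ge> 1 / 2 \<Longrightarrow> cmod (deriv (\<lambda>z. v (act A z)) z / v (act A z)) \<le> C2"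
    by (rule modular_unit_growth[OF N v A]) (rule that)
  have darg: "\<bar>darg x z w\<bar> \<le> cmod (deriv x z / x z) * cmod w" for x z w
    using abs_Im_le_cmod[of "deriv x z * w / x z"] by (simp add: darg_def norm_mult norm_divide)
  show ?thesis
  proof (rule that[of "2 * C1 * C2"])
    fix z w :: complex assume z: "Im z \<ge> 1 / 2"
    let ?u = "\<lambda>z. u (act A z)" and ?v = "\<lambda>z. v (act A z)"
    have "cmod (eta ?u ?v z w) \<le> \<bar>ln (cmod (?u z)) * darg ?v z w\<bar> + \<bar>ln (cmod (?v z)) * darg ?u z w\<bar>"
      unfolding eta_def norm_of_real by (rule abs_triangle_ineq4)
    also have "\<bar>ln (cmod (?u z)) * darg ?v z w\<bar> \<le> (C1 * Im z) * (C2 * cmod w)"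
      unfolding abs_mult using z C1 C2 by (intro mult_mono order.trans[OF darg] mult_right_mono) auto
    also have "\<bar>ln (cmod (?v z)) * darg ?u z w\<bar> \<le> (C2 * Im z) * (C1 * cmod w)"
      unfolding abs_mult using z C1 C2 by (intro mult_mono order.trans[OF darg] mult_right_mono) auto
    finally show "cmod (eta ?u ?v z w) \<le> 2 * C1 * C2 * Im z * cmod w"
      by (simp add: algebra_simps)
  qed (use C1 C2 in auto)
qed

subsection \<open>Closed forms of moderate growth\<close>

definition pull :: "form1 \<Rightarrow> int ^ 2 ^ 2 \<Rightarrow> form1" where
  "pull \<alpha> A z w = \<alpha> (act A z) (w / (aut_factor A z)\<^sup>2)"

text \<open>What the boundary computation uses about \<eta>(u,v): invariance, closedness, linear
  growth at every cusp and a global potential. It is kept abstract because the same computation is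
  applied to the form \<open>cnj (f z * w)\<close> at levels 1 and 2.\<close>

definition tame :: "nat \<Rightarrow> form1 \<Rightarrow> bool" where
  "tame N \<alpha> \<longleftrightarrow>
     (\<forall>A\<in>Gamma1 N. \<forall>z w. Im z > 0 \<longrightarrow> pull \<alpha> A z w = \<alpha> z w) \<and>
     (\<forall>A\<in>SL2Z. C1_closed (pull \<alpha> A)) \<and>
     (\<forall>A\<in>SL2Z. \<exists>C\<ge>0. \<forall>z w. Im z \<ge> 1 / 2 \<longrightarrow> cmod (pull \<alpha> A z w) \<le> C * Im z * cmod w) \<and>
     (\<exists>H. \<forall>z. Im z > 0 \<longrightarrow> (H has_derivative \<alpha> z) (at z))"

lemma has_derivative_Re_hol:
  assumes "(L has_field_derivative L') (at z)"
  shows "((\<lambda>z. Re (L z)) has_derivative (\<lambda>w. Re (L' * w))) (at z)"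
    and "((\<lambda>z. Im (L z)) has_derivative (\<lambda>w. Im (L' * w))) (at z)"
  using assms unfolding has_field_derivative_def
  by (rule has_derivative_Re, rule has_derivative_Im)

text \<open>For u = exp L and v = exp M this is log |u| d arg v - log |v| d arg u, written with
  holomorphic functions only.\<close>

definition log_form :: "(complex \<Rightarrow> complex) \<Rightarrow> (complex \<Rightarrow> complex) \<Rightarrow> form1" where
  "log_form L M z w = of_real (Re (L z) * Im (deriv M z * w) - Re (M z) * Im (deriv L z * w))"

text \<open>In both mixed derivatives the products of first derivatives of L and M are symmetric in
  the two functions and drop out of the difference; what remains is Re L Re M'' - Re M Re L'' on
  either side.\<close>

lemma log_form_C1_closed:
  assumes L: "L holomorphic_on upper_half_plane" and M: "M holomorphic_on upper_half_plane"
    and \<beta>: "\<And>z w. Im z > 0 \<Longrightarrow> \<beta> z w = log_form L M z w"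
  shows "C1_closed \<beta>"
proof -
  define P where "P z = complex_of_real (Re (L z) * Im (deriv M z) - Re (M z) * Im (deriv L z))" for z
  define Q where "Q z = complex_of_real (Re (L z) * Re (deriv M z) - Re (M z) * Re (deriv L z))" for z
  define P' where "P' z w = complex_of_real
     ((Re (L z) * Im (deriv (deriv M) z * w) + Re (deriv L z * w) * Im (deriv M z))
      - (Re (M z) * Im (deriv (deriv L) z * w) + Re (deriv M z * w) * Im (deriv L z)))" for z w
  define Q' where "Q' z w = complex_of_real
     ((Re (L z) * Re (deriv (deriv M) z * w) + Re (deriv L z * w) * Re (deriv M z))
      - (Re (M z) * Re (deriv (deriv L) z * w) + Re (deriv M z * w) * Re (deriv L z)))" for z w
  note op = open_upper_half_plane
  have L': "deriv L holomorphic_on upper_half_plane" and M': "deriv M holomorphic_on upper_half_plane"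
    using L M op by (auto intro: holomorphic_deriv)
  have L'': "deriv (deriv L) holomorphic_on upper_half_plane" and M'': "deriv (deriv M) holomorphic_on upper_half_plane"
    using L' M' op by (auto intro: holomorphic_deriv)
  note c = holomorphic_on_imp_continuous_on
  have d: "(F has_field_derivative deriv F z) (at z)" if "F holomorphic_on upper_half_plane" "Im z > 0" for F z
    using holomorphic_derivI[OF that(1) op] that(2) by simp
  have "continuous_on upper_half_plane (\<lambda>z. P' z w)" "continuous_on upper_half_plane (\<lambda>z. Q' z w)" for w
    unfolding P'_def Q'_def by (intro continuous_intros c L M L' M' L'' M'')+
  moreover have "(P has_derivative P' z) (at z)" if z: "Im z > 0" for z
    unfolding P_def[abs_def] P'_def[abs_def]
    by (intro has_derivative_of_real has_derivative_diff has_derivative_mult has_derivative_Re_hol d L M L' M' z)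
  moreover have "(Q has_derivative Q' z) (at z)" if z: "Im z > 0" for z
    unfolding Q_def[abs_def] Q'_def[abs_def]
    by (intro has_derivative_of_real has_derivative_diff has_derivative_mult has_derivative_Re_hol d L M L' M' z)
  moreover have "P' z \<i> = Q' z 1" for z
    by (simp add: P'_def Q'_def)
  moreover have "\<beta> z w = of_real (Re w) * P z + of_real (Im w) * Q z" if "Im z > 0" for z w
    unfolding \<beta>[OF that] log_form_def P_def Q_def of_real_mult[symmetric] of_real_add[symmetric] of_real_eq_iff
    by (simp add: algebra_simps)
  ultimately show ?thesis
    unfolding C1_closed_def by (intro exI[of _ P] exI[of _ Q] exI[of _ P'] exI[of _ Q']) simp
qed

lemma log_form_potential:
  assumes L: "L holomorphic_on upper_half_plane" and M: "M holomorphic_on upper_half_plane"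
  obtains H where "\<And>z. Im z > 0 \<Longrightarrow> (H has_derivative log_form L M z) (at z)"
proof -
  note op = open_upper_half_plane
  have L': "deriv L holomorphic_on upper_half_plane" and M': "deriv M holomorphic_on upper_half_plane"
    using L M op by (auto intro: holomorphic_deriv)
  have d: "(F has_field_derivative deriv F z) (at z)" if "F holomorphic_on upper_half_plane" "Im z > 0" for F z
    using holomorphic_derivI[OF that(1) op] that(2) by simp
  have "(\<lambda>z. L z * deriv M z - M z * deriv L z) holomorphic_on upper_half_plane"
    by (intro holomorphic_intros L M L' M')
  from holomorphic_convex_primitive'[OF convex_upper_half_plane op this]
  obtain K where K: "\<And>z. z \<in> upper_half_plane \<Longrightarrow>
      (K has_field_derivative L z * deriv M z - M z * deriv L z) (at z within upper_half_plane)"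
    by blast
  have K': "(K has_field_derivative L z * deriv M z - M z * deriv L z) (at z)" if "Im z > 0" for z
    using K[of z] at_within_open[OF _ op, of z] that by simp
  \<comment> \<open>Twice the form is Im ((L M' - M L') dz) + d (Re L Im M - Im L Re M). The first
    part has the primitive Im K.\<close>
  define H where "H z = complex_of_real (1 / 2 * (Im (K z) + (Re (L z) * Im (M z) - Im (L z) * Re (M z))))" for z
  have "(H has_derivative log_form L M z) (at z)" if z: "Im z > 0" for z
  proof -
    have "(H has_derivative (\<lambda>w. complex_of_real (1 / 2 * (Im ((L z * deriv M z - M z * deriv L z) * w)
       + ((Re (L z) * Im (deriv M z * w) + Re (deriv L z * w) * Im (M z))
         - (Im (L z) * Re (deriv M z * w) + Im (deriv L z * w) * Re (M z))))))) (at z)"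
      unfolding H_def[abs_def]
      by (intro has_derivative_of_real has_derivative_mult_right has_derivative_add has_derivative_diff has_derivative_mult
            has_derivative_Re_hol d L M z K')
    also have "(\<lambda>w. complex_of_real (1 / 2 * (Im ((L z * deriv M z - M z * deriv L z) * w)
       + ((Re (L z) * Im (deriv M z * w) + Re (deriv L z * w) * Im (M z))
         - (Im (L z) * Re (deriv M z * w) + Im (deriv L z * w) * Re (M z)))))) = log_form L M z"
      unfolding log_form_def by (intro ext arg_cong[of _ _ complex_of_real]) (simp add: field_simps)
    finally show ?thesis .
  qed
  then show ?thesis by (rule that)
qed

text \<open>The half-plane is convex, so nowhere vanishing holomorphic functions on it have
  holomorphic logarithms.\<close>

lemma eta_log_form:
  assumes "u holomorphic_on upper_half_plane" "\<And>z. Im z > 0 \<Longrightarrow> u z \<noteq> 0"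
    and "v holomorphic_on upper_half_plane" "\<And>z. Im z > 0 \<Longrightarrow> v z \<noteq> 0"
  obtains L M where "L holomorphic_on upper_half_plane" "M holomorphic_on upper_half_plane"
    "\<And>z w. Im z > 0 \<Longrightarrow> eta u v z w = log_form L M z w"
proof -
  have log: "\<exists>L. L holomorphic_on upper_half_plane \<and> (\<forall>z. Im z > 0 \<longrightarrow> exp (L z) = u z)"
    if hol: "u holomorphic_on upper_half_plane" and nz: "\<And>z. Im z > 0 \<Longrightarrow> u z \<noteq> 0" for u
  proof -
    obtain L where "L holomorphic_on upper_half_plane" "\<And>z. z \<in> upper_half_plane \<Longrightarrow> exp (L z) = u z"
      by (rule holomorphic_logarithm_exists[OF convex_upper_half_plane open_upper_half_plane hol, of \<i>])
         (use nz in auto)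
    then show ?thesis by auto
  qed
  have dlog: "deriv u z / u z = deriv L z \<and> ln (cmod (u z)) = Re (L z)"
    if "L holomorphic_on upper_half_plane" "\<forall>z. Im z > 0 \<longrightarrow> exp (L z) = u z" "Im z > 0" for u L z
  proof -
    have "(L has_field_derivative deriv L z) (at z)"
      using holomorphic_derivI[OF that(1) open_upper_half_plane] that(3) by simp
    then have "((\<lambda>z. exp (L z)) has_field_derivative exp (L z) * deriv L z) (at z)"
      by (rule DERIV_chain2[OF DERIV_exp])
    then have "(u has_field_derivative exp (L z) * deriv L z) (at z)"
      by (rule has_field_derivative_transform_within_open[OF _ open_upper_half_plane]) (use that in auto)
    then have "deriv u z = exp (L z) * deriv L z" by (rule DERIV_imp_deriv)
    moreover have u: "u z = exp (L z)" using that by simp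
    ultimately show ?thesis by simp
  qed
  obtain L M where L: "L holomorphic_on upper_half_plane" "\<forall>z. Im z > 0 \<longrightarrow> exp (L z) = u z"
    and M: "M holomorphic_on upper_half_plane" "\<forall>z. Im z > 0 \<longrightarrow> exp (M z) = v z"
    using log[OF assms(1,2)] log[OF assms(3,4)] by blast
  show ?thesis
  proof (rule that[OF L(1) M(1)])
    fix z w :: complex assume z: "Im z > 0"
    have "deriv u z * w / u z = deriv L z * w" "deriv v z * w / v z = deriv M z * w"
      using dlog[OF L z] dlog[OF M z] by (metis times_divide_eq_left)+
    then show "eta u v z w = log_form L M z w"
      using dlog[OF L z] dlog[OF M z] by (simp add: eta_def darg_def log_form_def)
  qed
qed

lemma holomorphic_on_act:
  assumes "u holomorphic_on upper_half_plane" "A \<in> SL2Z"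
  shows "(\<lambda>z. u (act A z)) holomorphic_on upper_half_plane"
proof -
  have "act A holomorphic_on upper_half_plane"
    unfolding holomorphic_on_def field_differentiable_def
    using has_field_derivative_act[OF assms(2)] by (meson upper_half_plane_iff)
  then have "(u \<circ> act A) holomorphic_on upper_half_plane"
    by (rule holomorphic_on_compose_gen[OF _ assms(1)]) (use assms Im_act_pos in auto)
  then show ?thesis by (simp add: o_def)
qed

lemma pull_eta:
  assumes u: "u holomorphic_on upper_half_plane" and v: "v holomorphic_on upper_half_plane"
    and A: "A \<in> SL2Z" and z: "Im z > 0"
  shows "pull (eta u v) A z w = eta (\<lambda>z. u (act A z)) (\<lambda>z. v (act A z)) z w"
proof -
  have d: "deriv (\<lambda>z. x (act A z)) z = deriv x (act A z) / (aut_factor A z)\<^sup>2"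
    if "x holomorphic_on upper_half_plane" for x
  proof -
    have "(x has_field_derivative deriv x (act A z)) (at (act A z))"
      using holomorphic_derivI[OF that open_upper_half_plane] Im_act_pos[OF A z] by simp
    from DERIV_chain2[OF this has_field_derivative_act[OF A z]] show ?thesis
      by (simp add: DERIV_imp_deriv)
  qed
  show ?thesis
    by (simp add: pull_def eta_def darg_def d u v)
qed

lemma modular_unit_nonzero:
  assumes "u \<in> modular_units N" "Im z > 0"
  shows "u z \<noteq> 0"
proof -
  obtain u' where "\<forall>z\<in>upper_half_plane. u z * u' z = 1"
    using assms(1) unfolding modular_units_def by blast
  with assms(2) have "u z * u' z = 1" by simp
  then show ?thesis by auto
qed

lemma tame_eta:
  assumes N: "N \<ge> 1" and u: "u \<in> modular_units N" and v: "v \<in> modular_units N"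
  shows "tame N (eta u v)"
proof -
  note nz = modular_unit_nonzero
  have hol: "x holomorphic_on upper_half_plane"
    and inv: "A \<in> Gamma1 N \<Longrightarrow> Im z > 0 \<Longrightarrow> x (act A z) = x z"
    if "x \<in> modular_units N" for x A z
    using that by (auto simp: modular_units_def regular_functions_Y1_def)
  have "pull (eta u v) A z w = eta u v z w" if A: "A \<in> Gamma1 N" and z: "Im z > 0" for A z w
  proof -
    have "deriv (\<lambda>z. x (act A z)) z = deriv x z" if "x \<in> modular_units N" for x
    proof (rule deriv_cong_ev)
      show "\<forall>\<^sub>F z in nhds z. x (act A z) = x z"
        using eventually_nhds_in_open[OF open_upper_half_plane, of z] z
        by (auto elim!: eventually_mono intro: inv[OF that A])
    qed simp
    then show ?thesis
      using u v inv[OF u A z] inv[OF v A z]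
      by (simp add: pull_eta[OF hol[OF u] hol[OF v] Gamma1_SL2Z[OF A] z] eta_def darg_def)
  qed
  moreover have "C1_closed (pull (eta u v) A)" if A: "A \<in> SL2Z" for A
  proof -
    obtain L M where LM: "L holomorphic_on upper_half_plane" "M holomorphic_on upper_half_plane"
      "\<And>z w. Im z > 0 \<Longrightarrow> eta (\<lambda>z. u (act A z)) (\<lambda>z. v (act A z)) z w = log_form L M z w"
      by (rule eta_log_form[OF holomorphic_on_act[OF hol[OF u] A] nz[OF u] holomorphic_on_act[OF hol[OF v] A] nz[OF v]])
         (use Im_act_pos[OF A] in auto)
    then show ?thesis
      by (intro log_form_C1_closed[OF LM(1,2)]) (simp add: pull_eta[OF hol[OF u] hol[OF v] A])
  qed
  moreover have "\<exists>C\<ge>0. \<forall>z w. Im z \<ge> 1 / 2 \<longrightarrow> cmod (pull (eta u v) A z w) \<le> C * Im z * cmod w" if A: "A \<in> SL2Z" for A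
  proof -
    obtain C where C: "C \<ge> 0" "\<And>z w. Im z \<ge> 1 / 2 \<Longrightarrow>
       cmod (eta (\<lambda>z. u (act A z)) (\<lambda>z. v (act A z)) z w) \<le> C * Im z * cmod w"
      by (rule eta_growth[OF N u v A]) (rule that)
    then show ?thesis
      by (intro exI[of _ C]) (auto simp: pull_eta[OF hol[OF u] hol[OF v] A])
  qed
  moreover have "\<exists>H. \<forall>z. Im z > 0 \<longrightarrow> (H has_derivative eta u v z) (at z)"
  proof -
    obtain L M where LM: "L holomorphic_on upper_half_plane" "M holomorphic_on upper_half_plane"
      "\<And>z w. Im z > 0 \<Longrightarrow> eta u v z w = log_form L M z w"
      by (rule eta_log_form[OF hol[OF u] nz[OF u] hol[OF v] nz[OF v]]) (assumption, assumption, rule that)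
    obtain H where "\<And>z. Im z > 0 \<Longrightarrow> (H has_derivative log_form L M z) (at z)"
      by (rule log_form_potential[OF LM(1,2)]) (rule that)
    moreover have "eta u v z = log_form L M z" if "Im z > 0" for z
      using LM(3)[OF that] by (rule ext)
    ultimately show ?thesis by (intro exI[of _ H]) simp
  qed
  ultimately show ?thesis
    unfolding tame_def by blast
qed

lemma slash2_mult:
  assumes "A \<in> SL2Z" "B \<in> SL2Z" "Im z > 0"
  shows "slash2 f (A ** B) z = slash2 f A (act B z) / (aut_factor B z)\<^sup>2"
  using assms by (simp add: slash2_def act_mult aut_factor_mult power_mult_distrib)

lemma pull_mult:
  assumes "A \<in> SL2Z" "B \<in> SL2Z" "Im z > 0"
  shows "pull \<alpha> (A ** B) z w = pull \<alpha> A (act B z) (w / (aut_factor B z)\<^sup>2)"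
  using assms by (simp add: pull_def act_mult aut_factor_mult power_mult_distrib mult.commute)

lemma holomorphic_slash2:
  assumes "f holomorphic_on upper_half_plane" "A \<in> SL2Z"
  shows "slash2 f A holomorphic_on upper_half_plane"
  unfolding slash2_def[abs_def]
  using assms aut_factor_nonzero[OF assms(2)]
  by (intro holomorphic_intros holomorphic_on_act) (auto simp: aut_factor_def intro!: holomorphic_intros)

text \<open>The conjugate of the closed form f dz, with the conjugate primitive as potential. It
  even decays at the cusps; exp \<le> 1 \<le> 2 Im z puts this into the required linear shape.
  Wedged with f dz it yields the Petersson norm.\<close>

lemma tame_cnj:
  assumes N: "N \<ge> 1" and f: "f \<in> cusp_forms2 N"
  shows "tame N (\<lambda>z w. cnj (f z * w))"
proof -
  define \<alpha> :: form1 where "\<alpha> = (\<lambda>z w. cnj (f z * w))"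
  have hol: "f holomorphic_on upper_half_plane"
    and inv: "\<And>A z. A \<in> Gamma1 N \<Longrightarrow> Im z > 0 \<Longrightarrow> f (act A z) = aut_factor A z ^ 2 * f z"
    using f by (auto simp: cusp_forms2_def)
  have pull: "pull \<alpha> A z w = cnj (slash2 f A z * w)" for A z w
    by (simp add: \<alpha>_def pull_def slash2_def)
  have "pull \<alpha> A z w = \<alpha> z w" if A: "A \<in> Gamma1 N" and z: "Im z > 0" for A z w
    using aut_factor_nonzero[OF Gamma1_SL2Z[OF A] z] inv[OF A z] unfolding pull by (simp add: \<alpha>_def slash2_def)
  moreover have "C1_closed (pull \<alpha> A)" if A: "A \<in> SL2Z" for A
  proof -
    define F where "F = slash2 f A"
    have F: "F holomorphic_on upper_half_plane"
      unfolding F_def using hol A by (rule holomorphic_slash2)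
    then have F': "deriv F holomorphic_on upper_half_plane"
      by (intro holomorphic_deriv open_upper_half_plane)
    have d: "(F has_derivative (\<lambda>w. deriv F z * w)) (at z)" if "Im z > 0" for z
      using holomorphic_derivI[OF F open_upper_half_plane, of z] that by (simp add: has_field_derivative_def)
    have "pull \<alpha> A z w = of_real (Re w) * cnj (F z) + of_real (Im w) * cnj (\<i> * F z)" for z w
      unfolding pull F_def by (simp add: complex_eq_iff algebra_simps)
    moreover have "((\<lambda>z. cnj (F z)) has_derivative (\<lambda>w. cnj (deriv F z * w))) (at z)"
      "((\<lambda>z. cnj (\<i> * F z)) has_derivative (\<lambda>w. cnj (\<i> * (deriv F z * w)))) (at z)" if "Im z > 0" for z
      by (intro has_derivative_cnj has_derivative_mult_right d that)+
    moreover have "continuous_on upper_half_plane (\<lambda>z. cnj (deriv F z * w))"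
      "continuous_on upper_half_plane (\<lambda>z. cnj (\<i> * (deriv F z * w)))" for w
      by (intro continuous_intros holomorphic_on_imp_continuous_on[OF F'])+
    ultimately show ?thesis
      unfolding C1_closed_def
      by (intro exI[of _ "\<lambda>z. cnj (F z)"] exI[of _ "\<lambda>z. cnj (\<i> * F z)"]
            exI[of _ "\<lambda>z w. cnj (deriv F z * w)"] exI[of _ "\<lambda>z w. cnj (\<i> * (deriv F z * w))"]) simp
  qed
  moreover have "\<exists>C\<ge>0. \<forall>z w. Im z \<ge> 1 / 2 \<longrightarrow> cmod (pull \<alpha> A z w) \<le> C * Im z * cmod w" if A: "A \<in> SL2Z" for A
  proof -
    obtain C where C: "C \<ge> 0" "\<And>z. Im z \<ge> 1 / 2 \<Longrightarrow> cmod (slash2 f A z) \<le> C * exp (- (2 * pi / N) * Im z)"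
      by (rule cusp_form_decay[OF N f A]) (rule that)
    have "cmod (pull \<alpha> A z w) \<le> 2 * C * Im z * cmod w" if z: "Im z \<ge> 1 / 2" for z w
    proof -
      have "cmod (slash2 f A z) \<le> C * 1"
        using C(1) z by (intro order.trans[OF C(2)[OF z]] mult_left_mono) auto
      also have "\<dots> \<le> C * (2 * Im z)"
        using C(1) z by (intro mult_left_mono) auto
      finally have "cmod (slash2 f A z) * cmod w \<le> C * (2 * Im z) * cmod w"
        by (rule mult_right_mono) simp
      then show ?thesis by (simp add: pull norm_mult mult_ac)
    qed
    then show ?thesis using C(1) by (intro exI[of _ "2 * C"]) auto
  qed
  moreover have "\<exists>H. \<forall>z. Im z > 0 \<longrightarrow> (H has_derivative \<alpha> z) (at z)"
  proof -
    obtain G C where G: "C \<ge> (0 :: real)" "\<And>z. Im z > 0 \<Longrightarrow> (G has_field_derivative slash2 f (mat 1) z) (at z)"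
      by (rule cusp_form_primitive[OF N f mat_1_SL2Z]) (rule that)
    have "((\<lambda>z. cnj (G z)) has_derivative \<alpha> z) (at z)" if "Im z > 0" for z
      using has_derivative_cnj[OF G(2)[OF that, unfolded has_field_derivative_def]]
      by (simp add: \<alpha>_def slash2_def)
    then show ?thesis by blast
  qed
  ultimately show ?thesis
    unfolding \<alpha>_def[symmetric] tame_def by blast
qed

lemma path_integral1_potential:
  assumes H: "\<And>z. Im z > 0 \<Longrightarrow> (H has_derivative \<alpha> z) (at z)"
    and p: "valid_path p" "path_image p \<subseteq> upper_half_plane"
  shows "path_integral1 \<alpha> p = H (pathfinish p) - H (pathstart p)"
proof -
  obtain S where S: "finite S" "p C1_differentiable_on {0..1} - S" and cont: "continuous_on {0..1} p"
    using p(1) by (auto simp: valid_path_def piecewise_C1_differentiable_on_def)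
  obtain D where "\<forall>t\<in>{0..1} - S. (p has_vector_derivative D t) (at t)"
    using S(2) unfolding C1_differentiable_on_def by blast
  then have D: "(p has_vector_derivative D t) (at t)" if "t \<in> {0..1} - S" for t
    using that by blast
  have pos: "Im (p t) > 0" if "t \<in> {0..1}" for t
  proof -
    have "p t \<in> upper_half_plane"
      using p(2) that by (auto simp only: path_image_def)
    then show ?thesis by simp
  qed
  have "((\<lambda>t. \<alpha> (p t) (vector_derivative p (at t within {0..1}))) has_integral (H (p 1) - H (p 0))) {0..1}"
  proof (rule fundamental_theorem_of_calculus_strong[OF S(1), of 0 1 "\<lambda>t. H (p t)"])
    fix t assume t: "t \<in> {0..1} - S"
    then have "vector_derivative p (at t within {0..1}) = D t"
      using D[OF t] by (intro vector_derivative_at_within_ivl[of _ _ _ 0 1]) auto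
    moreover have "((\<lambda>t. H (p t)) has_vector_derivative \<alpha> (p t) (D t)) (at t)"
      using vector_derivative_diff_chain_within[of p "D t" t UNIV H "\<alpha> (p t)"] D[OF t] H[OF pos, of t] t
      by (auto simp: o_def intro: has_derivative_at_withinI)
    ultimately show "((\<lambda>t. H (p t)) has_vector_derivative \<alpha> (p t) (vector_derivative p (at t within {0..1}))) (at t)"
      by simp
  next
    have "continuous_on upper_half_plane H"
      by (rule has_derivative_continuous_on[OF has_derivative_at_withinI[OF H]]) simp
    then show "continuous_on {0..1} (\<lambda>t. H (p t))"
      by (rule continuous_on_compose2[OF _ cont]) (use pos in auto)
  qed simp
  then show ?thesis
    by (simp add: path_integral1_def integral_unique pathfinish_def pathstart_def)
qed

subsection \<open>Periods of a cusp form\<close>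

text \<open>Half of the exponent is spent on the linear factor, by c y / 2 \<le> exp (c y /
  2).\<close>

lemma exp_times_linear_bound:
  assumes "c > (0 :: real)" "y \<ge> 0"
  shows "y * exp (- c * y) \<le> 2 / c * exp (- (c / 2) * y)"
proof -
  have "c / 2 * y \<le> exp (c / 2 * y)"
    using exp_ge_add_one_self[of "c / 2 * y"] by linarith
  then have "y \<le> 2 / c * exp (c / 2 * y)"
    using assms(1) by (simp add: field_simps)
  then have "y * exp (- c * y) \<le> (2 / c * exp (c / 2 * y)) * exp (- c * y)"
    by (rule mult_right_mono) simp
  also have "\<dots> = 2 / c * exp (c / 2 * y + - c * y)"
    unfolding exp_add by simp
  also have "c / 2 * y + - c * y = - (c / 2) * y"
    by (simp add: field_simps)
  finally show ?thesis .
qed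

lemma tendsto_exp_neg:
  assumes "c > (0 :: real)"
  shows "((\<lambda>t. exp (- c * t)) \<longlongrightarrow> 0) at_top"
proof -
  have "filterlim (\<lambda>t. - c * t) at_bot at_top"
    using assms by (intro filterlim_tendsto_neg_mult_at_bot[OF tendsto_const] filterlim_ident) simp
  then show ?thesis
    by (rule filterlim_compose[OF exp_at_bot])
qed

lemma imaginary_axis_vector_derivative:
  "((\<lambda>s. \<i> * complex_of_real s) has_vector_derivative \<i>) (at t)"
proof -
  have "((\<lambda>s. \<i> * complex_of_real s) has_vector_derivative (\<i> * of_real 1)) (at t)"
    by (intro has_vector_derivative_mult_right has_vector_derivative_of_real)
       (auto simp: has_real_derivative_iff_has_vector_derivative[symmetric])
  then show ?thesis by simp
qed

lemma field_derivative_zero_constant_on_H: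
  fixes F :: "complex \<Rightarrow> complex"
  assumes "\<And>z. Im z > 0 \<Longrightarrow> (F has_field_derivative 0) (at z)" "Im z > 0" "Im w > 0"
  shows "F z = F w"
proof -
  have "\<exists>c. \<forall>x\<in>upper_half_plane. F x = c"
    by (rule has_field_derivative_zero_constant[OF convex_upper_half_plane])
       (use assms(1) in \<open>auto intro: has_field_derivative_at_within\<close>)
  then show ?thesis using assms by auto
qed

text \<open>Increasing x therefore runs along the arc from \<open>rho ^ 2\<close> to
  \<open>rho\<close>, against the direction of the integrals in the theorem.\<close>

lemma rho_strip: "rho = strip (1 / 2) 0" "rho ^ 2 = strip (- 1 / 2) 0"
proof -
  have r: "rho = Complex (1 / 2) (sqrt 3 / 2)"
    by (simp add: rho_def exp_eq_polar complex_eq_iff Re_exp Im_exp cos_60 sin_60)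
  have s: "sqrt (3 / 4) = sqrt 3 / 2"
    by (simp add: real_sqrt_divide)
  show "rho = strip (1 / 2) 0" "rho ^ 2 = strip (- 1 / 2) 0"
    by (simp_all add: r strip_def power2_eq_square complex_eq_iff s)
qed

text \<open>On the unit circle - 1/z is minus the conjugate of z.\<close>

lemma strip_0_neg:
  assumes "x \<in> {- 1 / 2..1 / 2}"
  shows "- 1 / strip x 0 = strip (- x) 0"
proof -
  have "(Re (strip x 0))\<^sup>2 + (Im (strip x 0))\<^sup>2 = 1"
    using arc_pos(1)[OF assms] by (simp add: strip_def)
  then show ?thesis
    by (simp add: complex_eq_iff Re_divide Im_divide) (simp add: strip_def)
qed

section \<open>Normalised primitives and their periods\<close>

locale period_data =
  fixes N :: nat and f :: "complex \<Rightarrow> complex" and \<alpha> :: form1 and g :: "int \<times> int \<Rightarrow> int ^ 2 ^ 2"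
  assumes N: "N \<ge> 1" and f: "f \<in> cusp_forms2 N" and tame: "tame N \<alpha>"
    and g: "\<And>x. x \<in> E_set N \<Longrightarrow> lifts N (g x) x"
begin

lemma g_SL2Z: "x \<in> E_set N \<Longrightarrow> g x \<in> SL2Z"
  using g lifts_iff_row[OF N] by blast

lemma f_hol: "f holomorphic_on upper_half_plane"
  using f by (simp add: cusp_forms2_def)

lemma slash2_row:
  assumes "A \<in> SL2Z" "B \<in> SL2Z" "bottom_row N A = bottom_row N B" "Im z > 0"
  shows "slash2 f A z = slash2 f B z"
proof -
  obtain C where C: "C \<in> Gamma1 N" "C \<in> SL2Z" "C ** B = A"
    using bottom_row_cosetE[OF N assms(1-3)] .
  have pos: "Im (act B z) > 0" using assms Im_act_pos by auto
  have "slash2 f A z = slash2 f C (act B z) / (aut_factor B z)\<^sup>2"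
    using C assms by (simp flip: slash2_mult)
  also have "slash2 f C (act B z) = f (act B z)"
    using f C(1) pos aut_factor_nonzero[OF C(2) pos] by (simp add: cusp_forms2_def slash2_def)
  finally show ?thesis by (simp add: slash2_def)
qed

lemma pull_row:
  assumes "A \<in> SL2Z" "B \<in> SL2Z" "bottom_row N A = bottom_row N B" "Im z > 0"
  shows "pull \<alpha> A z w = pull \<alpha> B z w"
proof -
  obtain C where C: "C \<in> Gamma1 N" "C \<in> SL2Z" "C ** B = A"
    using bottom_row_cosetE[OF N assms(1-3)] .
  have pos: "Im (act B z) > 0" using assms Im_act_pos by auto
  have "pull \<alpha> A z w = pull \<alpha> C (act B z) (w / (aut_factor B z)\<^sup>2)"
    using C assms by (simp flip: pull_mult)
  also have "\<dots> = \<alpha> (act B z) (w / (aut_factor B z)\<^sup>2)"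
    using tame C(1) pos by (simp add: tame_def)
  finally show ?thesis by (simp add: pull_def)
qed

definition is_prim :: "int ^ 2 ^ 2 \<Rightarrow> (complex \<Rightarrow> complex) \<Rightarrow> bool" where
  "is_prim A G \<longleftrightarrow> (\<forall>z. Im z > 0 \<longrightarrow> (G has_field_derivative slash2 f A z) (at z)) \<and>
     (\<exists>C\<ge>0. \<forall>z. Im z \<ge> 1 / 2 \<longrightarrow> cmod (G z) \<le> C * exp (- (2 * pi / N) * Im z))"

text \<open>The decay at infinity fixes the constant of integration, so by
  \<open>is_prim_unique\<close> the choice is determined on the half-plane.\<close>

definition prim :: "int ^ 2 ^ 2 \<Rightarrow> complex \<Rightarrow> complex" where
  "prim A = (SOME G. is_prim A G)"

lemma is_prim_prim:
  assumes "A \<in> SL2Z"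
  shows "is_prim A (prim A)"
  unfolding prim_def
proof (rule someI_ex[of "is_prim A"])
  obtain G C where "C \<ge> 0" "\<And>z. Im z > 0 \<Longrightarrow> (G has_field_derivative slash2 f A z) (at z)"
    "\<And>z. Im z \<ge> 1 / 2 \<Longrightarrow> cmod (G z) \<le> C * exp (- (2 * pi / N) * Im z)"
    "\<And>z. Im z \<ge> 1 / 2 \<Longrightarrow> cmod (slash2 f A z) \<le> C * exp (- (2 * pi / N) * Im z)"
    by (rule cusp_form_primitive[OF N f assms]) (rule that)
  then have "is_prim A G"
    unfolding is_prim_def by blast
  then show "\<exists>G. is_prim A G"
    by blast
qed

lemma is_prim_tendsto_0:
  assumes "is_prim A G"
  shows "((\<lambda>t. G (\<i> * of_real t)) \<longlongrightarrow> 0) at_top"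
proof -
  obtain C where C: "C \<ge> 0" "\<And>z. Im z \<ge> 1 / 2 \<Longrightarrow> cmod (G z) \<le> C * exp (- (2 * pi / N) * Im z)"
    using assms by (auto simp: is_prim_def)
  have c: "2 * pi / N > 0" using N by simp
  have "((\<lambda>t. C * exp (- (2 * pi / N) * t)) \<longlongrightarrow> 0) at_top"
    by (rule tendsto_mult_right_zero[OF tendsto_exp_neg[OF c]])
  moreover have "\<forall>\<^sub>F t in at_top. cmod (G (\<i> * of_real t)) \<le> C * exp (- (2 * pi / N) * t)"
    using eventually_ge_at_top[of "1 / 2"]
  proof eventually_elim
    case (elim t)
    then show ?case using C(2)[of "\<i> * of_real t"] by simp
  qed
  ultimately show ?thesis
    by (rule Lim_null_comparison[rotated])
qed

text \<open>The difference is constant and tends to 0 along the imaginary axis.\<close>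

lemma is_prim_unique:
  assumes "is_prim A G" "is_prim B G'" "\<And>z. Im z > 0 \<Longrightarrow> slash2 f A z = slash2 f B z" "Im z > 0"
  shows "G z = G' z"
proof -
  define F where "F z = G z - G' z" for z
  have const: "F w = F z" if "Im w > 0" for w
  proof (rule field_derivative_zero_constant_on_H[OF _ that assms(4)])
    fix x assume x: "Im x > 0"
    have "((\<lambda>z. G z - G' z) has_field_derivative slash2 f A x - slash2 f B x) (at x)"
      using assms(1,2) x by (intro DERIV_diff) (auto simp: is_prim_def)
    then show "(F has_field_derivative 0) (at x)"
      using assms(3)[OF x] by (simp add: F_def[abs_def])
  qed
  have "((\<lambda>t. F (\<i> * of_real t)) \<longlongrightarrow> 0 - 0) at_top"
    unfolding F_def using assms(1,2) by (intro tendsto_diff is_prim_tendsto_0)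
  moreover have "\<forall>\<^sub>F t in at_top. F (\<i> * of_real t) = F z"
    using eventually_gt_at_top[of "0 :: real"] by eventually_elim (rule const, simp)
  ultimately have "((\<lambda>t :: real. F z) \<longlongrightarrow> 0) at_top"
    by (simp add: tendsto_cong)
  then have "F z = 0"
    by (simp add: tendsto_const_iff)
  then show ?thesis by (simp add: F_def)
qed

lemma prim_row:
  assumes "A \<in> SL2Z" "B \<in> SL2Z" "bottom_row N A = bottom_row N B" "Im z > 0"
  shows "prim A z = prim B z"
  using is_prim_unique[OF is_prim_prim[OF assms(1)] is_prim_prim[OF assms(2)] _ assms(4)] slash2_row[OF assms(1-3)]
  by blast

lemma prim_deriv:
  assumes "A \<in> SL2Z" "Im z > 0"
  shows "(prim A has_field_derivative slash2 f A z) (at z)"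
  using is_prim_prim[OF assms(1)] assms(2) by (simp add: is_prim_def)

text \<open>Translation preserves the cusp at infinity and hence the decay, so no additive constant
  appears; \<open>matS\<close> moves that cusp, and there one does.\<close>

lemma prim_T:
  assumes "A \<in> SL2Z" "Im z > 0"
  shows "prim A (z + 1) = prim (A ** matT 1) z"
proof (rule is_prim_unique[OF _ is_prim_prim refl assms(2)])
  show "A ** matT 1 \<in> SL2Z"
    using assms by (simp add: SL2Z_mult)
  have "((\<lambda>z. prim A (z + 1)) has_field_derivative slash2 f (A ** matT 1) z) (at z)" if "Im z > 0" for z
  proof -
    have "((\<lambda>z. prim A (z + 1)) has_field_derivative slash2 f A (z + 1) * 1) (at z)"
      by (rule DERIV_chain2[OF prim_deriv]) (use assms that in \<open>auto intro!: derivative_eq_intros\<close>)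
    then show ?thesis
      using assms that by (simp add: slash2_mult)
  qed
  moreover obtain C where "C \<ge> 0" "\<And>z. Im z \<ge> 1 / 2 \<Longrightarrow> cmod (prim A z) \<le> C * exp (- (2 * pi / N) * Im z)"
    using is_prim_prim[OF assms(1)] by (auto simp: is_prim_def)
  then have "\<exists>C\<ge>0. \<forall>z. Im z \<ge> 1 / 2 \<longrightarrow> cmod (prim A (z + 1)) \<le> C * exp (- (2 * pi / N) * Im z)"
    by (metis add.right_neutral one_complex.simps(2) plus_complex.simps(2))
  ultimately show "is_prim (A ** matT 1) (\<lambda>z. prim A (z + 1))"
    unfolding is_prim_def by blast
qed

text \<open>The integral of the translate of f by A from 0 to infinity along the imaginary axis. It
  is the constant by which two primitives differ, read off at the fixed point \<open>\<i>\<close> of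
  \<open>matS\<close>.\<close>

definition period :: "int ^ 2 ^ 2 \<Rightarrow> complex" where
  "period A = prim (A ** matS) \<i> - prim A \<i>"

lemma prim_S:
  assumes A: "A \<in> SL2Z" and z: "Im z > 0"
  shows "prim A (- 1 / z) = prim (A ** matS) z - period A"
proof -
  have AS: "A ** matS \<in> SL2Z" using A by (simp add: SL2Z_mult)
  have pos: "Im (- 1 / z) > 0" if "Im z > 0" for z
    using Im_act_pos[of matS z] that by simp
  define F where "F z = prim A (- 1 / z) - prim (A ** matS) z" for z
  have "F z = F \<i>"
  proof (rule field_derivative_zero_constant_on_H[OF _ z])
    fix x assume x: "Im x > 0"
    have "((\<lambda>z. - 1 / z) has_field_derivative 1 / x\<^sup>2) (at x)"
      using has_field_derivative_act[of matS x] x by (simp add: act_matS[abs_def])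
    from DERIV_chain2[OF prim_deriv[OF A pos[OF x]] this]
    have "((\<lambda>z. prim A (- 1 / z)) has_field_derivative slash2 f (A ** matS) x) (at x)"
      using A x by (simp add: slash2_mult)
    from DERIV_diff[OF this prim_deriv[OF AS x]] show "(F has_field_derivative 0) (at x)"
      by (simp add: F_def[abs_def])
  qed simp
  then show ?thesis
    by (simp add: F_def period_def algebra_simps)
qed

text \<open>For t \<ge> 1 this is the decay at infinity; for t < 1 the inversion s = 1/t moves the
  point up the axis, where decay beats the factor s^2. The bound makes the integral of
  \<open>manin_symbol\<close> absolutely convergent at both ends.\<close>

lemma slash2_axis_bound:
  assumes A: "A \<in> SL2Z"
  obtains C where "\<And>t. t > 0 \<Longrightarrow> cmod (slash2 f A (\<i> * of_real t)) \<le> C * exp (- (2 * pi / N) * t)"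
proof -
  define c where "c = 2 * pi / real N"
  have c: "c > 0" using N by (simp add: c_def)
  have AS: "A ** matS \<in> SL2Z" using A by (simp add: SL2Z_mult)
  obtain C1 where C1: "C1 \<ge> 0" "\<And>z. Im z \<ge> 1 / 2 \<Longrightarrow> cmod (slash2 f A z) \<le> C1 * exp (- (2 * pi / N) * Im z)"
    by (rule cusp_form_decay[OF N f A]) (rule that)
  obtain C2 where C2: "C2 \<ge> 0" "\<And>z. Im z \<ge> 1 / 2 \<Longrightarrow> cmod (slash2 f (A ** matS) z) \<le> C2 * exp (- (2 * pi / N) * Im z)"
    by (rule cusp_form_decay[OF N f AS]) (rule that)
  \<comment> \<open>\<open>2 / c\<close> and \<open>4 / c\<close> come from applying
    \<open>exp_times_linear_bound\<close> with c and then c/2, once for each factor s. The factor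
    exp c compensates exp (- c t) for t < 1.\<close>
  define C where "C = C1 + C2 * (2 / c * (4 / c)) * exp c"
  have Cpos: "0 \<le> C2 * (2 / c * (4 / c)) * exp c"
    using C2(1) c by simp
  have "cmod (slash2 f A (\<i> * of_real t)) \<le> C * exp (- c * t)" if t: "t > 0" for t
  proof (cases "t \<ge> 1")
    case True
    have "cmod (slash2 f A (\<i> * of_real t)) \<le> C1 * exp (- c * t)"
      using C1(2)[of "\<i> * of_real t"] True by (simp add: c_def)
    also have "\<dots> \<le> C * exp (- c * t)"
      using Cpos by (intro mult_right_mono) (auto simp: C_def)
    finally show ?thesis .
  next
    case False
    define s where "s = 1 / t"
    have s: "s \<ge> 1" using False t by (simp add: s_def)
    have st: "- 1 / (\<i> * of_real s) = \<i> * complex_of_real t"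
      using t by (simp add: s_def field_simps)
    have "slash2 f (A ** matS) (\<i> * of_real s) = slash2 f A (\<i> * of_real t) / (\<i> * of_real s)\<^sup>2"
      using slash2_mult[of A matS "\<i> * of_real s" f] A s st by simp
    then have "cmod (slash2 f A (\<i> * of_real t)) = s\<^sup>2 * cmod (slash2 f (A ** matS) (\<i> * of_real s))"
      using s by (simp add: norm_divide norm_mult norm_power)
    also have "\<dots> \<le> s\<^sup>2 * (C2 * exp (- c * s))"
      using C2(2)[of "\<i> * of_real s"] s by (intro mult_left_mono) (auto simp: c_def)
    also have "\<dots> = C2 * (s * (s * exp (- c * s)))"
      by (simp add: power2_eq_square)
    also have "\<dots> \<le> C2 * (s * (2 / c * exp (- (c / 2) * s)))"
      using exp_times_linear_bound[OF c, of s] s C2(1) by (intro mult_left_mono) auto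
    also have "\<dots> = C2 * (2 / c * (s * exp (- (c / 2) * s)))"
      by simp
    also have "\<dots> \<le> C2 * (2 / c * (2 / (c / 2) * exp (- (c / 2 / 2) * s)))"
      using exp_times_linear_bound[of "c / 2" s] s C2(1) c by (intro mult_left_mono) auto
    also have "\<dots> \<le> C2 * (2 / c * (2 / (c / 2) * 1))"
      using s C2(1) c by (intro mult_left_mono) auto
    finally have 1: "cmod (slash2 f A (\<i> * of_real t)) \<le> C2 * (2 / c * (4 / c)) * 1"
      by simp
    also have "\<dots> \<le> C2 * (2 / c * (4 / c)) * (exp c * exp (- c * t))"
    proof (rule mult_left_mono)
      have "c * t \<le> c * 1"
        using False c by (intro mult_left_mono) auto
      then show "1 \<le> exp c * exp (- c * t)"
        by (simp flip: exp_add)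
    qed (use C2(1) c in simp)
    also have "\<dots> \<le> C * exp (- c * t)"
      using C1(1) by (simp add: C_def algebra_simps)
    finally show ?thesis .
  qed
  then show ?thesis unfolding c_def by (rule that)
qed

lemma manin_symbol_period:
  assumes A: "A \<in> SL2Z"
  shows "manin_symbol f A = - \<i> * period A"
proof -
  define h where "h t = \<i> * slash2 f A (\<i> * of_real t)" for t :: real
  have vd: "vector_derivative (\<lambda>s. act A (\<i> * of_real s)) (at t) = \<i> / (aut_factor A (\<i> * of_real t))\<^sup>2" if "t > 0" for t :: real
  proof (rule vector_derivative_at)
    have "(act A has_field_derivative 1 / (aut_factor A (\<i> * of_real t))\<^sup>2) (at (\<i> * of_real t))"
      using that by (intro has_field_derivative_act A) simp
    from field_vector_diff_chain_at[OF imaginary_axis_vector_derivative this]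
    show "((\<lambda>s. act A (\<i> * of_real s)) has_vector_derivative \<i> / (aut_factor A (\<i> * of_real t))\<^sup>2) (at t)"
      by (simp add: o_def)
  qed
  have hd: "((\<lambda>t. prim A (\<i> * of_real t)) has_vector_derivative h t) (at t)" if "t > 0" for t
  proof -
    from field_vector_diff_chain_at[OF imaginary_axis_vector_derivative, of "prim A"] prim_deriv[OF A, of "\<i> * of_real t"] that
    show ?thesis
      by (simp add: o_def h_def)
  qed
  have cont: "continuous_on {0<..} h"
    unfolding h_def[abs_def]
    by (intro continuous_intros continuous_on_compose2[OF holomorphic_on_imp_continuous_on[OF holomorphic_slash2[OF f_hol A]]]) auto
  have int: "set_integrable lborel {0<..} h"
  proof -
    obtain C where C: "\<And>t. t > 0 \<Longrightarrow> cmod (slash2 f A (\<i> * of_real t)) \<le> C * exp (- (2 * pi / N) * t)"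
      by (rule slash2_axis_bound[OF A]) (rule that)
    have "(\<lambda>y :: real. exp (- (2 * pi / N) * y)) absolutely_integrable_on {0..}"
      using N by (intro nonnegative_absolutely_integrable_1 integrable_on_exp_minus_to_infinity) auto
    then have "set_integrable lborel {0..} (\<lambda>y. exp (- (2 * pi / N) * y))"
      unfolding set_integrable_def by (subst (asm) integrable_completion) auto
    then have "set_integrable lborel {0<..} (\<lambda>y. exp (- (2 * pi / N) * y))"
      by (rule set_integrable_subset) auto
    then have "integrable lborel (\<lambda>y. C * (indicat_real {0<..} y *\<^sub>R exp (- (2 * pi / N) * y)))"
      unfolding set_integrable_def by (rule integrable_mult_right)
    then show ?thesis
      unfolding set_integrable_def
    proof (rule Bochner_Integration.integrable_bound)
      show "(\<lambda>t. indicat_real {0<..} t *\<^sub>R h t) \<in> borel_measurable lborel"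
        using borel_measurable_continuous_on_indicator[OF _ cont] by simp
      show "AE t in lborel. cmod (indicat_real {0<..} t *\<^sub>R h t) \<le> norm (C * (indicat_real {0<..} t *\<^sub>R exp (- (2 * pi / N) * t)))"
      proof (rule AE_I2)
        fix t :: real
        show "cmod (indicat_real {0<..} t *\<^sub>R h t) \<le> norm (C * (indicat_real {0<..} t *\<^sub>R exp (- (2 * pi / N) * t)))"
        proof (cases "t > 0")
          case True
          then show ?thesis
            using order.trans[OF C[OF True] abs_ge_self] by (simp add: h_def norm_mult)
        qed simp
      qed
    qed
  qed
  have lim1: "((\<lambda>t. prim A (\<i> * of_real t)) \<longlongrightarrow> 0) at_top"
    by (rule is_prim_tendsto_0[OF is_prim_prim[OF A]])
  \<comment> \<open>By \<open>prim_S\<close> the behaviour at 0 is that of the primitive for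
    \<open>A ** matS\<close> at infinity, shifted by the period.\<close>
  have lim0: "((\<lambda>t. prim A (\<i> * of_real t)) \<longlongrightarrow> - period A) (at_right 0)"
  proof -
    have AS: "A ** matS \<in> SL2Z" using A by (simp add: SL2Z_mult)
    have "((\<lambda>t. prim (A ** matS) (\<i> * of_real (inverse t)) - period A) \<longlongrightarrow> 0 - period A) (at_right 0)"
      by (intro tendsto_diff tendsto_const filterlim_compose[OF is_prim_tendsto_0[OF is_prim_prim[OF AS]] filterlim_inverse_at_top_right])
    moreover have "\<forall>\<^sub>F t in at_right 0. prim A (\<i> * of_real t) = prim (A ** matS) (\<i> * of_real (inverse t)) - period A"
      using eventually_at_right_less[of "0 :: real"]
    proof eventually_elim
      case (elim t)
      have "- 1 / (\<i> * of_real (inverse t)) = \<i> * complex_of_real t"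
        using elim by (simp add: field_simps)
      then show ?case
        using prim_S[OF A, of "\<i> * of_real (inverse t)"] elim by simp
    qed
    ultimately show ?thesis
      by (simp add: tendsto_cong)
  qed
  have "(LBINT t=0..\<infinity>. h t) = 0 - (- period A)"
  proof (rule interval_integral_FTC_integrable[where F = "\<lambda>t. prim A (\<i> * of_real t)"])
    show "((\<lambda>t. prim A (\<i> * of_real t)) has_vector_derivative h x) (at x)" if "0 < ereal x" "ereal x < \<infinity>" for x
      using that by (intro hd) simp
    show "isCont h x" if "0 < ereal x" "ereal x < \<infinity>" for x
      using cont that by (intro continuous_on_interior[OF cont]) (simp add: interior_open)
    show "set_integrable lborel (einterval 0 \<infinity>) h"
      using int by (simp add: zero_ereal_def)
    show "(((\<lambda>t. prim A (\<i> * of_real t)) \<circ> real_of_ereal) \<longlongrightarrow> - period A) (at_right 0)"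
      using lim0 by (simp add: zero_ereal_def ereal_tendsto_simps)
    show "(((\<lambda>t. prim A (\<i> * of_real t)) \<circ> real_of_ereal) \<longlongrightarrow> 0) (at_left \<infinity>)"
      using lim1 by (simp add: ereal_tendsto_simps)
  qed simp
  then have "(LINT t:{0<..}|lborel. h t) = period A"
    by (simp add: interval_lebesgue_integral_def zero_ereal_def)
  moreover have "(LINT t:{0<..}|lborel. f (act A (\<i> * of_real t)) * vector_derivative (\<lambda>s. act A (\<i> * of_real s)) (at t))
     = (LINT t:{0<..}|lborel. h t)"
    by (rule set_lebesgue_integral_cong) (auto simp: vd h_def slash2_def)
  ultimately show ?thesis
    by (simp add: manin_symbol_def)
qed

end

section \<open>Boundary contributions and their sum over E_N\<close>

context period_data
begin

lemma closed: "A \<in> SL2Z \<Longrightarrow> C1_closed (pull \<alpha> A)"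
  using tame by (simp add: tame_def)

lemma growth:
  assumes "A \<in> SL2Z"
  obtains C where "C \<ge> 0" "\<And>z w. Im z \<ge> 1 / 2 \<Longrightarrow> cmod (pull \<alpha> A z w) \<le> C * Im z * cmod w"
proof -
  have "\<exists>C\<ge>0. \<forall>z w. Im z \<ge> 1 / 2 \<longrightarrow> cmod (pull \<alpha> A z w) \<le> C * Im z * cmod w"
    using tame assms by (simp add: tame_def)
  then obtain C where "C \<ge> 0" "\<forall>z w. Im z \<ge> 1 / 2 \<longrightarrow> cmod (pull \<alpha> A z w) \<le> C * Im z * cmod w"
    by (elim exE conjE) (rule that)
  then show ?thesis by (intro that[of C]) simp_all
qed

lemma pull_mat_1: "pull \<alpha> (mat 1) = \<alpha>"
  by (intro ext) (simp add: pull_def)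

lemma \<alpha>_linear: "Im z > 0 \<Longrightarrow> \<alpha> z w = of_real (Re w) * \<alpha> z 1 + of_real (Im w) * \<alpha> z \<i>"
  by (rule C1_closed_linear[OF closed[OF mat_1_SL2Z], unfolded pull_mat_1])

definition \<Phi> :: "complex \<Rightarrow> complex" where
  "\<Phi> z = wedge \<alpha> (omega f) z 1 \<i>"

text \<open>The combination \<alpha>(i) - i \<alpha>(1) is - 2 i times the coefficient of the
  conjugate differential, the only part of \<alpha> surviving the wedge with f dz. It scales by
  \<open>cnj k\<close>, while f dz scales by k, which together give the Jacobian.\<close>

lemma slash4_\<Phi>:
  assumes "A \<in> SL2Z" "Im z > 0"
  shows "slash4 \<Phi> A z = - 2 * of_real pi * \<i> * (slash2 f A z * (pull \<alpha> A z \<i> - \<i> * pull \<alpha> A z 1))"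
proof -
  define k where "k = 1 / (aut_factor A z)\<^sup>2"
  let ?z = "act A z"
  note lin = \<alpha>_linear[OF Im_act_pos[OF assms]]
  have k: "w / (aut_factor A z)\<^sup>2 = w * k" for w
    by (simp add: k_def)
  have "\<alpha> ?z (\<i> * k) - \<i> * \<alpha> ?z k = cnj k * (\<alpha> ?z \<i> - \<i> * \<alpha> ?z 1)"
    unfolding lin[of "\<i> * k"] lin[of k] by (simp add: complex_eq_iff algebra_simps)
  then have 1: "slash2 f A z * (pull \<alpha> A z \<i> - \<i> * pull \<alpha> A z 1) = (k * cnj k) * (f ?z * (\<alpha> ?z \<i> - \<i> * \<alpha> ?z 1))"
    unfolding pull_def k by (simp add: slash2_def k_def)
  have 2: "slash4 \<Phi> A z = (k * cnj k) * \<Phi> ?z"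
    unfolding slash4_def k_def[symmetric] scaleR_conv_of_real complex_norm_square ..
  have 3: "\<Phi> ?z = - 2 * of_real pi * \<i> * (f ?z * (\<alpha> ?z \<i> - \<i> * \<alpha> ?z 1))"
    by (simp add: \<Phi>_def wedge_def omega_def algebra_simps)
  show ?thesis
    unfolding 1 2 3 by (rule mult.left_commute)
qed

lemma slash4_mat_1: "slash4 \<Phi> (mat 1) = \<Phi>"
  by (intro ext) (simp add: slash4_def)

lemma \<Phi>_invariant:
  assumes "A \<in> Gamma1 N" "Im z > 0"
  shows "slash4 \<Phi> A z = \<Phi> z"
proof -
  have row: "bottom_row N A = bottom_row N (mat 1)"
    using Gamma1_mult_row[OF N assms(1), of "mat 1"] by simp
  note A = Gamma1_SL2Z[OF assms(1)]
  have "slash4 \<Phi> A z = slash4 \<Phi> (mat 1) z"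
    using slash2_row[OF A mat_1_SL2Z row assms(2)] pull_row[OF A mat_1_SL2Z row assms(2)]
    by (simp add: slash4_\<Phi>[OF A assms(2)] slash4_\<Phi>[OF mat_1_SL2Z assms(2)])
  then show ?thesis by (simp add: slash4_mat_1)
qed

lemma continuous_slash4_\<Phi>: "A \<in> SL2Z \<Longrightarrow> continuous_on upper_half_plane (slash4 \<Phi> A)"
proof -
  assume A: "A \<in> SL2Z"
  have "continuous_on upper_half_plane (\<lambda>z. - 2 * of_real pi * \<i> * (slash2 f A z * (pull \<alpha> A z \<i> - \<i> * pull \<alpha> A z 1)))"
    by (intro continuous_intros C1_closed_continuous closed A holomorphic_on_imp_continuous_on holomorphic_slash2 f_hol)
  then show ?thesis
    by (rule continuous_on_eq) (simp add: slash4_\<Phi>[OF A])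
qed

lemma continuous_\<Phi>: "continuous_on upper_half_plane \<Phi>"
  using continuous_slash4_\<Phi>[OF mat_1_SL2Z] by (simp add: slash4_mat_1)

lemma decay_pos: "2 * pi / real N > 0"
  using N by simp

lemma integrable_slash4_\<Phi>:
  assumes A: "A \<in> SL2Z"
  shows "set_integrable lborel fund (slash4 \<Phi> A)"
proof -
  define c where "c = 2 * pi / real N"
  have c: "c > 0" using decay_pos by (simp add: c_def)
  obtain C where C: "C \<ge> 0" "\<And>z. Im z \<ge> 1 / 2 \<Longrightarrow> cmod (slash2 f A z) \<le> C * exp (- (2 * pi / N) * Im z)"
    by (rule cusp_form_decay[OF N f A]) (rule that)
  obtain C' where C': "C' \<ge> 0" "\<And>z w. Im z \<ge> 1 / 2 \<Longrightarrow> cmod (pull \<alpha> A z w) \<le> C' * Im z * cmod w"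
    by (rule growth[OF A]) (rule that)
  show ?thesis
  proof (rule set_integrable_fund[OF continuous_slash4_\<Phi>[OF A]])
    show "c / 2 > 0" using c by simp
    fix z :: complex assume z: "Im z > 1 / 2"
    have "cmod (pull \<alpha> A z \<i> - \<i> * pull \<alpha> A z 1) \<le> cmod (pull \<alpha> A z \<i>) + cmod (\<i> * pull \<alpha> A z 1)"
      by (rule norm_triangle_ineq4)
    also have "\<dots> \<le> 2 * C' * Im z"
      using C'(2)[of z \<i>] C'(2)[of z 1] z by (simp add: norm_mult)
    finally have pull: "cmod (pull \<alpha> A z \<i> - \<i> * pull \<alpha> A z 1) \<le> 2 * C' * Im z" .
    have "cmod (slash4 \<Phi> A z) = 2 * pi * (cmod (slash2 f A z) * cmod (pull \<alpha> A z \<i> - \<i> * pull \<alpha> A z 1))"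
      using z by (simp add: slash4_\<Phi>[OF A] norm_mult)
    also have "\<dots> \<le> 2 * pi * ((C * exp (- c * Im z)) * (2 * C' * Im z))"
      using C(2)[of z] C(1) z pull unfolding c_def by (intro mult_left_mono mult_mono) auto
    also have "\<dots> = 2 * pi * C * (2 * C') * (Im z * exp (- c * Im z))"
      by (simp add: mult_ac)
    also have "\<dots> \<le> 2 * pi * C * (2 * C') * (2 / c * exp (- (c / 2) * Im z))"
      using exp_times_linear_bound[OF c, of "Im z"] z C(1) C'(1) by (intro mult_left_mono) auto
    finally show "cmod (slash4 \<Phi> A z) \<le> 2 * pi * C * (2 * C') * (2 / c) * exp (- (c / 2) * Im z)"
      by (simp add: mult_ac)
  qed
qed

definition side :: "int ^ 2 ^ 2 \<Rightarrow> real \<Rightarrow> real \<Rightarrow> complex" where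
  "side A x T = integral {0..T} (\<lambda>t. prim A (strip x t) * pull \<alpha> A (strip x t) \<i>)"

definition arc_int :: "int ^ 2 ^ 2 \<Rightarrow> real \<Rightarrow> complex" where
  "arc_int A t = integral {- 1 / 2..1 / 2} (\<lambda>x. prim A (strip x t) * pull \<alpha> A (strip x t) (strip_dx x))"

text \<open>The sign reverses because the wedge has \<alpha> first, whereas
  \<open>stokes_strip\<close> integrates G' dz wedge \<beta>.\<close>

lemma strip_integral:
  assumes A: "A \<in> SL2Z" and T: "T \<ge> 0"
  shows "integral {- 1 / 2..1 / 2} (\<lambda>x. integral {0..T} (\<lambda>t. slash4 \<Phi> A (strip x t))) =
    - 2 * of_real pi * \<i> * (side A (1 / 2) T - side A (- 1 / 2) T - arc_int A T + arc_int A 0)"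
proof -
  let ?c = "- 2 * of_real pi * \<i> :: complex"
  let ?h = "\<lambda>x t. slash2 f A (strip x t) * (pull \<alpha> A (strip x t) \<i> - \<i> * pull \<alpha> A (strip x t) 1)"
  have "integral {- 1 / 2..1 / 2} (\<lambda>x. integral {0..T} (\<lambda>t. slash4 \<Phi> A (strip x t)))
    = integral {- 1 / 2..1 / 2} (\<lambda>x. ?c * integral {0..T} (?h x))"
  proof (rule integral_cong)
    fix x :: real assume x: "x \<in> {- 1 / 2..1 / 2}"
    have "integral {0..T} (\<lambda>t. slash4 \<Phi> A (strip x t)) = integral {0..T} (\<lambda>t. ?c * ?h x t)"
      using Im_strip[OF x] by (intro integral_cong slash4_\<Phi>[OF A]) force
    then show "integral {0..T} (\<lambda>t. slash4 \<Phi> A (strip x t)) = ?c * integral {0..T} (?h x)"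
      by (simp only: integral_mult_right)
  qed
  also have "\<dots> = ?c * integral {- 1 / 2..1 / 2} (\<lambda>x. integral {0..T} (?h x))"
    by (rule integral_mult_right)
  also have "integral {- 1 / 2..1 / 2} (\<lambda>x. integral {0..T} (?h x))
      = side A (1 / 2) T - side A (- 1 / 2) T - arc_int A T + arc_int A 0"
    unfolding side_def arc_int_def
    by (rule stokes_strip[OF closed[OF A] prim_deriv[OF A] holomorphic_on_imp_continuous_on[OF holomorphic_slash2[OF f_hol A]] T])
  finally show ?thesis .
qed

lemma side_shift:
  assumes A: "A \<in> SL2Z"
  shows "side A (1 / 2) T = side (A ** matT 1) (- 1 / 2) T"
  unfolding side_def
proof (rule integral_cong)
  fix t assume "t \<in> {0..T}"
  then have pos: "Im (strip (- 1 / 2) t) > 0"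
    using Im_strip[of "- 1 / 2" t] by simp
  have shift: "strip (1 / 2) t = strip (- 1 / 2) t + 1"
    by (simp add: strip_def complex_eq_iff power2_eq_square)
  show "prim A (strip (1 / 2) t) * pull \<alpha> A (strip (1 / 2) t) \<i>
      = prim (A ** matT 1) (strip (- 1 / 2) t) * pull \<alpha> (A ** matT 1) (strip (- 1 / 2) t) \<i>"
    unfolding shift using prim_T[OF A pos] pull_mult[OF A matT_SL2Z pos, of \<alpha> 1 \<i>] by simp
qed

lemma sum_side:
  "(\<Sum>x\<in>E_set N. side (g x) (1 / 2) T) = (\<Sum>x\<in>E_set N. side (g x) (- 1 / 2) T)"
proof -
  have "(\<Sum>x\<in>E_set N. side (g x) (1 / 2) T) = (\<Sum>x\<in>E_set N. side (g x ** matT 1) (- 1 / 2) T)"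
    by (intro sum.cong refl side_shift g_SL2Z)
  also have "\<dots> = (\<Sum>x\<in>E_set N. side (g x) (- 1 / 2) T)"
  proof (rule sum_E_set_mult[OF N g _ matT_SL2Z])
    fix A B assume AB: "A \<in> SL2Z" "B \<in> SL2Z" "bottom_row N A = bottom_row N B"
    show "side A (- 1 / 2) T = side B (- 1 / 2) T"
      unfolding side_def
    proof (rule integral_cong)
      fix t assume "t \<in> {0..T}"
      then have pos: "Im (strip (- 1 / 2) t) > 0"
        using Im_strip[of "- 1 / 2" t] by simp
      show "prim A (strip (- 1 / 2) t) * pull \<alpha> A (strip (- 1 / 2) t) \<i>
          = prim B (strip (- 1 / 2) t) * pull \<alpha> B (strip (- 1 / 2) t) \<i>"
        using prim_row[OF AB pos] pull_row[OF AB pos] by simp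
    qed
  qed
  finally show ?thesis .
qed

lemma arc_row:
  assumes "A \<in> SL2Z" "B \<in> SL2Z" "bottom_row N A = bottom_row N B"
  shows "arc_int A 0 = arc_int B 0"
  unfolding arc_int_def
proof (rule integral_cong)
  fix x :: real assume "x \<in> {- 1 / 2..1 / 2}"
  then have pos: "Im (strip x 0) > 0"
    using Im_strip[of x 0] by simp
  show "prim A (strip x 0) * pull \<alpha> A (strip x 0) (strip_dx x) = prim B (strip x 0) * pull \<alpha> B (strip x 0) (strip_dx x)"
    using prim_row[OF assms pos] pull_row[OF assms pos] by simp
qed

lemma arc_integrand_continuous:
  assumes A: "A \<in> SL2Z" and t: "t \<ge> 0"
  shows "continuous_on {- 1 / 2..1 / 2} (\<lambda>x. pull \<alpha> A (strip x t) (strip_dx x))"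
proof -
  have pos: "Im (strip x t) > 0" if "x \<in> {- 1 / 2..1 / 2}" for x
    using Im_strip[OF that t] by simp
  have *: "continuous_on {- 1 / 2..1 / 2} (\<lambda>x. pull \<alpha> A (strip x t) w)" for w
    by (rule continuous_on_compose2[OF C1_closed_continuous[OF closed[OF A]]])
       (auto intro!: continuous_intros pos)
  have "continuous_on {- 1 / 2..1 / 2} (\<lambda>x. of_real (Re (strip_dx x)) * pull \<alpha> A (strip x t) 1
      + of_real (Im (strip_dx x)) * pull \<alpha> A (strip x t) \<i>)"
    by (intro continuous_intros * continuous_on_strip_dx) auto
  then show ?thesis
    by (rule continuous_on_eq) (rule C1_closed_linear[OF closed[OF A] pos, symmetric])
qed

lemma continuous_prim: "A \<in> SL2Z \<Longrightarrow> continuous_on upper_half_plane (prim A)"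
  by (rule DERIV_continuous_on[OF has_field_derivative_at_within[OF prim_deriv]]) auto

lemma continuous_prim_strip:
  assumes A: "A \<in> SL2Z" and t: "t \<ge> 0"
  shows "continuous_on {- 1 / 2..1 / 2} (\<lambda>x. prim A (strip x t))"
proof -
  have pos: "Im (strip x t) > 0" if "x \<in> {- 1 / 2..1 / 2}" for x
    using Im_strip[OF that t] by simp
  show ?thesis
    by (rule continuous_on_compose2[OF continuous_prim[OF A]]) (auto intro!: continuous_intros pos)
qed

lemma arc_tendsto_0:
  assumes A: "A \<in> SL2Z"
  shows "(\<lambda>n. arc_int A (real n)) \<longlonglongrightarrow> 0"
proof -
  define c where "c = 2 * pi / real N"
  have c: "c > 0" using decay_pos by (simp add: c_def)
  obtain C where C: "C \<ge> 0" "\<And>z. Im z \<ge> 1 / 2 \<Longrightarrow> cmod (prim A z) \<le> C * exp (- c * Im z)"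
    using is_prim_prim[OF A] by (auto simp: is_prim_def c_def)
  obtain C' where C': "C' \<ge> 0" "\<And>z w. Im z \<ge> 1 / 2 \<Longrightarrow> cmod (pull \<alpha> A z w) \<le> C' * Im z * cmod w"
    by (rule growth[OF A]) (rule that)
  define K where "K = C * (2 * C') * (2 / c)"
  have K: "K \<ge> 0" using C(1) C'(1) c by (simp add: K_def)
  have bound: "cmod (arc_int A t) \<le> K * exp (- (c / 2) * t)" if t: "t \<ge> 0" for t
  proof -
    have "norm (arc_int A t) \<le> K * exp (- (c / 2) * t) * (1 / 2 - (- 1 / 2))"
      unfolding arc_int_def
    proof (rule integral_bound)
      show "continuous_on {- 1 / 2..1 / 2} (\<lambda>x. prim A (strip x t) * pull \<alpha> A (strip x t) (strip_dx x))"
        by (intro continuous_intros continuous_prim_strip arc_integrand_continuous A t)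
      fix x :: real assume x: "x \<in> {- 1 / 2..1 / 2}"
      let ?y = "Im (strip x t)"
      have y: "?y \<ge> 1 / 2" using Im_strip[OF x t] by simp
      have yt: "?y \<ge> t" using arc_pos[OF x] by (simp add: strip_def)
      \<comment> \<open>By the bounds |x| \<le> 1/2 and sqrt (1 - x^2) > 1/2 the slope is at most
        1.\<close>
      have dx: "cmod (strip_dx x) \<le> 2"
      proof -
        have "\<bar>x / sqrt (1 - x\<^sup>2)\<bar> \<le> (1 / 2) / (1 / 2)"
          unfolding abs_divide using arc_pos[OF x] x by (intro frac_le) auto
        then show ?thesis
          using cmod_le[of "strip_dx x"] by (simp add: strip_dx_def)
      qed
      have "cmod (prim A (strip x t) * pull \<alpha> A (strip x t) (strip_dx x)) \<le> (C * exp (- c * ?y)) * (C' * ?y * 2)"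
        unfolding norm_mult
      proof (rule mult_mono)
        show "cmod (pull \<alpha> A (strip x t) (strip_dx x)) \<le> C' * ?y * 2"
          using C'(1) y dx by (intro order.trans[OF C'(2)[OF y]] mult_left_mono) auto
      qed (use C C' y in auto)
      also have "\<dots> = C * (2 * C') * (?y * exp (- c * ?y))"
        by (simp add: mult_ac)
      also have "\<dots> \<le> C * (2 * C') * (2 / c * exp (- (c / 2) * ?y))"
        using exp_times_linear_bound[OF c, of ?y] y C(1) C'(1) by (intro mult_left_mono) auto
      also have "\<dots> = K * exp (- (c / 2) * ?y)"
        by (simp add: K_def)
      also have "\<dots> \<le> K * exp (- (c / 2) * t)"
        using yt c K by (intro mult_left_mono) auto
      finally show "norm (prim A (strip x t) * pull \<alpha> A (strip x t) (strip_dx x)) \<le> K * exp (- (c / 2) * t)" .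
    qed simp
    then show ?thesis by simp
  qed
  have "(\<lambda>n. K * exp (- (c / 2) * real n)) \<longlonglongrightarrow> 0"
    using c by (intro tendsto_mult_right_zero filterlim_compose[OF tendsto_exp_neg filterlim_real_sequentially]) simp
  then show ?thesis
    by (rule Lim_null_comparison[rotated]) (intro always_eventually allI bound, simp)
qed

lemma integral_arc_form:
  assumes H: "\<And>z. Im z > 0 \<Longrightarrow> (H has_derivative \<alpha> z) (at z)" and A: "A \<in> SL2Z"
  shows "integral {- 1 / 2..1 / 2} (\<lambda>x. pull \<alpha> A (strip x 0) (strip_dx x)) = H (act A rho) - H (act A (rho ^ 2))"
proof -
  have "((\<lambda>x. pull \<alpha> A (strip x 0) (strip_dx x)) has_integral
      (H (act A (strip (1 / 2) 0)) - H (act A (strip (- 1 / 2) 0)))) {- 1 / 2..1 / 2}"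
  proof (rule fundamental_theorem_of_calculus)
    fix x :: real assume x: "x \<in> {- 1 / 2..1 / 2}"
    have pos: "Im (strip x 0) > 0" using Im_strip[OF x] by force
    have "((\<lambda>x. act A (strip x 0)) has_vector_derivative strip_dx x * (1 / (aut_factor A (strip x 0))\<^sup>2)) (at x within {- 1 / 2..1 / 2})"
      by (rule field_vector_diff_chain_within[OF strip_dx_vector_derivative[OF x], unfolded o_def])
         (rule has_field_derivative_act[OF A pos])
    then have "((\<lambda>x. act A (strip x 0)) has_vector_derivative strip_dx x / (aut_factor A (strip x 0))\<^sup>2) (at x within {- 1 / 2..1 / 2})"
      by simp
    from vector_derivative_diff_chain_within[OF this has_derivative_at_withinI[OF H[OF Im_act_pos[OF A pos]]]]
    show "((\<lambda>x. H (act A (strip x 0))) has_vector_derivative pull \<alpha> A (strip x 0) (strip_dx x)) (at x within {- 1 / 2..1 / 2})"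
      by (simp add: o_def pull_def)
  qed simp
  then show ?thesis
    unfolding rho_strip(2) unfolding rho_strip(1) by (rule integral_unique)
qed

lemma rho_upper: "Im rho > 0" "Im (rho ^ 2) > 0"
  unfolding rho_strip(2) unfolding rho_strip(1)
  using Im_strip[of "1 / 2" 0] Im_strip[of "- 1 / 2" 0] by simp_all

lemma act_matS_rho: "act matS rho = rho ^ 2" "act matS (rho ^ 2) = rho"
  unfolding rho_strip(2) unfolding rho_strip(1)
  using strip_0_neg[of "1 / 2"] strip_0_neg[of "- 1 / 2"] by simp_all

lemma arc_inversion:
  assumes H: "\<And>z. Im z > 0 \<Longrightarrow> (H has_derivative \<alpha> z) (at z)" and A: "A \<in> SL2Z"
  shows "arc_int A 0 = - arc_int (A ** matS) 0 + period A * (H (act A (rho ^ 2)) - H (act A rho))"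
proof -
  have AS: "A ** matS \<in> SL2Z" using A by (simp add: SL2Z_mult)
  let ?X = "{- 1 / 2..1 / 2 :: real}"
  have pt: "prim A (strip (- x) 0) * pull \<alpha> A (strip (- x) 0) (strip_dx (- x)) =
      period A * pull \<alpha> (A ** matS) (strip x 0) (strip_dx x)
      - prim (A ** matS) (strip x 0) * pull \<alpha> (A ** matS) (strip x 0) (strip_dx x)" if x: "x \<in> ?X" for x
  proof -
    let ?z = "strip x 0"
    have pos: "Im ?z > 0" using Im_strip[OF x] by force
    then have nz: "?z \<noteq> 0" by auto
    have mx: "- x \<in> ?X" using x by auto
    have S: "strip (- x) 0 = - 1 / ?z" using strip_0_neg[OF x] by simp
    have posS: "Im (strip (- x) 0) > 0" using Im_strip[OF mx] by force
    \<comment> \<open>The result of differentiating strip (- x) 0 = - 1 / strip x 0.\<close>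
    have dx: "strip_dx (- x) = - (strip_dx x / ?z\<^sup>2)"
    proof -
      have s: "sqrt (1 - x\<^sup>2) \<noteq> 0" "(sqrt (1 - x\<^sup>2))\<^sup>2 = 1 - x\<^sup>2"
        using arc_pos[OF x] by auto
      have "strip_dx (- x) * ?z\<^sup>2 = - strip_dx x"
        using s by (simp add: strip_dx_def strip_def complex_eq_iff power2_eq_square field_simps)
      then show ?thesis using nz by (simp add: field_simps)
    qed
    have "pull \<alpha> A (strip (- x) 0) (- w) = - pull \<alpha> A (strip (- x) 0) w" for w
      using C1_closed_linear[OF closed[OF A] posS, of w] C1_closed_linear[OF closed[OF A] posS, of "- w"] by simp
    then have "pull \<alpha> A (strip (- x) 0) (strip_dx (- x)) = - pull \<alpha> A (- 1 / ?z) (strip_dx x / ?z\<^sup>2)"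
      unfolding dx S by simp
    also have "\<dots> = - pull \<alpha> (A ** matS) ?z (strip_dx x)"
      using pull_mult[OF A matS_SL2Z pos, of \<alpha> "strip_dx x"] by simp
    finally have 1: "pull \<alpha> A (strip (- x) 0) (strip_dx (- x)) = - pull \<alpha> (A ** matS) ?z (strip_dx x)" .
    have 2: "prim A (strip (- x) 0) = prim (A ** matS) ?z - period A"
      unfolding S by (rule prim_S[OF A pos])
    show ?thesis
      unfolding 1 2 by (simp add: algebra_simps)
  qed
  have "arc_int A 0 = integral ?X (\<lambda>x. prim A (strip (- x) 0) * pull \<alpha> A (strip (- x) 0) (strip_dx (- x)))"
  proof -
    have X: "?X = {- (1 / 2)..- (- 1 / 2)}" by simp
    have reflect: "integral ?X F = integral ?X (\<lambda>x. F (- x))" for F :: "real \<Rightarrow> complex"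
      using has_integral_reflect_real[of F _ "1 / 2" "- 1 / 2"] X unfolding integral_def integrable_on_def by simp
    show ?thesis
      unfolding arc_int_def by (rule reflect)
  qed
  also have "\<dots> = integral ?X (\<lambda>x. period A * pull \<alpha> (A ** matS) (strip x 0) (strip_dx x)
      - prim (A ** matS) (strip x 0) * pull \<alpha> (A ** matS) (strip x 0) (strip_dx x))"
    by (rule integral_cong) (rule pt)
  also have "\<dots> = integral ?X (\<lambda>x. period A * pull \<alpha> (A ** matS) (strip x 0) (strip_dx x)) - arc_int (A ** matS) 0"
    unfolding arc_int_def
    by (intro integral_diff integrable_continuous_real continuous_intros arc_integrand_continuous continuous_prim_strip AS) simp_all
  also have "integral ?X (\<lambda>x. period A * pull \<alpha> (A ** matS) (strip x 0) (strip_dx x))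
      = period A * (H (act (A ** matS) rho) - H (act (A ** matS) (rho ^ 2)))"
    by (simp only: integral_mult_right integral_arc_form[OF H AS])
  also have "act (A ** matS) rho = act A (rho ^ 2)"
    using A rho_upper by (simp only: act_mult matS_SL2Z act_matS_rho)
  also have "act (A ** matS) (rho ^ 2) = act A rho"
    using A rho_upper by (simp only: act_mult matS_SL2Z act_matS_rho)
  finally show ?thesis by simp
qed

text \<open>Since \<open>matS\<close> permutes the cosets, summing \<open>arc_inversion\<close>
  expresses the total as minus itself plus the period terms.\<close>

lemma sum_arc:
  assumes H: "\<And>z. Im z > 0 \<Longrightarrow> (H has_derivative \<alpha> z) (at z)"
  shows "2 * (\<Sum>x\<in>E_set N. arc_int (g x) 0) =
    (\<Sum>x\<in>E_set N. period (g x) * (H (act (g x) (rho ^ 2)) - H (act (g x) rho)))"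
proof -
  have "(\<Sum>x\<in>E_set N. arc_int (g x) 0) = - (\<Sum>x\<in>E_set N. arc_int (g x ** matS) 0)
    + (\<Sum>x\<in>E_set N. period (g x) * (H (act (g x) (rho ^ 2)) - H (act (g x) rho)))"
    unfolding sum_negf[symmetric] sum.distrib[symmetric]
    by (intro sum.cong refl arc_inversion[OF H g_SL2Z])
  also have "(\<Sum>x\<in>E_set N. arc_int (g x ** matS) 0) = (\<Sum>x\<in>E_set N. arc_int (g x) 0)"
    by (rule sum_E_set_mult[OF N g arc_row matS_SL2Z])
  finally show ?thesis by simp
qed

lemma sum_integral_fund:
  assumes H: "\<And>z. Im z > 0 \<Longrightarrow> (H has_derivative \<alpha> z) (at z)"
  shows "(\<Sum>x\<in>E_set N. LINT z:fund|lborel. slash4 \<Phi> (g x) z) =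
    of_real pi * (\<Sum>x\<in>E_set N. (H (act (g x) (rho ^ 2)) - H (act (g x) rho)) * manin_symbol f (g x))"
proof -
  let ?I = "\<lambda>A n. integral {- 1 / 2..1 / 2} (\<lambda>x. integral {0..real n} (\<lambda>t. slash4 \<Phi> A (strip x t)))"
  have lim1: "(\<lambda>n. \<Sum>x\<in>E_set N. ?I (g x) n) \<longlonglongrightarrow> (\<Sum>x\<in>E_set N. LINT z:fund|lborel. slash4 \<Phi> (g x) z)"
    by (intro tendsto_sum integral_fund_limit continuous_slash4_\<Phi> integrable_slash4_\<Phi> g_SL2Z)
  have eq: "(\<Sum>x\<in>E_set N. ?I (g x) n) = - 2 * of_real pi * \<i> *
      ((\<Sum>x\<in>E_set N. arc_int (g x) 0) - (\<Sum>x\<in>E_set N. arc_int (g x) (real n)))" for n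
  proof -
    have "(\<Sum>x\<in>E_set N. ?I (g x) n) = (\<Sum>x\<in>E_set N. - 2 * of_real pi * \<i> *
        (side (g x) (1 / 2) (real n) - side (g x) (- 1 / 2) (real n) - arc_int (g x) (real n) + arc_int (g x) 0))"
      by (intro sum.cong refl strip_integral g_SL2Z) simp_all
    also have "\<dots> = - 2 * of_real pi * \<i> * ((\<Sum>x\<in>E_set N. side (g x) (1 / 2) (real n))
       - (\<Sum>x\<in>E_set N. side (g x) (- 1 / 2) (real n)) - (\<Sum>x\<in>E_set N. arc_int (g x) (real n)) + (\<Sum>x\<in>E_set N. arc_int (g x) 0))"
      by (simp only: sum_distrib_left[symmetric] sum_subtractf sum.distrib)
    finally show ?thesis
      unfolding sum_side by simp
  qed
  have "(\<lambda>n. \<Sum>x\<in>E_set N. arc_int (g x) (real n)) \<longlonglongrightarrow> (\<Sum>x\<in>E_set N. 0)"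
    by (intro tendsto_sum arc_tendsto_0 g_SL2Z)
  then have "(\<lambda>n. \<Sum>x\<in>E_set N. arc_int (g x) (real n)) \<longlonglongrightarrow> 0"
    by simp
  then have "(\<lambda>n. - 2 * of_real pi * \<i> * ((\<Sum>x\<in>E_set N. arc_int (g x) 0) - (\<Sum>x\<in>E_set N. arc_int (g x) (real n))))
      \<longlonglongrightarrow> - 2 * of_real pi * \<i> * ((\<Sum>x\<in>E_set N. arc_int (g x) 0) - 0)"
    by (intro tendsto_intros)
  then have "(\<Sum>x\<in>E_set N. LINT z:fund|lborel. slash4 \<Phi> (g x) z) = - 2 * of_real pi * \<i> * (\<Sum>x\<in>E_set N. arc_int (g x) 0)"
    using lim1 unfolding eq by (simp add: LIMSEQ_unique)
  \<comment> \<open>The 2 is split off to match \<open>sum_arc\<close>; the remaining - i times the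
    period is the Manin symbol.\<close>
  also have "\<dots> = - of_real pi * \<i> * (2 * (\<Sum>x\<in>E_set N. arc_int (g x) 0))"
    by simp
  also have "2 * (\<Sum>x\<in>E_set N. arc_int (g x) 0) =
      (\<Sum>x\<in>E_set N. period (g x) * (H (act (g x) (rho ^ 2)) - H (act (g x) rho)))"
    by (rule sum_arc) (rule H)
  also have "- of_real pi * \<i> * \<dots> = of_real pi * (\<Sum>x\<in>E_set N. (H (act (g x) (rho ^ 2)) - H (act (g x) rho)) * manin_symbol f (g x))"
    unfolding sum_distrib_left
    by (intro sum.cong refl) (simp add: manin_symbol_period[OF g_SL2Z])
  finally show ?thesis .
qed

end

section \<open>Vanishing of cusp forms at levels 1 and 2\<close>

lemma open_fund_int: "open fund_int"
proof -
  have eq: "fund_int = {z. 0 < Im z} \<inter> {z. \<bar>Re z\<bar> < 1 / 2} \<inter> {z. 1 < cmod z}"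
    by (auto simp: fund_int_def)
  show ?thesis
    unfolding eq by (intro open_Int open_Collect_less continuous_intros)
qed

context period_data
begin

text \<open>H composed with A and with B have the same derivative, the pullback of an invariant
  form, so they differ by a constant.\<close>

lemma potential_difference_row:
  assumes H: "\<And>z. Im z > 0 \<Longrightarrow> (H has_derivative \<alpha> z) (at z)"
    and AB: "A \<in> SL2Z" "B \<in> SL2Z" "bottom_row N A = bottom_row N B" and zw: "Im z > 0" "Im w > 0"
  shows "H (act A z) - H (act A w) = H (act B z) - H (act B w)"
proof -
  have d: "((\<lambda>z. H (act A z)) has_derivative pull \<alpha> A z) (at z)" if A: "A \<in> SL2Z" and z: "Im z > 0" for A z
  proof -
    have "(act A has_derivative (\<lambda>w. 1 / (aut_factor A z)\<^sup>2 * w)) (at z)"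
      using has_field_derivative_act[OF A z] unfolding has_field_derivative_def .
    from has_derivative_compose[OF this H[OF Im_act_pos[OF A z]]] show ?thesis
      by (simp add: pull_def[abs_def])
  qed
  have "\<exists>c. \<forall>x\<in>upper_half_plane. H (act A x) - H (act B x) = c"
  proof (rule has_derivative_zero_constant[OF convex_upper_half_plane])
    fix x :: complex assume "x \<in> upper_half_plane"
    then have x: "Im x > 0" by simp
    have "((\<lambda>x. H (act A x) - H (act B x)) has_derivative (\<lambda>w. pull \<alpha> A x w - pull \<alpha> B x w)) (at x)"
      by (intro has_derivative_diff d AB x)
    then have "((\<lambda>x. H (act A x) - H (act B x)) has_derivative (\<lambda>w. 0)) (at x)"
      by (simp add: pull_row[OF AB x])
    then show "((\<lambda>x. H (act A x) - H (act B x)) has_derivative (\<lambda>w. 0)) (at x within upper_half_plane)"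
      by (rule has_derivative_at_withinI)
  qed
  then obtain c where "\<forall>x\<in>upper_half_plane. H (act A x) - H (act B x) = c" by blast
  then have "H (act A z) - H (act B z) = H (act A w) - H (act B w)"
    using zw by simp
  then show ?thesis by (simp add: algebra_simps)
qed

end

text \<open>For \<open>N \<le> 2\<close> the group contains \<open>- 1\<close>, so the sum over \<open>E\<^sub>N\<close> counts each coset only once and
  the factor in the formula would be wrong. Both sides vanish in this case: all the arc integrals of
  \<open>cnj f\<close> are zero by the relations between bottom rows, and the formula for the form \<open>cnj (f dz)\<close>
  then says that the Petersson norm of \<open>f\<close> is zero.\<close>

lemma cusp_forms2_level_le_2:
  assumes N: "N \<ge> 1" "N \<le> 2" and f: "f \<in> cusp_forms2 N"
    and g: "\<And>x. x \<in> E_set N \<Longrightarrow> lifts N (g x) x" and z: "Im z > 0"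
  shows "f z = 0"
proof -
  interpret period_data N f "\<lambda>z w. cnj (f z * w)" g
    by unfold_locales (use N f g tame_cnj in auto)
  define H where "H z = cnj (prim (mat 1) z)" for z
  have H: "(H has_derivative (\<lambda>w. cnj (f z * w))) (at z)" if "Im z > 0" for z
    using has_derivative_cnj[OF prim_deriv[OF mat_1_SL2Z that, unfolded has_field_derivative_def]]
    by (simp add: H_def[abs_def] slash2_def)
  define P where "P A = H (act A (rho ^ 2)) - H (act A rho)" for A
  have P_row: "P A = P B" if "A \<in> SL2Z" "B \<in> SL2Z" "bottom_row N A = bottom_row N B" for A B
    unfolding P_def by (rule potential_difference_row[OF H that rho_upper(2,1)])
  have P_S: "P (A ** matS) = - P A" if "A \<in> SL2Z" for A
    using that rho_upper by (simp add: P_def act_mult act_matS_rho del: act_matS)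
  \<comment> \<open>The end points differ by the translation 1, which fixes the bottom row (0, 1) of
    the identity; so the primitive is 1-periodic.\<close>
  have P_1: "P (mat 1) = 0"
  proof -
    have "rho = rho ^ 2 + 1"
      unfolding rho_strip(2) unfolding rho_strip(1) by (simp add: strip_def complex_eq_iff power2_eq_square)
    then have "prim (mat 1) rho = prim (mat 1) (rho ^ 2 + 1)"
      by simp
    also have "\<dots> = prim (mat 1 ** matT 1) (rho ^ 2)"
      by (rule prim_T[OF mat_1_SL2Z rho_upper(2)])
    also have "\<dots> = prim (mat 1) (rho ^ 2)"
    proof (rule prim_row[OF _ _ _ rho_upper(2)])
      show "bottom_row N (mat 1 ** matT 1) = bottom_row N (mat 1)"
        by (simp add: bottom_row_def matT_def mat_def)
    qed (simp_all add: SL2Z_mult mat_1_SL2Z)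
    finally show ?thesis by (simp add: P_def H_def)
  qed
  have P_0: "P A = 0" if A: "A \<in> SL2Z" for A
  proof -
    \<comment> \<open>At level 1 all rows coincide. At level 2 the rows are (0, 1), (1, 0) and (1,
      1): the identity, \<open>matS\<close>, and a row fixed by \<open>matS\<close>, where P equals
      its own negative.\<close>
    have "bottom_row N A = bottom_row N (mat 1) \<or> bottom_row N A = bottom_row N (mat 1 ** matS) \<or>
        bottom_row N (A ** matS) = bottom_row N A"
    proof (cases "N = 1")
      case True
      then show ?thesis by (simp add: bottom_row_def)
    next
      case False
      then have N2: "N = 2" using assms(1,2) by simp
      have "\<not> (even (A $ 2 $ 1) \<and> even (A $ 2 $ 2))"
      proof
        assume "even (A $ 2 $ 1) \<and> even (A $ 2 $ 2)"
        then have "even (A $ 1 $ 1 * A $ 2 $ 2 - A $ 1 $ 2 * A $ 2 $ 1)" by simp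
        moreover have "A $ 1 $ 1 * A $ 2 $ 2 - A $ 1 $ 2 * A $ 2 $ 1 = 1"
          using A by (simp add: SL2Z_iff)
        ultimately show False by (simp only:) simp
      qed
      then show ?thesis
        unfolding N2 by (auto simp: bottom_row_def matS_def mat_def even_iff_mod_2_eq_zero odd_iff_mod_2_eq_one
            zmod_zminus1_eq_if)
    qed
    then show ?thesis
    proof (elim disjE)
      assume "bottom_row N A = bottom_row N (mat 1)"
      then show ?thesis using P_row[OF A mat_1_SL2Z] P_1 by simp
    next
      assume "bottom_row N A = bottom_row N (mat 1 ** matS)"
      then show ?thesis using P_row[OF A SL2Z_mult[OF mat_1_SL2Z matS_SL2Z]] P_S[OF mat_1_SL2Z] P_1 by simp
    next
      assume "bottom_row N (A ** matS) = bottom_row N A"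
      then have "P A = - P A"
        using P_row[OF SL2Z_mult[OF A matS_SL2Z] A] P_S[OF A] by simp
      then show ?thesis by simp
    qed
  qed
  define J where "J x = (LINT z:fund|lborel. (cmod (slash2 f (g x) z))\<^sup>2)" for x
  \<comment> \<open>The conjugate of dz wedged with dz is 2 i dx dy, and 2 \<pi> i * 2 i = - 4
    \<pi>.\<close>
  have s4: "slash4 \<Phi> A z = of_real (- 4 * pi) * of_real ((cmod (slash2 f A z))\<^sup>2)" if "A \<in> SL2Z" "Im z > 0" for A z
  proof -
    have pull: "pull (\<lambda>z w. cnj (f z * w)) A z w = cnj (slash2 f A z * w)" for w
      by (simp add: pull_def slash2_def)
    have "- 2 * of_real pi * \<i> * (F * (cnj (F * \<i>) - \<i> * cnj (F * 1))) = of_real (- 4 * pi) * (F * cnj F)" for F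
      by (simp add: complex_eq_iff algebra_simps)
    then show ?thesis
      unfolding slash4_\<Phi>[OF that] pull complex_norm_square .
  qed
  have integrable: "set_integrable lborel fund (\<lambda>z. complex_of_real ((cmod (slash2 f A z))\<^sup>2))" if A: "A \<in> SL2Z" for A
  proof -
    have "set_integrable lborel fund (\<lambda>z. of_real (- 1 / (4 * pi)) * slash4 \<Phi> A z)"
      by (intro set_integrable_mult_right integrable_slash4_\<Phi> A)
    also have "?this \<longleftrightarrow> ?thesis"
    proof (rule set_integrable_cong)
      fix z assume "z \<in> fund"
      then have "Im z > 0" by (simp add: fund_def)
      then show "of_real (- 1 / (4 * pi)) * slash4 \<Phi> A z = complex_of_real ((cmod (slash2 f A z))\<^sup>2)"
        unfolding s4[OF A \<open>Im z > 0\<close>] by simp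
    qed simp_all
    finally show ?thesis .
  qed
  have J: "(LINT z:fund|lborel. slash4 \<Phi> (g x) z) = of_real (- 4 * pi * J x)" if x: "x \<in> E_set N" for x
  proof -
    have "(LINT z:fund|lborel. slash4 \<Phi> (g x) z) =
        (LINT z:fund|lborel. of_real (- 4 * pi) * complex_of_real ((cmod (slash2 f (g x) z))\<^sup>2))"
    proof (rule set_lebesgue_integral_cong)
      show "\<forall>z. z \<in> fund \<longrightarrow> slash4 \<Phi> (g x) z = of_real (- 4 * pi) * complex_of_real ((cmod (slash2 f (g x) z))\<^sup>2)"
        by (intro allI impI s4[OF g_SL2Z[OF x]]) (simp add: fund_def)
    qed simp
    also have "\<dots> = of_real (- 4 * pi) * (LINT z:fund|lborel. complex_of_real ((cmod (slash2 f (g x) z))\<^sup>2))"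
      by (rule set_integral_mult_right)
    also have "(LINT z:fund|lborel. complex_of_real ((cmod (slash2 f (g x) z))\<^sup>2)) = of_real (J x)"
      unfolding J_def by (rule set_integral_complex_of_real)
    finally show ?thesis by simp
  qed
  have "complex_of_real (\<Sum>x\<in>E_set N. - 4 * pi * J x) = (\<Sum>x\<in>E_set N. LINT z:fund|lborel. slash4 \<Phi> (g x) z)"
    unfolding of_real_sum by (intro sum.cong refl J[symmetric])
  \<comment> \<open>This identity lives on the standard domain, before any unfolding, so the role of
    \<open>- mat 1\<close> does not enter.\<close>
  also have "\<dots> = of_real pi * (\<Sum>x\<in>E_set N. P (g x) * manin_symbol f (g x))"
    unfolding P_def by (rule sum_integral_fund) (rule H)
  also have "\<dots> = 0"
    by (simp add: P_0 g_SL2Z)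
  finally have "(\<Sum>x\<in>E_set N. - 4 * pi * J x) = 0"
    by (simp only: of_real_eq_0_iff)
  then have J_sum: "(\<Sum>x\<in>E_set N. J x) = 0"
    unfolding sum_distrib_left[symmetric] by simp
  have J_nonneg: "J x \<ge> 0" for x
    unfolding J_def set_lebesgue_integral_def by (rule Bochner_Integration.integral_nonneg) simp
  \<comment> \<open>One coset is enough, because \<open>act (g x)\<close> maps the half-plane onto
    itself.\<close>
  define x where "x = bottom_row N (mat 1)"
  have x: "x \<in> E_set N"
    unfolding x_def by (rule bottom_row_in_E_set[OF assms(1) mat_1_SL2Z])
  define F where "F = slash2 f (g x)"
  have gx: "g x \<in> SL2Z" using g_SL2Z[OF x] .
  have F: "F holomorphic_on upper_half_plane"
    unfolding F_def by (rule holomorphic_slash2[OF f_hol gx])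
  have "J x = 0"
    using J_sum J_nonneg sum_nonneg_eq_0_iff[OF finite_E_set, of N J] x by simp
  moreover have "integrable lborel (\<lambda>z. indicat_real fund z *\<^sub>R (cmod (F z))\<^sup>2)"
    using integrable[OF gx] unfolding set_integrable_def F_def
    by (simp add: scaleR_conv_of_real complex_of_real_integrable_eq flip: of_real_mult of_real_power)
  ultimately have "AE z in lborel. indicat_real fund z *\<^sub>R (cmod (F z))\<^sup>2 = 0"
    unfolding J_def set_lebesgue_integral_def F_def
    by (subst (asm) integral_nonneg_eq_0_iff_AE) auto
  then have "AE z in lebesgue. indicat_real fund z *\<^sub>R (cmod (F z))\<^sup>2 = 0"
    by (rule AE_completion)
  then have "AE z in lebesgue. z \<notin> {z \<in> fund_int. F z \<noteq> 0}"
    by eventually_elim (use fund_int_subset in auto)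
  then obtain Z where "Z \<in> null_sets lebesgue" "{z \<in> fund_int. F z \<noteq> 0} \<subseteq> Z"
    by (auto simp: eventually_ae_filter)
  then have neg: "negligible {z \<in> fund_int. F z \<noteq> 0}"
    by (meson negligible_iff_null_sets negligible_subset)
  have "open {z \<in> fund_int. F z \<noteq> 0}"
  proof -
    have "continuous_on fund_int F"
      using fund_int_subset by (intro continuous_on_subset[OF holomorphic_on_imp_continuous_on[OF F]]) auto
    from continuous_open_preimage[OF this open_fund_int open_Compl[OF closed_singleton[of 0]]]
    show ?thesis by (simp add: vimage_def Int_def)
  qed
  \<comment> \<open>An open null set is empty; this upgrades almost everywhere to
    everywhere.\<close>
  with neg have zero: "F z = 0" if "z \<in> fund_int" for z
    using open_not_negligible that by blast
  have F0: "F w = 0" if "Im w > 0" for w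
  proof (rule analytic_continuation[OF F open_upper_half_plane convex_connected[OF convex_upper_half_plane]])
    \<comment> \<open>2 i is an interior point of the domain, which makes the identity theorem
      applicable.\<close>
    show "2 * \<i> islimpt fund_int"
      by (rule interior_limit_point) (simp add: interior_open open_fund_int, simp add: fund_int_def)
    show "fund_int \<subseteq> upper_half_plane" using fund_int_subset by blast
  qed (use zero that in auto)
  define w where "w = act (minv (g x)) z"
  have w: "Im w > 0" unfolding w_def by (rule Im_act_pos[OF minv_SL2Z[OF gx] z])
  have "act (g x) w = z"
    unfolding w_def using gx z by simp
  with F0[OF w] aut_factor_nonzero[OF gx w] show ?thesis
    by (simp add: F_def slash2_def)
qed

theorem theorem3:
  fixes N :: nat and f u v :: "complex \<Rightarrow> complex"
    and g :: "int \<times> int \<Rightarrow> int ^ 2 ^ 2"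
    and p :: "int \<times> int \<Rightarrow> real \<Rightarrow> complex"
    and D :: "complex set"
  assumes "N \<ge> 1"
    and "f \<in> cusp_forms2 N"
    and "u \<in> modular_units N"
    and "v \<in> modular_units N"
    and "fundamental_domain N D"
    and "\<And>x. x \<in> E_set N \<Longrightarrow> lifts N (g x) x"
    and "\<And>x. x \<in> E_set N \<Longrightarrow> valid_path (p x) \<and> path_image (p x) \<subseteq> upper_half_plane
           \<and> pathstart (p x) = act (g x) rho \<and> pathfinish (p x) = act (g x) (rho ^ 2)"
  shows "integrable2 D (wedge (eta u v) (omega f))
    \<and> integral2 D (wedge (eta u v) (omega f)) =
        of_real pi / 2 *
          (\<Sum>x \<in> E_set N. path_integral1 (eta u v) (p x) * manin_symbol f (g x))"
proof (cases "N \<le> 2")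
  case True
  have f0: "f z = 0" if "Im z > 0" for z
    using cusp_forms2_level_le_2[OF assms(1) True assms(2) assms(6) that] by blast
  have D: "D \<subseteq> upper_half_plane"
    using assms(5) by (simp add: fundamental_domain_def)
  have 0: "indicat_real D z *\<^sub>R wedge (eta u v) (omega f) z 1 \<i> = 0" for z
    using D f0[of z] by (cases "z \<in> D") (auto simp: wedge_def omega_def)
  have "manin_symbol f (g x) = 0" if x: "x \<in> E_set N" for x
  proof -
    have A: "g x \<in> SL2Z"
      using assms(6)[OF x] by (simp add: lifts_def)
    have "indicat_real {0<..} t *\<^sub>R (f (act (g x) (\<i> * of_real t)) *
        vector_derivative (\<lambda>s. act (g x) (\<i> * of_real s)) (at t)) = 0" for t
      using f0 Im_act_pos[OF A, of "\<i> * of_real t"] by (cases "t > 0") auto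
    then have "(LINT t:{0<..}|lborel. f (act (g x) (\<i> * of_real t)) *
        vector_derivative (\<lambda>s. act (g x) (\<i> * of_real s)) (at t)) = 0"
      unfolding set_lebesgue_integral_def by (simp only: Bochner_Integration.integral_zero)
    then show ?thesis
      by (simp add: manin_symbol_def)
  qed
  then show ?thesis
    unfolding integrable2_def integral2_def set_integrable_def set_lebesgue_integral_def 0 by simp
next
  case False
  interpret period_data N f "eta u v" g
    by unfold_locales (use assms tame_eta in auto)
  obtain H where H: "\<And>z. Im z > 0 \<Longrightarrow> (H has_derivative eta u v z) (at z)"
    using tame unfolding tame_def by blast
  have path: "path_integral1 (eta u v) (p x) = H (act (g x) (rho ^ 2)) - H (act (g x) rho)" if x: "x \<in> E_set N" for x
    using assms(7)[OF x] path_integral1_potential[of H "eta u v" "p x"] H by simp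
  have int: "set_integrable lborel fund_int (slash4 \<Phi> (g x))" if "x \<in> E_set N" for x
    by (intro integral_fund_int continuous_slash4_\<Phi> integrable_slash4_\<Phi> g_SL2Z that)
  have N3: "N \<ge> 3" using False by simp
  have unfold: "set_integrable lborel D \<Phi>"
    "2 * (LINT z:D|lborel. \<Phi> z) = (\<Sum>x\<in>E_set N. LINT z:fund_int|lborel. slash4 \<Phi> (g x) z)"
    by (rule unfold_integral[OF N3 assms(5) g continuous_\<Phi> \<Phi>_invariant int]; assumption)+
  have "2 * (LINT z:D|lborel. \<Phi> z) = (\<Sum>x\<in>E_set N. LINT z:fund|lborel. slash4 \<Phi> (g x) z)"
    unfolding unfold(2)
    by (intro sum.cong refl integral_fund_int continuous_slash4_\<Phi> integrable_slash4_\<Phi> g_SL2Z)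
  also have "\<dots> = of_real pi * (\<Sum>x\<in>E_set N. (H (act (g x) (rho ^ 2)) - H (act (g x) rho)) * manin_symbol f (g x))"
    by (rule sum_integral_fund) (rule H)
  also have "(\<Sum>x\<in>E_set N. (H (act (g x) (rho ^ 2)) - H (act (g x) rho)) * manin_symbol f (g x))
      = (\<Sum>x\<in>E_set N. path_integral1 (eta u v) (p x) * manin_symbol f (g x))"
    by (intro sum.cong refl) (simp add: path)
  finally have "(LINT z:D|lborel. \<Phi> z) = of_real pi / 2 *
      (\<Sum>x\<in>E_set N. path_integral1 (eta u v) (p x) * manin_symbol f (g x))"
    by (simp add: field_simps)
  then show ?thesis
    using unfold(1) by (simp add: integrable2_def integral2_def \<Phi>_def[abs_def])
qed

end
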